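(* Let $n \geqslant 5$ and let $F_n$ be the free group of rank $n$. Every action of $\operatorname{SAut}(F_n)$ on a set containing fewer than $18$ elements is trivial; that is, for every set $X$ with $|X| < 18$, every group homomorphism $\operatorname{SAut}(F_n) \to \operatorname{Sym}(X)$ is trivial.
   Context: $\operatorname{SAut}(F_n)$ denotes the kernel of the composition $\operatorname{Aut}(F_n) \to \operatorname{GL}_n(\mathbb{Z}) \xrightarrow{\det} \{\pm 1\}$, where the first map is induced by abelianizing $F_n$. *)

theory Defs
  imports
    "Jordan_Normal_Form.Determinant"
    "HOL-Algebra.Sym_Groups"
    "HOL-Algebra.Group_Action"
    "HOL-Algebra.Generated_Groups"
begin

section \<open>Free groups\<close>

text \<open>The letter \<open>(s, True)\<close> stands for the generator \<open>s\<close> and \<open>(s, False)\<close> for its formal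
  inverse. The free group on \<open>S\<close> consists of the freely reduced words over these letters.\<close>

type_synonym 's letter = "'s \<times> bool"

definition inv_letter :: "'s letter \<Rightarrow> 's letter" where
  "inv_letter a = (fst a, \<not> snd a)"

definition reduced :: "'s letter list \<Rightarrow> bool" where
  "reduced = successively (\<lambda>a b. b \<noteq> inv_letter a)"

text \<open>Left multiplication of a reduced word by a single letter.\<close>

fun cons_letter :: "'s letter \<Rightarrow> 's letter list \<Rightarrow> 's letter list" where
  "cons_letter a [] = [a]"
| "cons_letter a (b # w) = (if b = inv_letter a then w else a # b # w)"

definition free_group :: "'s set \<Rightarrow> 's letter list monoid" where
  "free_group S =
    \<lparr>carrier = {w. reduced w \<and> fst ` set w \<subseteq> S}, mult = foldr cons_letter, one = []\<rparr>"

lemma inv_letter_inv_letter [simp]: "inv_letter (inv_letter a) = a"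
  by (simp add: inv_letter_def)

lemma fst_inv_letter [simp]: "fst (inv_letter a) = fst a"
  by (simp add: inv_letter_def)

lemma reduced_Nil [simp]: "reduced []"
  by (simp add: reduced_def)

lemma reduced_single [simp]: "reduced [a]"
  by (simp add: reduced_def)

lemma reduced_Cons_Cons [simp]:
  "reduced (a # b # w) \<longleftrightarrow> b \<noteq> inv_letter a \<and> reduced (b # w)"
  by (simp add: reduced_def)

lemma reduced_ConsD: "reduced (a # w) \<Longrightarrow> reduced w"
  by (cases w) auto

lemma reduced_cons_letter: "reduced w \<Longrightarrow> reduced (cons_letter a w)"
  by (cases w) (auto dest: reduced_ConsD)

lemma set_cons_letter: "set (cons_letter a w) \<subseteq> insert a (set w)"
  by (cases w) auto

lemma reduced_foldr: "reduced v \<Longrightarrow> reduced (foldr cons_letter u v)"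
  by (induction u) (auto intro: reduced_cons_letter)

lemma set_foldr: "set (foldr cons_letter u v) \<subseteq> set u \<union> set v"
  by (induction u) (use set_cons_letter in fastforce)+

lemma cons_letter_reduced: "reduced (a # w) \<Longrightarrow> cons_letter a w = a # w"
  by (cases w) auto

lemma cons_letter_cancel: "reduced w \<Longrightarrow> cons_letter a (cons_letter (inv_letter a) w) = w"
  by (cases w) (auto simp: cons_letter_reduced)

lemma foldr_cons_letter_Nil: "reduced u \<Longrightarrow> foldr cons_letter u [] = u"
proof (induction u)
  case (Cons a u)
  then show ?case using reduced_ConsD[OF Cons.prems] by (simp add: cons_letter_reduced)
qed simp

lemma foldr_cons_letter_assoc1:
  assumes "reduced w"
  shows "foldr cons_letter (cons_letter a t) w = cons_letter a (foldr cons_letter t w)"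
  using cons_letter_cancel[OF reduced_foldr[OF assms]] by (cases t) auto

lemma foldr_cons_letter_assoc:
  assumes "reduced w"
  shows "foldr cons_letter (foldr cons_letter u v) w = foldr cons_letter u (foldr cons_letter v w)"
  by (induction u) (auto simp: foldr_cons_letter_assoc1[OF assms])

lemma foldr_cons_letter_inverse:
  "foldr cons_letter (map inv_letter (rev u)) (foldr cons_letter u v) = v" if "reduced v"
  using that
proof (induction u arbitrary: v)
  case (Cons a u)
  then show ?case
    using cons_letter_cancel[of "foldr cons_letter u v" "inv_letter a"] by (simp add: reduced_foldr)
qed simp

lemma reduced_inverse: "reduced u \<Longrightarrow> reduced (map inv_letter (rev u))"
proof -
  have "inv_letter a \<noteq> b \<longleftrightarrow> a \<noteq> inv_letter b" for a b :: "'a letter"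
    by (auto simp: inv_letter_def)
  then show "reduced u \<Longrightarrow> reduced (map inv_letter (rev u))"
    unfolding reduced_def rev_map
    by (auto simp: successively_map elim!: successively_mono)
qed

lemma group_free_group: "group (free_group S)"
proof (rule groupI)
  fix x assume "x \<in> carrier (free_group S)"
  then have x: "reduced x" "fst ` set x \<subseteq> S" by (auto simp: free_group_def)
  show "\<exists>y\<in>carrier (free_group S). y \<otimes>\<^bsub>free_group S\<^esub> x = \<one>\<^bsub>free_group S\<^esub>"
  proof (rule bexI[of _ "map inv_letter (rev x)"])
    show "map inv_letter (rev x) \<otimes>\<^bsub>free_group S\<^esub> x = \<one>\<^bsub>free_group S\<^esub>"
      using foldr_cons_letter_inverse[of "[]" x] foldr_cons_letter_Nil[OF x(1)]
      by (simp add: free_group_def)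
    show "map inv_letter (rev x) \<in> carrier (free_group S)"
      using x reduced_inverse by (auto simp: free_group_def)
  qed
next
  fix x y assume "x \<in> carrier (free_group S)" "y \<in> carrier (free_group S)"
  then show "x \<otimes>\<^bsub>free_group S\<^esub> y \<in> carrier (free_group S)"
    using set_foldr[of x y] by (fastforce simp: free_group_def reduced_foldr)
qed (auto simp: free_group_def foldr_cons_letter_assoc)

lemma one_free_group: "\<one>\<^bsub>free_group S\<^esub> = []"
  by (simp add: free_group_def)

lemma Cons_free_group:
  assumes "a # w \<in> carrier (free_group S)"
  shows "fst a \<in> S" "w \<in> carrier (free_group S)" "[a] \<in> carrier (free_group S)"
    "a # w = [a] \<otimes>\<^bsub>free_group S\<^esub> w"
  using assms by (auto simp: free_group_def cons_letter_reduced dest: reduced_ConsD)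

lemma gen_free_group: "s \<in> S \<Longrightarrow> [(s, b)] \<in> carrier (free_group S)"
  by (simp add: free_group_def)

lemma inv_gen_free_group:
  assumes "s \<in> S" shows "inv\<^bsub>free_group S\<^esub> [(s, True)] = [(s, False)]"
  by (rule group.inv_equality[OF group_free_group])
    (use assms in \<open>auto simp: free_group_def inv_letter_def\<close>)

lemma hom_free_group_eqI:
  assumes "group G" "h \<in> hom (free_group S) G" "k \<in> hom (free_group S) G"
    and "\<And>s. s \<in> S \<Longrightarrow> h [(s, True)] = k [(s, True)]"
    and "w \<in> carrier (free_group S)"
  shows "h w = k w"
proof -
  interpret h: group_hom "free_group S" G h
    using assms by (simp add: group_hom_def group_hom_axioms_def group_free_group)
  interpret k: group_hom "free_group S" G k
    using assms by (simp add: group_hom_def group_hom_axioms_def group_free_group)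
  have gen: "h [a] = k [a]" if "fst a \<in> S" for a
  proof (cases "snd a")
    case True
    then show ?thesis using assms(4)[OF that] by (metis prod.collapse)
  next
    case False
    then have "[a] = inv\<^bsub>free_group S\<^esub> [(fst a, True)]"
      using inv_gen_free_group[OF that] by (metis prod.collapse)
    then show ?thesis
      using assms(4)[OF that] gen_free_group[OF that] by simp
  qed
  show ?thesis using assms(5)
  proof (induction w)
    case Nil
    then show ?case using h.hom_one k.hom_one by (simp add: one_free_group)
  next
    case (Cons a w)
    note a = Cons_free_group[OF Cons.prems]
    show ?case
      by (subst (1 2) a(4)) (use a gen Cons.IH in simp)
  qed
qed

text \<open>The universal property. Uniqueness of the extension is \<open>hom_free_group_eqI\<close>.\<close>

lemma free_group_universal:
  assumes "group G" and f: "f \<in> S \<rightarrow> carrier G"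
  shows "\<exists>h\<in>hom (free_group S) G. \<forall>s\<in>S. h [(s, True)] = f s"
proof -
  interpret group G by fact
  define l where "l a = (if snd a then f (fst a) else inv\<^bsub>G\<^esub> f (fst a))" for a
  define h where "h w = foldr (\<lambda>a x. l a \<otimes>\<^bsub>G\<^esub> x) w \<one>\<^bsub>G\<^esub>" for w
  have l: "l a \<in> carrier G" if "fst a \<in> S" for a
    using f that by (auto simp: l_def)
  have l_inv: "l a \<otimes>\<^bsub>G\<^esub> l (inv_letter a) = \<one>\<^bsub>G\<^esub>" if "fst a \<in> S" for a
    using f that by (auto simp: l_def inv_letter_def Pi_def)
  have h_simps: "h [] = \<one>\<^bsub>G\<^esub>" "h (a # w) = l a \<otimes>\<^bsub>G\<^esub> h w" for a w
    by (simp_all add: h_def)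
  have h: "h w \<in> carrier G" if "fst ` set w \<subseteq> S" for w
    using that by (induction w) (auto simp: h_simps l)
  have h_cons: "h (cons_letter a w) = l a \<otimes>\<^bsub>G\<^esub> h w" if "fst a \<in> S" "fst ` set w \<subseteq> S" for a w
  proof (cases w)
    case (Cons b v)
    show ?thesis
    proof (cases "b = inv_letter a")
      case True
      have "l a \<otimes>\<^bsub>G\<^esub> (l b \<otimes>\<^bsub>G\<^esub> h v) = l a \<otimes>\<^bsub>G\<^esub> l b \<otimes>\<^bsub>G\<^esub> h v"
        using that Cons by (intro m_assoc[symmetric] l h) auto
      also have "\<dots> = h v" using that Cons True l_inv h by simp
      finally show ?thesis using Cons True by (simp add: h_simps)
    qed (simp add: Cons h_simps)
  qed (simp add: h_simps)
  have h_mult: "h (foldr cons_letter u v) = h u \<otimes>\<^bsub>G\<^esub> h v"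
    if "fst ` set u \<subseteq> S" "fst ` set v \<subseteq> S" for u v
    using that
  proof (induction u)
    case (Cons a u)
    have "fst ` set (foldr cons_letter u v) \<subseteq> S"
      using set_foldr[of u v] Cons.prems by fastforce
    then show ?case using Cons by (simp add: h_cons h_simps l h m_assoc)
  qed (simp add: h_simps h)
  have "h \<in> hom (free_group S) G"
    using h h_mult by (auto simp: hom_def free_group_def)
  moreover have "h [(s, True)] = f s" if "s \<in> S" for s
    using f that by (auto simp: h_simps l_def Pi_def)
  ultimately show ?thesis by blast
qed


section \<open>Abelianization and the special automorphism group\<close>

definition exp_sum :: "'s \<Rightarrow> 's letter list \<Rightarrow> int" where
  "exp_sum s w = int (count_list w (s, True)) - int (count_list w (s, False))"

text \<open>The abelianization map from the free group of rank \<open>n\<close> to \<open>\<int>\<^sup>n\<close>; see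
  \<open>abel_vec_hom\<close>, \<open>abel_vec_surj\<close> and \<open>abel_vec_kernel\<close> below.\<close>

definition abel_vec :: "nat \<Rightarrow> nat letter list \<Rightarrow> int vec" where
  "abel_vec n w = vec n (\<lambda>i. exp_sum i w)"

definition general_linear_int :: "nat \<Rightarrow> int mat monoid" where
  "general_linear_int n = units_of (ring_mat TYPE(int) n ())"

text \<open>The endomorphism of \<open>\<int>\<^sup>n\<close> induced by \<open>\<phi>\<close>: column \<open>j\<close> is the image of the \<open>j\<close>-th standard
  basis vector.\<close>

definition abel_mat :: "nat \<Rightarrow> (nat letter list \<Rightarrow> nat letter list) \<Rightarrow> int mat" where
  "abel_mat n \<phi> = mat n n (\<lambda>(i, j). abel_vec n (\<phi> [(j, True)]) $ i)"

text \<open>The kernel of the composition of \<open>abel_mat_hom\<close> and \<open>det_hom\<close> below; \<open>sign_img\<close> is the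
  multiplicative group \<open>{-1, 1}\<close>.\<close>

definition SAut :: "nat \<Rightarrow> (nat letter list \<Rightarrow> nat letter list) monoid" where
  "SAut n = (AutoGroup (free_group {..<n}))
     \<lparr>carrier := kernel (AutoGroup (free_group {..<n})) sign_img (det \<circ> abel_mat n)\<rparr>"

lemma exp_sum_Nil [simp]: "exp_sum s [] = 0"
  by (simp add: exp_sum_def)

lemma exp_sum_Cons:
  "exp_sum s (a # w) = (if fst a = s then if snd a then 1 else - 1 else 0) + exp_sum s w"
  by (cases a) (auto simp: exp_sum_def)

lemma exp_sum_cons_letter: "exp_sum s (cons_letter a w) = exp_sum s (a # w)"
  by (cases w) (auto simp: exp_sum_Cons inv_letter_def)

lemma exp_sum_foldr: "exp_sum s (foldr cons_letter u v) = exp_sum s u + exp_sum s v"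
  by (induction u) (auto simp: exp_sum_Cons exp_sum_cons_letter)

lemma abel_vec_carrier [simp]: "abel_vec n w \<in> carrier_vec n"
  by (simp add: abel_vec_def)

lemma abel_vec_mult: "abel_vec n (u \<otimes>\<^bsub>free_group S\<^esub> v) = abel_vec n u + abel_vec n v"
  by (auto simp: abel_vec_def free_group_def exp_sum_foldr)

lemma abel_vec_gen: "i < n \<Longrightarrow> abel_vec n [(i, True)] = unit_vec n i"
  by (auto simp: abel_vec_def exp_sum_Cons)

lemma group_monoid_vec: "group (monoid_vec TYPE(int) n)"
  by (intro groupI) (auto simp: monoid_vec_def intro!: bexI[of _ "- x" for x])

lemma abel_vec_hom: "abel_vec n \<in> hom (free_group S) (monoid_vec TYPE(int) n)"
  by (auto simp: hom_def monoid_vec_def abel_vec_mult)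

lemma abel_mat_carrier [simp]: "abel_mat n \<phi> \<in> carrier_mat n n"
  by (simp add: abel_mat_def)

lemma mat_mult_unit_vec:
  "A \<in> carrier_mat m n \<Longrightarrow> j < n \<Longrightarrow> A *\<^sub>v unit_vec n j = col A j" for A :: "int mat"
  by (rule eq_vecI) auto

lemma col_abel_mat: "j < n \<Longrightarrow> col (abel_mat n \<phi>) j = abel_vec n (\<phi> [(j, True)])"
  by (auto simp: abel_mat_def abel_vec_def)

text \<open>The endomorphism of the free group and the matrix it induces commute with abelianization.\<close>

lemma abel_vec_endo:
  assumes \<phi>: "\<phi> \<in> hom (free_group {..<n}) (free_group {..<n})" and "w \<in> carrier (free_group {..<n})"
  shows "abel_vec n (\<phi> w) = abel_mat n \<phi> *\<^sub>v abel_vec n w"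
proof (rule hom_free_group_eqI[where h = "\<lambda>w. abel_vec n (\<phi> w)" and S = "{..<n}"])
  show "(\<lambda>w. abel_vec n (\<phi> w)) \<in> hom (free_group {..<n}) (monoid_vec TYPE(int) n)"
    using \<phi> by (auto simp: hom_def monoid_vec_def abel_vec_mult)
  show "(\<lambda>w. abel_mat n \<phi> *\<^sub>v abel_vec n w) \<in> hom (free_group {..<n}) (monoid_vec TYPE(int) n)"
    by (auto simp: hom_def monoid_vec_def abel_vec_mult mult_add_distrib_mat_vec[of _ n n]
        intro!: mult_mat_vec_carrier[of _ n n])
  show "abel_vec n (\<phi> [(j, True)]) = abel_mat n \<phi> *\<^sub>v abel_vec n [(j, True)]" if "j \<in> {..<n}" for j
    using that by (simp add: abel_vec_gen mat_mult_unit_vec[of _ n n] col_abel_mat)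
qed (use assms group_monoid_vec in auto)

lemma carrier_AutoGroup: "carrier (AutoGroup G) = auto G"
  by (simp add: AutoGroup_def)

lemma mult_AutoGroup:
  "\<phi> \<in> auto G \<Longrightarrow> \<psi> \<in> auto G \<Longrightarrow> \<phi> \<otimes>\<^bsub>AutoGroup G\<^esub> \<psi> = compose (carrier G) \<phi> \<psi>"
  by (simp add: AutoGroup_def BijGroup_def auto_def)

lemma one_AutoGroup: "\<one>\<^bsub>AutoGroup G\<^esub> = (\<lambda>x\<in>carrier G. x)"
  by (simp add: AutoGroup_def BijGroup_def)

lemma abel_mat_mult:
  assumes "\<phi> \<in> auto (free_group {..<n})" "\<psi> \<in> auto (free_group {..<n})"
  shows "abel_mat n (\<phi> \<otimes>\<^bsub>AutoGroup (free_group {..<n})\<^esub> \<psi>) = abel_mat n \<phi> * abel_mat n \<psi>"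
proof (rule mat_col_eqI)
  fix j assume "j < dim_col (abel_mat n \<phi> * abel_mat n \<psi>)"
  then have j: "j < n" by (simp add: abel_mat_def)
  have hom: "\<phi> \<in> hom (free_group {..<n}) (free_group {..<n})"
    "\<psi> \<in> hom (free_group {..<n}) (free_group {..<n})"
    using assms by (auto simp: auto_def)
  have gen: "[(j, True)] \<in> carrier (free_group {..<n})"
    using j by (simp add: gen_free_group)
  then have "\<psi> [(j, True)] \<in> carrier (free_group {..<n})"
    using hom(2) by (auto simp: hom_def)
  then show "col (abel_mat n (\<phi> \<otimes>\<^bsub>AutoGroup (free_group {..<n})\<^esub> \<psi>)) j =
      col (abel_mat n \<phi> * abel_mat n \<psi>) j"
    using j gen abel_vec_endo[OF hom(1)]
    by (simp add: mult_AutoGroup[OF assms] col_abel_mat compose_def col_mult2[of _ n n _ n])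
qed (auto simp: abel_mat_def)

lemma abel_mat_one: "abel_mat n \<one>\<^bsub>AutoGroup (free_group {..<n})\<^esub> = 1\<^sub>m n"
  by (rule mat_col_eqI)
    (auto simp: col_abel_mat one_AutoGroup gen_free_group abel_vec_gen abel_mat_def)

lemma abel_mat_hom:
  "abel_mat n \<in> hom (AutoGroup (free_group {..<n})) (general_linear_int n)"
proof -
  interpret A: group "AutoGroup (free_group {..<n})"
    by (intro group.AutoGroup group_free_group)
  have "abel_mat n \<phi> \<in> Units (ring_mat TYPE(int) n ())"
    if "\<phi> \<in> carrier (AutoGroup (free_group {..<n}))" for \<phi>
  proof -
    define \<psi> where "\<psi> = inv\<^bsub>AutoGroup (free_group {..<n})\<^esub> \<phi>"
    have \<psi>: "\<psi> \<in> carrier (AutoGroup (free_group {..<n}))"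
      using that by (simp add: \<psi>_def)
    have "abel_mat n \<phi> * abel_mat n \<psi> = 1\<^sub>m n" "abel_mat n \<psi> * abel_mat n \<phi> = 1\<^sub>m n"
      using that \<psi> abel_mat_mult[of \<phi> n \<psi>] abel_mat_mult[of \<psi> n \<phi>]
      by (simp_all add: \<psi>_def carrier_AutoGroup[symmetric] abel_mat_one)
    then show ?thesis
      unfolding Units_def ring_mat_simps by (auto intro!: bexI[of _ "abel_mat n \<psi>"])
  qed
  then show ?thesis
    by (auto simp: hom_def general_linear_int_def units_of_carrier units_of_mult ring_mat_simps
        abel_mat_mult carrier_AutoGroup)
qed

lemma det_hom: "det \<in> hom (general_linear_int n) sign_img"
proof -
  have "det A = 1 \<or> det A = - 1" if A: "A \<in> Units (ring_mat TYPE(int) n ())" for A :: "int mat"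
  proof -
    obtain B where "A \<in> carrier_mat n n" "B \<in> carrier_mat n n" "A * B = 1\<^sub>m n"
      using A by (auto simp: Units_def ring_mat_simps)
    then have "det A * det B = 1"
      using det_mult[of A n B] by simp
    then show ?thesis
      using zmult_eq_1_iff by blast
  qed
  then show ?thesis
    by (auto simp: hom_def general_linear_int_def units_of_carrier units_of_mult sign_img_def
        ring_mat_simps Units_def intro!: det_mult)
qed

lemma group_SAut: "group (SAut n)"
proof -
  interpret group_hom "AutoGroup (free_group {..<n})" sign_img "det \<circ> abel_mat n"
    unfolding group_hom_def group_hom_axioms_def
    by (intro conjI group.AutoGroup group_free_group sign_img_is_group
        hom_compose[OF abel_mat_hom det_hom])
  show ?thesis
    unfolding SAut_def by (rule G.subgroup_imp_group[OF subgroup_kernel])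
qed

lemma group_action_SAut_iff: "group_action (SAut n) X \<phi> \<longleftrightarrow> \<phi> \<in> hom (SAut n) (BijGroup X)"
  by (simp add: group_action_def group_hom_def group_hom_axioms_def group_SAut group_BijGroup)

text \<open>A homomorphism from the free group to an abelian group factors through \<open>abel_vec\<close>.\<close>

lemma hom_comm_group_exp_sum:
  fixes n :: nat
  assumes "comm_group G" and h: "h \<in> hom (free_group {..<n}) G"
    and w: "w \<in> carrier (free_group {..<n})"
  shows "h w = (\<Otimes>\<^bsub>G\<^esub>i\<in>{..<n}. h [(i, True)] [^]\<^bsub>G\<^esub> exp_sum i w)"
proof -
  interpret comm_group G by fact
  have gen: "h [(i, True)] \<in> carrier G" if "i < n" for i
    using h that gen_free_group[of i "{..<n}"] by (auto simp: hom_def)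
  show ?thesis
  proof (rule hom_free_group_eqI[OF _ h _ _ w])
    show "(\<lambda>w. \<Otimes>\<^bsub>G\<^esub>i\<in>{..<n}. h [(i, True)] [^]\<^bsub>G\<^esub> exp_sum i w) \<in> hom (free_group {..<n}) G"
    proof (rule homI)
      fix u v
      have "exp_sum i (u \<otimes>\<^bsub>free_group {..<n}\<^esub> v) = exp_sum i u + exp_sum i v" for i
        by (simp add: free_group_def exp_sum_foldr)
      then have "(\<Otimes>\<^bsub>G\<^esub>i\<in>{..<n}. h [(i, True)] [^]\<^bsub>G\<^esub> exp_sum i (u \<otimes>\<^bsub>free_group {..<n}\<^esub> v)) =
          (\<Otimes>\<^bsub>G\<^esub>i\<in>{..<n}. h [(i, True)] [^]\<^bsub>G\<^esub> exp_sum i u \<otimes>\<^bsub>G\<^esub> h [(i, True)] [^]\<^bsub>G\<^esub> exp_sum i v)"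
        using gen by (intro finprod_cong') (auto simp: int_pow_mult)
      then show "(\<Otimes>\<^bsub>G\<^esub>i\<in>{..<n}. h [(i, True)] [^]\<^bsub>G\<^esub> exp_sum i (u \<otimes>\<^bsub>free_group {..<n}\<^esub> v)) =
          (\<Otimes>\<^bsub>G\<^esub>i\<in>{..<n}. h [(i, True)] [^]\<^bsub>G\<^esub> exp_sum i u) \<otimes>\<^bsub>G\<^esub>
          (\<Otimes>\<^bsub>G\<^esub>i\<in>{..<n}. h [(i, True)] [^]\<^bsub>G\<^esub> exp_sum i v)"
        using gen by (subst (asm) finprod_multf) auto
    qed (use gen in \<open>auto intro!: finprod_closed\<close>)
    fix j assume j: "j \<in> {..<n}"
    have "(\<Otimes>\<^bsub>G\<^esub>i\<in>{..<n}. h [(i, True)] [^]\<^bsub>G\<^esub> exp_sum i [(j, True)]) =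
        (\<Otimes>\<^bsub>G\<^esub>i\<in>{..<n}. if j = i then h [(i, True)] else \<one>\<^bsub>G\<^esub>)"
      using gen by (intro finprod_cong') (auto simp: exp_sum_Cons int_pow_1)
    also have "\<dots> = h [(j, True)]"
      using j gen by (intro finprod_singleton) auto
    finally show "h [(j, True)] =
        (\<Otimes>\<^bsub>G\<^esub>i\<in>{..<n}. h [(i, True)] [^]\<^bsub>G\<^esub> exp_sum i [(j, True)])" ..
  qed unfold_locales
qed

lemma abel_vec_kernel:
  "kernel (free_group {..<n}) (monoid_vec TYPE(int) n) (abel_vec n) =
     derived (free_group {..<n}) (carrier (free_group {..<n}))"
  (is "?K = ?D")
proof
  interpret F: group "free_group {..<n}" by (rule group_free_group)
  interpret D: normal ?D "free_group {..<n}" by (rule F.derived_self_is_normal)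
  interpret Q: comm_group "free_group {..<n} Mod ?D" by (rule F.derived_quot_is_comm_group)
  interpret v: group_hom "free_group {..<n}" "monoid_vec TYPE(int) n" "abel_vec n"
    by (simp add: group_hom_def group_hom_axioms_def group_free_group group_monoid_vec abel_vec_hom)
  show "?K \<subseteq> ?D"
  proof
    fix w assume "w \<in> ?K"
    then have w: "w \<in> carrier (free_group {..<n})" and "abel_vec n w = 0\<^sub>v n"
      by (auto simp: kernel_def monoid_vec_def)
    then have "exp_sum i w = 0" if "i < n" for i
      using that by (metis abel_vec_def index_vec index_zero_vec(1))
    then have "?D #>\<^bsub>free_group {..<n}\<^esub> w = \<one>\<^bsub>free_group {..<n} Mod ?D\<^esub>"
      unfolding hom_comm_group_exp_sum[OF Q.comm_group_axioms D.r_coset_hom_Mod w]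
      by (intro Q.finprod_one_eqI) simp
    then have "?D #>\<^bsub>free_group {..<n}\<^esub> w = ?D"
      by (simp add: FactGroup_def)
    then show "w \<in> ?D"
      using F.coset_join1[OF _ w D.subgroup_axioms] D.subset by blast
  qed
  show "?D \<subseteq> ?K"
  proof (unfold derived_def, rule F.generate_subgroup_incl[OF _ v.subgroup_kernel], safe)
    fix a b assume "a \<in> carrier (free_group {..<n})" "b \<in> carrier (free_group {..<n})"
    moreover have "x \<otimes>\<^bsub>monoid_vec TYPE(int) n\<^esub> y = y \<otimes>\<^bsub>monoid_vec TYPE(int) n\<^esub> x"
      if "x \<in> carrier (monoid_vec TYPE(int) n)" "y \<in> carrier (monoid_vec TYPE(int) n)" for x y
      using that by (auto simp: monoid_vec_def comm_add_vec)
    ultimately show "a \<otimes>\<^bsub>free_group {..<n}\<^esub> b \<otimes>\<^bsub>free_group {..<n}\<^esub> inv\<^bsub>free_group {..<n}\<^esub> a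
        \<otimes>\<^bsub>free_group {..<n}\<^esub> inv\<^bsub>free_group {..<n}\<^esub> b \<in> ?K"
      by (simp add: kernel_def v.H.m_assoc)
        (metis v.H.inv_solve_right' v.H.m_assoc v.H.m_closed v.H.inv_closed v.H.r_inv v.H.l_inv v.hom_closed v.H.r_one v.H.l_one)
  qed
qed

lemma abel_vec_surj: "abel_vec n ` carrier (free_group {..<n}) = carrier_vec n"
proof safe
  fix v :: "int vec" assume v: "v \<in> carrier_vec n"
  define u where "u = (\<lambda>i. replicate (nat \<bar>v $ i\<bar>) (i, 0 \<le> v $ i))"
  have append: "exp_sum s (xs @ ys) = exp_sum s xs + exp_sum s ys" for s :: nat and xs ys
    by (simp add: exp_sum_def count_list_append)
  have rep: "exp_sum s (replicate k (i, b)) = (if i = s then if b then int k else - int k else 0)"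
    for s i :: nat and k b
    by (induction k) (auto simp: exp_sum_Cons)
  have u: "exp_sum s (u i) = (if i = s then v $ i else 0)" for s i
    by (auto simp: u_def rep)
  have exp: "exp_sum s (concat (map u [0..<k])) = (if s < k then v $ s else 0)" for s k
    by (induction k) (auto simp: append u)
  define w where "w = foldr cons_letter (concat (map u [0..<n])) []"
  have "set w \<subseteq> set (concat (map u [0..<n]))"
    using set_foldr[of "concat (map u [0..<n])" "[]"] by (simp add: w_def)
  then have "fst ` set w \<subseteq> {..<n}"
    by (fastforce simp: u_def)
  then have "w \<in> carrier (free_group {..<n})"
    by (auto simp: free_group_def w_def reduced_foldr)
  moreover have "abel_vec n w = v"
    using v exp by (auto simp: abel_vec_def w_def exp_sum_foldr)
  ultimately show "v \<in> abel_vec n ` carrier (free_group {..<n})"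
    by blast
qed simp

end

theory Submission
  imports Defs
begin

text \<open>
  By Nielsen reduction, \<open>SAut n\<close> is generated by the transvections \<open>b \<mapsto> a b\<close> for letters
  \<open>a\<close>, \<open>b\<close> with different indices, and by the Steinberg relation it suffices to show that those
  of the first five generators act trivially. Consider the group \<open>D\<close> of order 16 that consists of
  the sign changes at an even number of these generators. As \<open>D\<close> is normalized by the signed
  permutations, counting conjugates of point stabilizers shows that on fewer than 18 points one of
  three cases occurs.

  If \<open>D\<close> acts trivially, the transvections satisfy the Steinberg relations of the special linear
  group of degree 5 over the field with two elements. By Burnside's lemma the elementary abelian
  group of the transvections in one row has a regular orbit of size 16 and fixes all other points.
  A transvection of another row then acts like one of this row, hence trivially.

  If \<open>D\<close> has a regular orbit, the transvections normalize the image of \<open>D\<close>, and the first case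
  applies to their conjugation action on \<open>D\<close>. So the image of \<open>D\<close> is central, although the signed
  permutations act on it nontrivially.

  Otherwise the points moved by \<open>D\<close> form five pairs, one for each generator, and \<open>D\<close> fixes at most
  7 points. A transvection cannot move a point of a pair outside this pair, since its conjugates
  would yield 10 distinct points fixed by \<open>D\<close>. Then the Steinberg relation forces all transvections
  to fix the pairs pointwise, although \<open>D\<close> does not.
\<close>

section \<open>Transvections over the field with two elements\<close>

text \<open>The obstacle is that left multiplications of one generator by two others need not
  commute in \<open>SAut n\<close>, so no linear group is at hand at the start. Left multiplication
  does commute with right multiplication, and conjugation by a sign change turns one into the other;
  it also turns a transvection into its inverse. So wherever \<open>D\<close> acts trivially, the
  relations become those of elementary matrices over the field with two elements, and the behaviour
  of \<open>D\<close> decides everything.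

  The bound 18 enters three times. A stabilizer in \<open>D\<close> that singles out two or three of
  the five generators has at least 10 conjugates, each belonging to at least two points, which makes
  20. An orbit of 16 points leaves at most one further point. Five pairs leave at most 7 points,
  fewer than the 10 that are indexed by pairs of generators.

  The relations are isolated in \<open>transvection_action\<close> because the conjugation action on
  \<open>D\<close> is a second model of them.\<close>

locale binary_transvections =
  fixes r :: "nat \<Rightarrow> nat \<Rightarrow> 'y \<Rightarrow> 'y" and Y :: "'y set"
  assumes finite_Y: "finite Y" and card_Y: "card Y < 18"
    and closed: "i < 5 \<Longrightarrow> j < 5 \<Longrightarrow> i \<noteq> j \<Longrightarrow> y \<in> Y \<Longrightarrow> r i j y \<in> Y"
    and invol: "i < 5 \<Longrightarrow> j < 5 \<Longrightarrow> i \<noteq> j \<Longrightarrow> y \<in> Y \<Longrightarrow> r i j (r i j y) = y"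
    and commute: "i < 5 \<Longrightarrow> j < 5 \<Longrightarrow> k < 5 \<Longrightarrow> l < 5 \<Longrightarrow> i \<noteq> j \<Longrightarrow> k \<noteq> l \<Longrightarrow> j \<noteq> k \<Longrightarrow> l \<noteq> i \<Longrightarrow> y \<in> Y \<Longrightarrow>
      r i j (r k l y) = r k l (r i j y)"
    and steinberg: "i < 5 \<Longrightarrow> j < 5 \<Longrightarrow> k < 5 \<Longrightarrow> i \<noteq> j \<Longrightarrow> j \<noteq> k \<Longrightarrow> i \<noteq> k \<Longrightarrow> y \<in> Y \<Longrightarrow>
      r j k (r i j y) = r i j (r i k (r j k y))"
begin

section \<open>The elementary abelian group of the transvections in row 4\<close>

definition row_elt :: "nat \<Rightarrow> nat set \<Rightarrow> 'y \<Rightarrow> 'y" where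
  "row_elt j v y = (if j \<in> v then r 4 j y else y)"

text \<open>The vector with support \<open>v\<close> in the 4-dimensional space over the field with
  two elements acts as the product of its \<open>r 4 j\<close>; these commute by
  \<open>row_elt_commute\<close>.\<close>

definition row :: "nat set \<Rightarrow> 'y \<Rightarrow> 'y" where
  "row v y = row_elt 0 v (row_elt 1 v (row_elt 2 v (row_elt 3 v y)))"

lemma row_elt_closed: "j < 4 \<Longrightarrow> y \<in> Y \<Longrightarrow> row_elt j v y \<in> Y"
  by (simp add: row_elt_def closed)

lemma row_elt_commute: "j < 4 \<Longrightarrow> k < 4 \<Longrightarrow> y \<in> Y \<Longrightarrow>
    row_elt j u (row_elt k v y) = row_elt k v (row_elt j u y)"
  by (cases "j = k") (auto simp: row_elt_def commute)

lemma row_elt_merge: "j < 4 \<Longrightarrow> y \<in> Y \<Longrightarrow>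
    row_elt j u (row_elt j v y) = row_elt j (sym_diff u v) y"
  by (auto simp: row_elt_def invol)

text \<open>Oriented so that rewriting sorts a product by index, which brings equal indices together
  for \<open>row_elt_merge\<close>.\<close>

lemma row_elt_bubble:
  assumes "y \<in> Y"
  shows "row_elt 3 u (row_elt 2 v y) = row_elt 2 v (row_elt 3 u y)"
    "row_elt 3 u (row_elt (Suc 0) v y) = row_elt (Suc 0) v (row_elt 3 u y)"
    "row_elt 3 u (row_elt 0 v y) = row_elt 0 v (row_elt 3 u y)"
    "row_elt 2 u (row_elt (Suc 0) v y) = row_elt (Suc 0) v (row_elt 2 u y)"
    "row_elt 2 u (row_elt 0 v y) = row_elt 0 v (row_elt 2 u y)"
    "row_elt (Suc 0) u (row_elt 0 v y) = row_elt 0 v (row_elt (Suc 0) u y)"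
  using assms by (simp_all add: row_elt_commute)

lemma row_closed: "y \<in> Y \<Longrightarrow> row v y \<in> Y"
  by (simp add: row_def row_elt_closed)

lemma row_empty [simp]: "row {} y = y"
  by (simp add: row_def row_elt_def)

lemma lt4: "j < 4 \<longleftrightarrow> j = 0 \<or> j = Suc 0 \<or> j = 2 \<or> j = 3" for j :: nat
  by auto

lemma row_single: "j < 4 \<Longrightarrow> row {j} y = r 4 j y"
  by (auto simp: row_def row_elt_def lt4)

lemma row_row: "y \<in> Y \<Longrightarrow> row u (row v y) = row (sym_diff u v) y"
  by (simp add: row_def row_elt_closed row_elt_bubble row_elt_merge)

lemma row_elt_pull: "l < 4 \<Longrightarrow> k < 4 \<Longrightarrow> y \<in> Y \<Longrightarrow> row_elt l v (r 4 k y) = r 4 k (row_elt l v y)"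
  by (cases "l = k") (auto simp: row_elt_def commute)

lemma r_row_elt:
  assumes "j < 4" "k < 4" "j \<noteq> k" "l < 4" "y \<in> Y"
  shows "r j k (row_elt l v y) =
    (if l = j \<and> j \<in> v then r 4 k (row_elt l v (r j k y)) else row_elt l v (r j k y))"
  using assms by (cases "l = j") (auto simp: row_elt_def commute steinberg closed)

text \<open>The transvections among the indices below 4 normalize the row group and act on it like
  elementary matrices on vectors: by the Steinberg relation, moving past the factor
  \<open>r 4 j\<close> creates a factor \<open>r 4 k\<close>.\<close>

lemma r_row:
  assumes "j < 4" "k < 4" "j \<noteq> k" "y \<in> Y"
  shows "r j k (row v y) = row (if j \<in> v then sym_diff v {k} else v) (r j k y)"
proof -
  have y: "r j k y \<in> Y" using assms by (simp add: closed)
  have "row (sym_diff v {k}) (r j k y) = row v (r 4 k (r j k y))"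
    using row_row[OF y, of v "{k}"] assms(2) by (simp add: row_single)
  moreover have "r j k (row v y) = (if j \<in> v then row v (r 4 k (r j k y)) else row v (r j k y))"
    using assms(1)[unfolded lt4] assms(2-) y
    by (elim disjE; simp add: row_def r_row_elt row_elt_closed row_elt_pull)
  ultimately show ?thesis by simp
qed

section \<open>Fixed points of the row group\<close>

lemma card_fix_conj:
  assumes g: "g ` Y \<subseteq> Y" "\<And>y. y \<in> Y \<Longrightarrow> g (g y) = y"
    and fg: "\<And>y. y \<in> Y \<Longrightarrow> g (f y) = f' (g y)" "\<And>y. y \<in> Y \<Longrightarrow> f y \<in> Y"
  shows "card {y \<in> Y. f y = y} = card {y \<in> Y. f' y = y}"
proof (rule bij_betw_same_card)
  show "bij_betw g {y \<in> Y. f y = y} {y \<in> Y. f' y = y}"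
  proof (rule bij_betw_byWitness[where f' = g])
    show "g ` {y \<in> Y. f' y = y} \<subseteq> {y \<in> Y. f y = y}"
    proof clarify
      fix y assume y: "y \<in> Y" "f' y = y"
      then have gy: "g y \<in> Y" using g by auto
      have "g (f (g y)) = g (g y)" using fg(1)[OF gy] y g by simp
      then show "g y \<in> Y \<and> f (g y) = g y" using gy g fg(2) by metis
    qed
  qed (use g fg in \<open>auto, metis\<close>)
qed

lemma card_fix_toggle:
  assumes "j < 4" "k < 4" "j \<noteq> k" "j \<in> v"
  shows "card {y \<in> Y. row (sym_diff v {k}) y = y} = card {y \<in> Y. row v y = y}"
  by (rule card_fix_conj[of "r j k", symmetric])
    (use assms in \<open>auto simp: closed invol r_row row_closed\<close>)

text \<open>All nonzero vectors are conjugate: once some \<open>j\<close> lies in \<open>v\<close>,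
  conjugation by \<open>r j k\<close> adds any missing \<open>k\<close>, so every nonempty
  \<open>v\<close> is linked to the full set, and so is \<open>{0}\<close>.\<close>

lemma card_fix_row:
  assumes "v \<subseteq> {..<4}" "v \<noteq> {}"
  shows "card {y \<in> Y. row v y = y} = card {y \<in> Y. r 4 0 y = y}"
proof -
  define c where "c v = card {y \<in> Y. row v y = y}" for v
  have tog: "c (sym_diff v {k}) = c v" if "j < 4" "k < 4" "j \<noteq> k" "j \<in> v" for j k v
    using card_fix_toggle[OF that] by (simp add: c_def)
  have ins: "c (insert k v) = c v" if "j < 4" "k < 4" "j \<noteq> k" "j \<in> v" for j k v
  proof (cases "k \<in> v")
    case False
    then have "sym_diff v {k} = insert k v" by auto
    then show ?thesis using tog[OF that] by simp
  qed (simp add: insert_absorb)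
  obtain j where j: "j \<in> v" "j < 4" using assms by auto
  have fill: "c v = c {..<4}"
  proof -
    define w where "w = insert 0 (insert 1 (insert 2 (insert 3 v)))"
    have *: "c (insert k u) = c u" if "j \<in> u" "k < 4" for k u
      using ins[of j k u] j that by (cases "j = k") (auto simp: insert_absorb)
    have "c w = c v" using j by (simp add: w_def *)
    moreover have "w = {..<4}" using assms(1) by (auto simp: w_def)
    ultimately show ?thesis by simp
  qed
  have "c {0} = c {..<4}"
  proof -
    have "c (insert 3 (insert 2 (insert 1 {0}))) = c {0}"
      using ins[of 0] by simp
    moreover have "insert 3 (insert 2 (insert 1 {0::nat})) = {..<4}" by auto
    ultimately show ?thesis by simp
  qed
  with fill show ?thesis by (simp add: c_def row_single)
qed

definition toggles :: "nat set monoid" where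
  "toggles = \<lparr>carrier = Pow {..<4}, mult = sym_diff, one = {}\<rparr>"

lemma group_toggles: "group toggles"
  by (rule groupI) (auto simp: toggles_def)

lemma action_toggles: "group_action toggles Y (\<lambda>v. restrict (row v) Y)"
proof -
  have bij: "restrict (row v) Y \<in> Bij Y" for v
    unfolding Bij_def by (auto intro!: bij_betw_byWitness[where f' = "row v"] simp: row_closed
      row_row)
  have "(\<lambda>v. restrict (row v) Y) \<in> hom toggles (BijGroup Y)"
    by (rule homI) (auto simp: BijGroup_def bij toggles_def compose_def row_row row_closed
        intro!: restrict_ext)
  then show ?thesis
    by (simp add: group_action_def group_hom_def group_hom_axioms_def group_toggles group_BijGroup)
qed

lemma card_toggles: "order toggles = 16"
  by (simp add: toggles_def order_def card_Pow)

text \<open>Burnside's lemma for a group of order 16: the identity fixes all points, and the other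
  15 elements have equally many fixed points by \<open>card_fix_row\<close>.\<close>

lemma fix_mod: "16 dvd card Y + 15 * card {y \<in> Y. r 4 0 y = y}"
proof -
  have "card (orbits toggles Y (\<lambda>v. restrict (row v) Y)) * order toggles =
      (\<Sum>v\<in>carrier toggles. card (invariants Y (\<lambda>v. restrict (row v) Y) v))"
    by (rule group_action.burnside[OF action_toggles]) (auto simp: toggles_def finite_Y)
  also have "\<dots> = (\<Sum>v\<in>Pow {..<4}. card {y \<in> Y. row v y = y})"
    by (rule sum.cong) (auto simp: toggles_def invariants_def intro!: arg_cong[of _ _ card])
  also have "\<dots> = card Y + (\<Sum>v\<in>Pow {..<4} - {{}}. card {y \<in> Y. row v y = y})"
    by (subst sum.remove[of _ "{}"]) auto
  also have "(\<Sum>v\<in>Pow {..<4} - {{}}. card {y \<in> Y. row v y = y}) =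
      (\<Sum>v\<in>Pow {..<(4::nat)} - {{}}. card {y \<in> Y. r 4 0 y = y})"
    by (rule sum.cong) (auto simp: card_fix_row)
  also have "\<dots> = 15 * card {y \<in> Y. r 4 0 y = y}"
    by (simp add: card_Diff_singleton card_Pow)
  finally show ?thesis by (metis card_toggles dvd_triv_right)
qed

lemma trivial_40:
  assumes y: "y \<in> Y"
  shows "r 4 0 y = y"
proof (rule ccontr)
  assume moved: "r 4 0 y \<noteq> y"
  define Z where "Z = {y \<in> Y. r 4 0 y = y}"
  have "Z \<subset> Y" using y moved by (auto simp: Z_def)
  then have ZY: "card Z < card Y" using finite_Y by (simp add: psubset_card_mono)
  \<comment> \<open>Here \<open>16 * (k - card Z) = card Y - card Z\<close> lies strictly between 0
    and 18, so \<open>k = card Z + 1\<close>.\<close>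
  obtain k where "card Y + 15 * card Z = 16 * k"
    using fix_mod by (auto simp: Z_def)
  moreover from this have "card Z < k" "k < card Z + 2" using card_Y ZY by linarith+
  ultimately have "card Y = card Z + 16" by simp
  then have Z: "card Z \<le> 1" "card Z + 16 = card Y" using card_Y by auto
  have finZ: "finite Z" using finite_Y by (simp add: Z_def)
  have uniq: "p = q" if "p \<in> Z" "q \<in> Z" for p q
    using Z(1) finZ that card_le_Suc0_iff_eq by auto
  \<comment> \<open>As \<open>Z\<close> has at most one point, every map commuting with \<open>r 4 0\<close> and having equally many
    fixed points has fixed point set \<open>Z\<close>.\<close>
  have fixZ: "{z \<in> Y. f z = z} = Z"
    if "\<And>z. z \<in> Y \<Longrightarrow> f z \<in> Y" "\<And>z. z \<in> Y \<Longrightarrow> r 4 0 (f z) = f (r 4 0 z)"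
      "card {z \<in> Y. f z = z} = card Z" for f
  proof -
    have "Z \<subseteq> {z \<in> Y. f z = z}"
    proof
      fix z assume z: "z \<in> Z"
      then have "f z \<in> Z" using that(1,2)[of z] by (auto simp: Z_def)
      then have "f z = z" by (rule uniq) (rule z)
      with z show "z \<in> {z \<in> Y. f z = z}" by (simp add: Z_def)
    qed
    then show ?thesis using finite_Y that(3) by (intro card_subset_eq[symmetric]) auto
  qed
  have row_fix: "{z \<in> Y. row v z = z} = Z" if "v \<subseteq> {..<4}" "v \<noteq> {}" for v
  proof (rule fixZ)
    show "r 4 0 (row v z) = row v (r 4 0 z)" if "z \<in> Y" for z
      using row_row[OF that, of "{0}" v] row_row[OF that, of v "{0}"]
      by (simp only: row_single Un_commute)
  qed (use card_fix_row[OF that] in \<open>auto simp: row_closed Z_def\<close>)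
  define Q where "Q = Y - Z"
  have "card Q = 16" using Z finZ by (simp add: Q_def card_Diff_subset Z_def finite_Y)
  have free: "u = v" if "u \<subseteq> {..<4}" "v \<subseteq> {..<4}" "z \<in> Q" "row u z = row v z" for u v z
  proof (rule ccontr)
    assume "u \<noteq> v"
    then have "sym_diff u v \<noteq> {}" by auto
    moreover have "row (sym_diff u v) z = z"
      using that row_row[of z u v] row_row[of z u u] by (simp add: Q_def)
    ultimately show False using row_fix[of "sym_diff u v"] that by (auto simp: Q_def)
  qed
  have row_Q: "row v z \<in> Q" if "z \<in> Q" "v \<subseteq> {..<4}" for v z
  proof -
    have zY: "z \<in> Y" using that by (simp add: Q_def)
    have "row v z \<notin> Z"
    proof
      assume "row v z \<in> Z"
      then have "r 4 0 (row v z) = row v z" by (simp add: Z_def)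
      then have "row (sym_diff {0} v) z = row v z" using row_row[OF zY, of "{0}" v]
        by (simp add: row_single)
      moreover have "sym_diff {0} v \<subseteq> {..<4}" using that(2) by auto
      ultimately have "sym_diff {0} v = v" using free that by metis
      then show False by blast
    qed
    then show ?thesis using zY row_closed by (simp add: Q_def)
  qed
  have trans: "\<exists>v. v \<subseteq> {..<4} \<and> z' = row v z" if "z \<in> Q" "z' \<in> Q" for z z'
  proof -
    have "(\<lambda>v. row v z) ` Pow {..<4} = Q"
    proof (rule card_subset_eq)
      show "finite Q" by (simp add: Q_def finite_Y)
      have "inj_on (\<lambda>v. row v z) (Pow {..<4})" by (rule inj_onI) (use free that(1) in simp)
      then show "card ((\<lambda>v. row v z) ` Pow {..<4}) = card Q"
        by (simp add: card_image card_Pow \<open>card Q = 16\<close>)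
    qed (use row_Q that in auto)
    then show ?thesis using that by blast
  qed
  \<comment> \<open>\<open>r 4 3\<close> conjugates \<open>r 3 0\<close> to the product of
    \<open>r 4 0\<close> and \<open>r 3 0\<close>, and \<open>r 3 4\<close> conjugates
    \<open>r 4 0\<close> to the same product, so the numbers of fixed points agree.\<close>
  have fix30: "{z \<in> Y. r 3 0 z = z} = Z"
  proof (rule fixZ)
    have "card {z \<in> Y. r 3 0 z = z} = card {z \<in> Y. r 4 0 (r 3 0 z) = z}"
    proof (rule card_fix_conj[of "r 4 3"])
      show "r 4 3 (r 3 0 z) = r 4 0 (r 3 0 (r 4 3 z))" if "z \<in> Y" for z
        using that steinberg[of 4 3 0 z] by (simp add: closed invol commute[of 4 0 4 3])
    qed (auto simp: closed invol)
    also have "\<dots> = card {z \<in> Y. r 4 0 z = z}"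
    proof (rule card_fix_conj[of "r 3 4", symmetric])
      show "r 3 4 (r 4 0 z) = r 4 0 (r 3 0 (r 3 4 z))" if "z \<in> Y" for z
        using that steinberg[of 3 4 0 "r 3 0 z"]
        by (simp add: closed invol commute[of 3 0 3 4] commute[of 4 0 3 0])
    qed (auto simp: closed invol)
    finally show "card {z \<in> Y. r 3 0 z = z} = card Z" by (simp add: Z_def)
  qed (auto simp: closed commute)
  have eq: "r 3 0 z = r 4 0 z" if zY: "z \<in> Y" for z
  proof (cases "z \<in> Z")
    case True
    then show ?thesis using fix30 by (auto simp: Z_def)
  next
    case False
    then have zQ: "z \<in> Q" using zY by (simp add: Q_def)
    have comm_Q: "f z \<in> Q" if "\<And>z. z \<in> Y \<Longrightarrow> f z \<in> Y" "f (r 4 0 z) = r 4 0 (f z)"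
      "\<And>z. z \<in> Y \<Longrightarrow> f (f z) = z" for f
    proof -
      have "r 4 0 z \<in> Y" using zY by (simp add: closed)
      have "f z \<notin> Z"
      proof
        assume "f z \<in> Z"
        then have "f (f (r 4 0 z)) = f (f z)" using that(2) by (simp add: Z_def)
        then show False using that(3) zY False \<open>r 4 0 z \<in> Y\<close> by (simp add: Z_def)
      qed
      then show ?thesis using that zY by (simp add: Q_def)
    qed
    have "r 3 0 z \<in> Q" by (rule comm_Q) (auto simp: closed commute invol zY)
    then obtain a where a: "a \<subseteq> {..<4}" "r 3 0 z = row a z" using trans[OF zQ] by blast
    \<comment> \<open>Compare the coordinate \<open>k\<close> of both sides of
      \<open>r 3 0 (r j k z) = r j k (r 3 0 z)\<close>: only the right side can pick up an extra
      \<open>k\<close>, and it does so exactly if \<open>j \<in> a\<close>.\<close>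
    have not: "j \<notin> a" if jk: "j \<in> {1, 2}" "k \<in> {1, 2}" "j \<noteq> k" for j k
    proof -
      have "r j k z \<in> Q" by (rule comm_Q) (use jk in \<open>auto simp: closed commute invol zY\<close>)
      then obtain b where b: "b \<subseteq> {..<4}" "r j k z = row b z" using trans[OF zQ] by blast
      have "r 3 0 (r j k z) = row (sym_diff (if 3 \<in> b then sym_diff b {0} else b) a) z"
        using a b zY by (simp add: r_row row_row)
      moreover have "r j k (r 3 0 z) = row (sym_diff (if j \<in> a then sym_diff a {k} else a) b) z"
        unfolding a(2) using jk zY b(2) by (auto simp: r_row row_row)
      moreover have "r 3 0 (r j k z) = r j k (r 3 0 z)"
        using jk zY by (auto simp: commute)
      ultimately have *: "row (sym_diff (if 3 \<in> b then sym_diff b {0} else b) a) z =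
          row (sym_diff (if j \<in> a then sym_diff a {k} else a) b) z" by simp
      have "sym_diff (if 3 \<in> b then sym_diff b {0} else b) a =
          sym_diff (if j \<in> a then sym_diff a {k} else a) b"
        by (rule free[OF _ _ zQ *]) (use a(1) b(1) jk in auto)
      then have "(0 \<in> sym_diff (if 3 \<in> b then sym_diff b {0} else b) a) =
          (0 \<in> sym_diff (if j \<in> a then sym_diff a {k} else a) b)"
        "(k \<in> sym_diff (if 3 \<in> b then sym_diff b {0} else b) a) =
          (k \<in> sym_diff (if j \<in> a then sym_diff a {k} else a) b)" by simp_all
      then show ?thesis using jk by (auto split: if_splits)
    qed
    \<comment> \<open>Otherwise applying \<open>r 3 0\<close> twice to \<open>z\<close> would give
      \<open>row {0} z\<close> instead of \<open>z\<close>.\<close>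
    have "3 \<notin> a"
    proof
      assume "3 \<in> a"
      have "row {} z = row (sym_diff (sym_diff a {0}) a) z"
        using invol[of 3 0 z] a zY \<open>3 \<in> a\<close> by (simp add: r_row row_row)
      then have "{} = sym_diff (sym_diff a {0}) a"
        by (rule free[OF _ _ zQ, rotated 2]) (use a(1) in auto)
      then show False by blast
    qed
    with not[of 1 2] not[of 2 1] a(1) have "a \<subseteq> {0}"
      by (auto simp: lt4)
    moreover have "a \<noteq> {}" using a(2) fix30 False zY by auto
    ultimately have "a = {0}" by blast
    then show ?thesis using a(2) by (simp add: row_single)
  qed
  \<comment> \<open>As \<open>r 3 0\<close> and \<open>r 4 0\<close> agree, two factors in the
    Steinberg relation for 4, 3, 0 cancel.\<close>
  have "r 4 3 (r 4 0 y) = r 4 0 (r 4 3 y)"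
    using y by (simp add: commute)
  also have "\<dots> = r 4 3 (r 4 0 (r 3 0 y))"
    using y steinberg[of 4 3 0 y] by (simp add: eq closed)
  also have "\<dots> = r 4 3 y"
    using y by (simp add: eq invol)
  finally have "r 4 3 (r 4 3 (r 4 0 y)) = r 4 3 (r 4 3 y)" by simp
  then show False using y moved by (simp add: invol closed)
qed

text \<open>Conjugacy gives the whole of row 4. A trivial outer factor in a Steinberg relation makes
  the middle factor trivial; this reaches first the entries off row and column 4 and then column
  4.\<close>

lemma trivial:
  assumes "i < 5" "j < 5" "i \<noteq> j" "y \<in> Y"
  shows "r i j y = y"
proof -
  have last: "r 4 j y = y" if "j < 4" "y \<in> Y" for j y
  proof -
    have "{y \<in> Y. r 4 0 y = y} = Y" using trivial_40 by auto
    then have "card {y \<in> Y. row {j} y = y} = card Y"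
      using card_fix_row[of "{j}"] that by simp
    then have "{y \<in> Y. row {j} y = y} = Y"
      using finite_Y by (intro card_subset_eq) auto
    then show ?thesis using that row_single by fastforce
  qed
  have inner: "r i k y = y" if "i < 4" "k < 4" "i \<noteq> k" "y \<in> Y" for i k y
  proof -
    have "r i 4 y = r i 4 (r i k y)"
      using that steinberg[of i 4 k y] by (simp add: last closed)
    then have "r i 4 (r i 4 y) = r i 4 (r i 4 (r i k y))" by simp
    then show ?thesis using that by (simp add: invol closed)
  qed
  have outer: "r i 4 y = y" if "i < 4" "y \<in> Y" for i y
  proof -
    obtain m where m: "m < 4" "m \<noteq> i"
      by (metis zero_less_numeral zero_neq_one one_less_numeral_iff semiring_norm(76))
    have "r m 4 y = r i 4 (r m 4 y)"
      using that m steinberg[of i m 4 y] by (simp add: inner closed)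
    moreover have "r m 4 (r i 4 y) = r i 4 (r m 4 y)"
      using that m by (simp add: commute)
    ultimately have "r m 4 (r m 4 (r i 4 y)) = r m 4 (r m 4 y)" by simp
    then show ?thesis using that m by (simp add: invol closed)
  qed
  consider "i = 4" | "j = 4" | "i < 4" "j < 4" using assms by linarith
  then show ?thesis using assms by cases (auto simp: last inner outer)
qed

end

section \<open>Transvections and signed permutations of the letters\<close>

text \<open>A signed transposition. The sign makes the determinant 1, so that the map is a product
  of transvections (\<open>relabel_swap\<close>), but it also gives the map order 4
  (\<open>swap_swap\<close>).\<close>

definition swap_letter :: "nat letter \<Rightarrow> nat letter \<Rightarrow> nat letter \<Rightarrow> nat letter" where
  "swap_letter a b x = (if x = b then a else if x = inv_letter b then inv_letter a
    else if x = a then inv_letter b else if x = inv_letter a then b else x)"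

definition flip_letters :: "nat set \<Rightarrow> nat letter \<Rightarrow> nat letter" where
  "flip_letters S x = (if fst x \<in> S then inv_letter x else x)"

abbreviation transp :: "nat \<Rightarrow> nat \<Rightarrow> nat \<Rightarrow> nat" where
  "transp \<equiv> Transposition.transpose"

definition indep :: "nat \<Rightarrow> nat letter \<Rightarrow> nat letter \<Rightarrow> bool" where
  "indep n a b \<longleftrightarrow> fst a < n \<and> fst b < n \<and> fst a \<noteq> fst b"

text \<open>The signed permutations of determinant 1 of the first five generators; the swaps have
  finite order, so their products already form a group.\<close>

inductive monomial :: "(nat letter \<Rightarrow> nat letter) \<Rightarrow> bool" where
  monomial_id: "monomial id"
| monomial_swap: "indep 5 a b \<Longrightarrow> monomial m \<Longrightarrow> monomial (swap_letter a b \<circ> m)"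

definition even_set :: "nat set \<Rightarrow> bool" where
  "even_set S \<longleftrightarrow> S \<subseteq> {..<5} \<and> even (card S)"

definition index_map :: "(nat letter \<Rightarrow> nat letter) \<Rightarrow> nat \<Rightarrow> nat" where
  "index_map m i = fst (m (i, True))"

lemma inv_letter_neq [simp]: "inv_letter a \<noteq> a" "a \<noteq> inv_letter a"
  by (auto simp: inv_letter_def prod_eq_iff)

lemma inv_letter_eq_iff [simp]: "inv_letter a = inv_letter b \<longleftrightarrow> a = b"
  by (metis inv_letter_inv_letter)

lemma letter_eq_or_inv: "fst a = fst b \<Longrightarrow> a = b \<or> a = inv_letter b"
  by (cases a; cases b) (auto simp: inv_letter_def)

lemma indep_inv [simp]:
  "indep n (inv_letter a) b \<longleftrightarrow> indep n a b"
  "indep n a (inv_letter b) \<longleftrightarrow> indep n a b"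
  by (simp_all add: indep_def)

lemma indep_Pair [simp]:
  "indep n (i, s) (j, u) \<longleftrightarrow> i < n \<and> j < n \<and> i \<noteq> j"
  by (simp add: indep_def)

lemma swap_letter_inv: "indep 5 a b \<Longrightarrow>
  swap_letter a b (inv_letter x) = inv_letter (swap_letter a b x)"
  by (auto simp: swap_letter_def indep_def)

lemma fst_swap_letter:
  "indep 5 a b \<Longrightarrow> fst (swap_letter a b x) = transp (fst a) (fst b) (fst x)"
  by (auto simp: swap_letter_def indep_def Transposition.transpose_def dest: letter_eq_or_inv)

lemma monomial_inv: "monomial m \<Longrightarrow> m (inv_letter x) = inv_letter (m x)"
  by (induction arbitrary: x rule: monomial.induct) (auto simp: swap_letter_inv)

lemma fst_monomial: "monomial m \<Longrightarrow> fst (m x) = index_map m (fst x)"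
  using letter_eq_or_inv[of x "(fst x, True)"] monomial_inv[of m "(fst x, True)"]
  by (auto simp: index_map_def)

lemma index_map_swap:
  "indep 5 a b \<Longrightarrow> index_map (swap_letter a b) = transp (fst a) (fst b)"
  by (simp add: fun_eq_iff index_map_def fst_swap_letter)

lemma index_map_comp: "monomial m \<Longrightarrow> index_map (m \<circ> k) = index_map m \<circ> index_map k"
  by (rule ext) (simp add: fst_monomial index_map_def[of "m \<circ> k"] index_map_def[of k])

lemma monomial_single: "indep 5 a b \<Longrightarrow> monomial (swap_letter a b)"
  using monomial_swap[OF _ monomial_id] by simp

lemma monomial_comp: "monomial m \<Longrightarrow> monomial k \<Longrightarrow> monomial (m \<circ> k)"
  by (induction rule: monomial.induct) (auto simp: comp_assoc intro: monomial_swap)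

lemma monomial_index_map:
  assumes "monomial m" shows "inj (index_map m)" "index_map m ` {..<5} = {..<5}"
  using assms
proof (induction rule: monomial.induct)
  case monomial_id
  { case 1 then show ?case by (simp add: index_map_def inj_def)
  next
    case 2 then show ?case by (simp add: index_map_def) }
next
  case (monomial_swap a b m)
  have eq: "index_map (swap_letter a b \<circ> m) = transp (fst a) (fst b) \<circ> index_map m"
    using monomial_swap by (simp add: index_map_comp monomial_single index_map_swap)
  { case 1 then show ?case unfolding eq using monomial_swap.IH by (intro inj_compose) auto
  next
    case 2
    have "transp (fst a) (fst b) ` {..<5} = {..<5}"
      using monomial_swap.hyps by (simp add: indep_def)
    then show ?case unfolding eq image_comp[symmetric] using monomial_swap.IH by simp }
qed

lemma indep_monomial:
  assumes "monomial m" "indep 5 a b" shows "indep 5 (m a) (m b)"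
  using assms monomial_index_map[OF assms(1)]
  by (auto simp: indep_def fst_monomial dest: injD)

lemma monomial_flip:
  "monomial m \<Longrightarrow> m \<circ> flip_letters S = flip_letters (index_map m ` S) \<circ> m"
  using monomial_index_map(1)[of m]
  by (auto simp: fun_eq_iff flip_letters_def fst_monomial monomial_inv dest: injD)

lemma flip_flip: "flip_letters S \<circ> flip_letters T = flip_letters (sym_diff S T)"
  by (auto simp: fun_eq_iff flip_letters_def)

lemma swap_swap: "indep 5 a b \<Longrightarrow> swap_letter a b \<circ> swap_letter a b = flip_letters {fst a, fst b}"
proof (rule ext)
  fix x assume "indep 5 a b"
  then have ab: "fst a \<noteq> fst b" by (simp add: indep_def)
  then have "b \<noteq> a" "b \<noteq> inv_letter a" "a \<noteq> b" "a \<noteq> inv_letter b" by auto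
  moreover consider "x = a" | "x = inv_letter a" | "x = b" | "x = inv_letter b"
    | "fst x \<noteq> fst a" "fst x \<noteq> fst b"
    using letter_eq_or_inv by blast
  ultimately show "(swap_letter a b \<circ> swap_letter a b) x = flip_letters {fst a, fst b} x"
    using ab by cases (simp_all add: swap_letter_def flip_letters_def, metis fst_inv_letter)
qed

lemma flip_empty: "flip_letters {} = id"
  by (simp add: fun_eq_iff flip_letters_def)

section \<open>Sign changes at an even number of generators\<close>

lemma even_set_finite: "even_set S \<Longrightarrow> finite S"
  by (auto simp: even_set_def intro: finite_subset)

lemma even_card_sym_diff:
  assumes "finite S" "finite T"
  shows "even (card (sym_diff S T)) \<longleftrightarrow> even (card S + card T)"
proof -
  have "card (sym_diff S T) = card (S - T) + card (T - S)"
    using assms by (intro card_Un_disjoint) auto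
  moreover have "card S = card (S - T) + card (S \<inter> T)" "card T = card (T - S) + card (S \<inter> T)"
    using assms by (simp_all add: card_Diff_subset_Int Int_commute card_mono)
  ultimately show ?thesis by presburger
qed

lemma even_set_sym_diff: "even_set S \<Longrightarrow> even_set T \<Longrightarrow> even_set (sym_diff S T)"
  using even_card_sym_diff[of S T] even_set_finite by (auto simp: even_set_def)

lemma even_set_empty [simp]: "even_set {}"
  by (simp add: even_set_def)

lemma even_set_pair [simp]: "i \<noteq> j \<Longrightarrow> even_set {i, j} \<longleftrightarrow> i < 5 \<and> j < 5"
  by (simp add: even_set_def)

lemma even_set_compl [simp]: "k < 5 \<Longrightarrow> even_set ({..<5} - {k})"
  by (auto simp: even_set_def card_Diff_singleton)

lemma even_set_image: "monomial m \<Longrightarrow> even_set S \<Longrightarrow> even_set (index_map m ` S)"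
  using monomial_index_map[of m] by (auto simp: even_set_def card_image inj_on_subset)

text \<open>A sign change at two generators is the square of a swap, and an even set is exhausted by
  pairs.\<close>

lemma monomial_flip_even: "even_set S \<Longrightarrow> monomial (flip_letters S)"
proof (induction "card S" arbitrary: S rule: less_induct)
  case less
  show ?case
  proof (cases "S = {}")
    case True
    then show ?thesis by (simp add: flip_empty monomial_id)
  next
    case False
    then obtain i where i: "i \<in> S" by blast
    have "S \<noteq> {i}" using less.prems by (auto simp: even_set_def)
    then obtain j where j: "j \<in> S" "j \<noteq> i" using i by blast
    have lt: "i < 5" "j < 5" using i j less.prems by (auto simp: even_set_def)
    have fin: "finite S" using less.prems by (rule even_set_finite)
    have "even_set (sym_diff S {i, j})" using less.prems lt j by (intro even_set_sym_diff) auto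
    moreover have eq: "sym_diff S {i, j} = S - {i, j}" using i j by auto
    moreover have "card (S - {i, j}) < card S" using fin i by (intro psubset_card_mono) auto
    ultimately have "monomial (flip_letters (S - {i, j}))" using less.hyps by simp
    moreover have "monomial (flip_letters {i, j})"
      using swap_swap[of "(i, True)" "(j, True)"] monomial_single[of "(i, True)" "(j, True)"] lt j
      by (metis indep_Pair fst_conv monomial_comp)
    moreover have "flip_letters {i, j} \<circ> flip_letters (S - {i, j}) = flip_letters S"
      unfolding flip_flip using i j by (intro arg_cong[of _ _ flip_letters]) auto
    ultimately show ?thesis by (metis monomial_comp)
  qed
qed

text \<open>Supplies the fresh indices of the arguments below: among five generators, up to four may
  be excluded.\<close>

lemma obtain_index:
  assumes "length xs < 5" obtains k :: nat where "k < 5" "k \<notin> set xs"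
proof -
  have "card (set xs) < card {..<5::nat}" using card_length[of xs] assms by simp
  then have "\<not> {..<5} \<subseteq> set xs" using card_mono[of "set xs" "{..<5}"] by auto
  then show ?thesis using that by auto
qed

text \<open>Only the first five generators are considered: the Steinberg relation later transfers
  triviality to the transvections that involve the others.\<close>

locale transvection_action =
  fixes X :: "'x set" and t :: "nat letter \<Rightarrow> nat letter \<Rightarrow> 'x \<Rightarrow> 'x"
    and mu :: "(nat letter \<Rightarrow> nat letter) \<Rightarrow> 'x \<Rightarrow> 'x"
  assumes finite_X: "finite X" and card_X: "card X < 18"
    and t_closed: "indep 5 a b \<Longrightarrow> x \<in> X \<Longrightarrow> t a b x \<in> X"
    and t_inv: "indep 5 a b \<Longrightarrow> x \<in> X \<Longrightarrow> t (inv_letter a) b (t a b x) = x"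
    and t_commute: "indep 5 a b \<Longrightarrow> indep 5 c d \<Longrightarrow> fst a \<noteq> fst d \<Longrightarrow> fst c \<noteq> fst b \<Longrightarrow> b \<noteq> d \<Longrightarrow>
      x \<in> X \<Longrightarrow> t a b (t c d x) = t c d (t a b x)"
    and t_steinberg: "indep 5 a b \<Longrightarrow> indep 5 b c \<Longrightarrow> fst a \<noteq> fst c \<Longrightarrow> x \<in> X \<Longrightarrow>
      t a b (t b c x) = t b c (t a c (t a b x))"
    and mu_closed: "monomial m \<Longrightarrow> x \<in> X \<Longrightarrow> mu m x \<in> X"
    and mu_id: "x \<in> X \<Longrightarrow> mu id x = x"
    and mu_comp: "monomial m \<Longrightarrow> monomial k \<Longrightarrow> x \<in> X \<Longrightarrow> mu (m \<circ> k) x = mu m (mu k x)"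
    and mu_t: "monomial m \<Longrightarrow> indep 5 a b \<Longrightarrow> x \<in> X \<Longrightarrow> mu m (t a b x) = t (m a) (m b) (mu m x)"
    and mu_swap: "indep 5 a b \<Longrightarrow> x \<in> X \<Longrightarrow>
      mu (swap_letter a b) x = t a b (t (inv_letter b) a (t (inv_letter a) (inv_letter b) x))"
begin

definition d :: "nat set \<Rightarrow> 'x \<Rightarrow> 'x" where
  "d S = mu (flip_letters S)"

definition sw :: "nat \<Rightarrow> nat \<Rightarrow> 'x \<Rightarrow> 'x" where
  "sw i j = mu (swap_letter (i, True) (j, True))"

lemma d_closed: "even_set S \<Longrightarrow> x \<in> X \<Longrightarrow> d S x \<in> X"
  by (simp add: d_def mu_closed monomial_flip_even)

lemma d_empty [simp]: "x \<in> X \<Longrightarrow> d {} x = x"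
  by (simp add: d_def flip_empty mu_id)

lemma d_d: "even_set S \<Longrightarrow> even_set T \<Longrightarrow> x \<in> X \<Longrightarrow> d S (d T x) = d (sym_diff S T) x"
  by (simp add: d_def mu_comp[symmetric] monomial_flip_even flip_flip)

lemma d_commute: "even_set S \<Longrightarrow> even_set T \<Longrightarrow> x \<in> X \<Longrightarrow> d S (d T x) = d T (d S x)"
  by (simp add: d_d Un_commute)

lemma d_invol [simp]: "even_set S \<Longrightarrow> x \<in> X \<Longrightarrow> d S (d S x) = x"
  by (simp add: d_d)

lemma mu_d: "monomial m \<Longrightarrow> even_set S \<Longrightarrow> x \<in> X \<Longrightarrow> mu m (d S x) = d (index_map m ` S) (mu m x)"
  unfolding d_def
  by (metis mu_comp monomial_flip monomial_flip_even even_set_image)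

lemma d_t: "even_set S \<Longrightarrow> indep 5 a b \<Longrightarrow> x \<in> X \<Longrightarrow>
    d S (t a b x) = t (flip_letters S a) (flip_letters S b) (d S x)"
  by (simp add: d_def mu_t monomial_flip_even)

lemma d_t_commute: "even_set S \<Longrightarrow> indep 5 a b \<Longrightarrow> x \<in> X \<Longrightarrow> fst a \<notin> S \<Longrightarrow> fst b \<notin> S \<Longrightarrow>
    d S (t a b x) = t a b (d S x)"
  by (simp add: d_t flip_letters_def)

lemma t_inv': "indep 5 a b \<Longrightarrow> x \<in> X \<Longrightarrow> t a b (t (inv_letter a) b x) = x"
  using t_inv[of "inv_letter a" b x] by simp

lemma t_inj: "indep 5 a b \<Longrightarrow> x \<in> X \<Longrightarrow> y \<in> X \<Longrightarrow> t a b x = t a b y \<longleftrightarrow> x = y"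
  by (metis t_inv)

lemma d_inj: "even_set S \<Longrightarrow> x \<in> X \<Longrightarrow> y \<in> X \<Longrightarrow> d S x = d S y \<longleftrightarrow> x = y"
  by (metis d_invol)

lemma sw_closed: "i < 5 \<Longrightarrow> j < 5 \<Longrightarrow> i \<noteq> j \<Longrightarrow> x \<in> X \<Longrightarrow> sw i j x \<in> X"
  by (simp add: sw_def mu_closed monomial_single)

lemma sw_sw: "i < 5 \<Longrightarrow> j < 5 \<Longrightarrow> i \<noteq> j \<Longrightarrow> x \<in> X \<Longrightarrow> sw i j (sw i j x) = d {i, j} x"
  by (simp add: sw_def mu_comp[symmetric] monomial_single swap_swap d_def)

lemma sw_d: "i < 5 \<Longrightarrow> j < 5 \<Longrightarrow> i \<noteq> j \<Longrightarrow> even_set S \<Longrightarrow> x \<in> X \<Longrightarrow>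
    sw i j (d S x) = d (transp i j ` S) (sw i j x)"
  by (simp add: sw_def mu_d monomial_single index_map_swap)

lemma sw_inj: "i < 5 \<Longrightarrow> j < 5 \<Longrightarrow> i \<noteq> j \<Longrightarrow> x \<in> X \<Longrightarrow> y \<in> X \<Longrightarrow> sw i j x = sw i j y \<longleftrightarrow> x = y"
  using sw_sw[of i j x] sw_sw[of i j y] d_inj[of "{i, j}" x y] by auto

lemma even_set_transpose: "i < 5 \<Longrightarrow> j < 5 \<Longrightarrow> i \<noteq> j \<Longrightarrow> even_set S \<Longrightarrow> even_set (transp i j ` S)"
  using even_set_image[OF monomial_single, of "(i, True)" "(j, True)" S]
    by (simp add: index_map_swap)

section \<open>Points moved by the sign changes, and a counting principle\<close>

definition F :: "'x set" where
  "F = {x \<in> X. \<forall>S. even_set S \<longrightarrow> d S x = x}"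

lemma F_X: "F \<subseteq> X" by (auto simp: F_def)

lemma d_not_F: "even_set S \<Longrightarrow> x \<in> X - F \<Longrightarrow> d S x \<in> X - F"
proof -
  assume S: "even_set S" and x: "x \<in> X - F"
  then obtain T where T: "even_set T" "d T x \<noteq> x" by (auto simp: F_def)
  have "d T (d S x) \<noteq> d S x"
    using S T x d_commute[of T S x] d_inj[of S "d T x" x] by (simp add: d_closed)
  then show "d S x \<in> X - F" using S T x by (auto simp: F_def d_closed)
qed

lemma sw_not_F:
  assumes "i < 5" "j < 5" "i \<noteq> j" "x \<in> X - F" shows "sw i j x \<in> X - F"
proof -
  obtain S where S: "even_set S" "d S x \<noteq> x" using assms by (auto simp: F_def)
  have "d (transp i j ` S) (sw i j x) \<noteq> sw i j x"
    using S assms sw_d[of i j S x] sw_inj[of i j "d S x" x] by (auto simp: d_closed)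
  then show ?thesis using S assms even_set_transpose[of i j S] by (auto simp: F_def sw_closed)
qed

text \<open>By transport along transpositions, \<open>c\<close> takes all index sets of the same
  size equally often outside \<open>F\<close>. A point outside \<open>F\<close> shares its value of
  \<open>c\<close> with a different point of its orbit under the sign changes, which gives the lower
  bound 2.\<close>

lemma class_count:
  assumes c_sw: "\<And>x i j. x \<in> X \<Longrightarrow> i < 5 \<Longrightarrow> j < 5 \<Longrightarrow> i \<noteq> j \<Longrightarrow> c (sw i j x) = transp i j ` c x"
    and c_d: "\<And>x S. x \<in> X \<Longrightarrow> even_set S \<Longrightarrow> c (d S x) = c x"
    and c_sub: "\<And>x. x \<in> X \<Longrightarrow> c x \<subseteq> {..<5}"
    and x: "x \<in> X - F"
  shows "(5 choose card (c x)) * card {y \<in> X - F. c y = c x} \<le> card (X - F)"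
    and "2 \<le> card {y \<in> X - F. c y = c x}"
    and "S \<subseteq> {..<5} \<Longrightarrow> card S = card (c x) \<Longrightarrow>
      card {y \<in> X - F. c y = S} = card {y \<in> X - F. c y = c x}"
proof -
  define N where "N S = card {y \<in> X - F. c y = S}" for S
  have le: "N S \<le> N (transp i j ` S)" if "i < 5" "j < 5" "i \<noteq> j" for i j S
    unfolding N_def
  proof (rule card_inj_on_le)
    show "inj_on (sw i j) {y \<in> X - F. c y = S}" using that by (auto simp: inj_on_def sw_inj)
    show "sw i j ` {y \<in> X - F. c y = S} \<subseteq> {y \<in> X - F. c y = transp i j ` S}"
      using that c_sw sw_not_F by auto
  qed (simp add: finite_X)
  have N_swap: "N (transp i j ` S) = N S" if "i < 5" "j < 5" "i \<noteq> j" for i j S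
    using le[OF that, of S] le[OF that, of "transp i j ` S"]
    by (simp add: image_comp transpose_comp_involutory)
  \<comment> \<open>A transposition exchanges an element of \<open>S - T\<close> with one of
    \<open>T - S\<close>, which brings \<open>S\<close> closer to \<open>T\<close>.\<close>
  have const: "N S = N T" if "S \<subseteq> {..<5}" "T \<subseteq> {..<5}" "card S = card T" for S T
    using that
  proof (induction "card (S - T)" arbitrary: S)
    case 0
    have fin: "finite S" "finite T" using 0 by (auto intro: finite_subset)
    then have "S \<subseteq> T" using 0 by auto
    then show ?case using 0 fin card_subset_eq by metis
  next
    case (Suc m)
    have fin: "finite S" "finite T" using Suc by (auto intro: finite_subset)
    obtain i where i: "i \<in> S" "i \<notin> T" using Suc(2)
      by (metis card.empty DiffE ex_in_conv nat.distinct(1))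
    have "\<not> T \<subseteq> S" using i Suc fin card_subset_eq by metis
    then obtain j where j: "j \<in> T" "j \<notin> S" by blast
    define S' where "S' = transp i j ` S"
    have S': "S' = insert j (S - {i})" using i j
      by (auto simp: S'_def Transposition.transpose_def image_iff)
    have lt: "i < 5" "j < 5" "i \<noteq> j" using i j Suc by auto
    have "S' - T = (S - T) - {i}" using j by (auto simp: S')
    then have "m = card (S' - T)" using Suc(2) i fin by (simp add: card_Diff_singleton)
    moreover have "S' \<subseteq> {..<5}" using S' Suc(3) lt by auto
    moreover have "card S' = card T"
      using Suc fin by (simp add: S'_def card_image)
    ultimately have "N S' = N T" using Suc(1)[of S'] Suc by blast
    then show ?case using N_swap[OF lt] by (simp add: S'_def)
  qed
  show all: "card {y \<in> X - F. c y = S} = card {y \<in> X - F. c y = c x}"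
    if "S \<subseteq> {..<5}" "card S = card (c x)" for S
    using const[of S "c x"] that c_sub x by (simp add: N_def)
  define K where "K = {S. S \<subseteq> {..<5::nat} \<and> card S = card (c x)}"
  have finK: "finite K" by (rule finite_subset[of _ "Pow {..<5}"]) (auto simp: K_def)
  have "(5 choose card (c x)) * card {y \<in> X - F. c y = c x} = (\<Sum>S\<in>K. N (c x))"
    using n_subsets[of "{..<5::nat}" "card (c x)"] by (simp add: N_def K_def)
  also have "\<dots> = (\<Sum>S\<in>K. card {y \<in> X - F. c y = S})"
    by (rule sum.cong) (use all in \<open>auto simp: K_def N_def\<close>)
  also have "\<dots> = card (\<Union>S\<in>K. {y \<in> X - F. c y = S})"
    using finK finite_X by (intro card_UN_disjoint[symmetric]) auto
  also have "\<dots> \<le> card (X - F)" using finite_X by (intro card_mono) auto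
  finally show "(5 choose card (c x)) * card {y \<in> X - F. c y = c x} \<le> card (X - F)" .
  obtain S where S: "even_set S" "d S x \<noteq> x" using x by (auto simp: F_def)
  have "{x, d S x} \<subseteq> {y \<in> X - F. c y = c x}" using x S d_not_F c_d by auto
  then have "card {x, d S x} \<le> card {y \<in> X - F. c y = c x}" using finite_X by (intro card_mono) auto
  then show "2 \<le> card {y \<in> X - F. c y = c x}" using S(2) by auto
qed

end

text \<open>An even set is determined by its part below 4, since parity decides about the index
  4.\<close>

lemma card_even_sets: "card {S. even_set S} = 16"
proof -
  have "bij_betw (\<lambda>S. S - {4}) {S. even_set S} (Pow {..<4})"
  proof (rule bij_betw_byWitness[where f' = "\<lambda>v. if even (card v) then v else insert 4 v"])
    show "\<forall>S\<in>{S. even_set S}. (if even (card (S - {4})) then S - {4} else insert 4 (S - {4})) = S"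
    proof clarify
      fix S assume S: "even_set S"
      show "(if even (card (S - {4})) then S - {4} else insert 4 (S - {4})) = S"
      proof (cases "4 \<in> S")
        case True
        then have "card S = Suc (card (S - {4}))"
          using S even_set_finite by (metis card.remove)
        then show ?thesis using S True by (auto simp: even_set_def)
      next
        case False
        then show ?thesis using S by (simp add: even_set_def)
      qed
    qed
    show "\<forall>v\<in>Pow {..<4::nat}. (if even (card v) then v else insert 4 v) - {4} = v" by auto
    show "(\<lambda>S. S - {4}) ` {S. even_set S} \<subseteq> Pow {..<4}"
      by (force simp: even_set_def less_Suc_eq numeral_eq_Suc)
    show "(\<lambda>v. if even (card v) then v else insert 4 v) ` Pow {..<4} \<subseteq> {S. even_set S}"
    proof clarify
      fix v :: "nat set" assume v: "v \<subseteq> {..<4}"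
      then have "finite v" "4 \<notin> v" "v \<subseteq> {..<5}" by (auto intro: finite_subset)
      then show "even_set (if even (card v) then v else insert 4 v)"
        by (auto simp: even_set_def)
    qed
  qed
  then show ?thesis by (simp add: bij_betw_same_card card_Pow)
qed

text \<open>The equivariance of both \<open>J\<close> and \<open>pair_support\<close> under swaps is
  reduced to this form.\<close>

lemma transpose_Collect:
  assumes "i < 5" "j < 5" "\<And>k. k < (5::nat) \<Longrightarrow> P k \<longleftrightarrow> Q (transp i j k)"
  shows "{k. k < 5 \<and> Q k} = transp i j ` {k. k < 5 \<and> P k}"
proof -
  have lt: "transp i j k < 5 \<longleftrightarrow> k < 5" for k
    using assms by (auto simp: Transposition.transpose_def)
  show ?thesis
  proof (rule Set.set_eqI)
    fix k
    have "k \<in> transp i j ` {k. k < 5 \<and> P k} \<longleftrightarrow>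
        transp i j k \<in> {k. k < 5 \<and> P k}"
      by (metis (no_types, lifting) image_iff transpose_involutory)
    then show "k \<in> {k. k < 5 \<and> Q k} \<longleftrightarrow> k \<in> transp i j ` {k. k < 5 \<and> P k}"
      using assms(3)[of "transp i j k"] lt by auto
  qed
qed

context transvection_action
begin

section \<open>Stabilizers of points in the group of sign changes\<close>

lemma d_fixed_even:
  assumes "even_set S" "x \<in> X" "\<And>i j. i \<in> S \<Longrightarrow> j \<in> S \<Longrightarrow> i \<noteq> j \<Longrightarrow> d {i, j} x = x"
  shows "d S x = x"
  using assms
proof (induction "card S" arbitrary: S rule: less_induct)
  case less
  show ?case
  proof (cases "S = {}")
    case False
    then obtain i where i: "i \<in> S" by blast
    have "S \<noteq> {i}" using less.prems by (auto simp: even_set_def)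
    then obtain j where j: "j \<in> S" "j \<noteq> i" using i by blast
    have lt: "i < 5" "j < 5" using i j less.prems by (auto simp: even_set_def)
    have fin: "finite S" using less.prems by (simp add: even_set_finite)
    have ev: "even_set (sym_diff S {i, j})" using less.prems lt j by (intro even_set_sym_diff) auto
    have eq: "sym_diff S {i, j} = S - {i, j}" using i j by auto
    have "card (S - {i, j}) < card S" using fin i by (intro psubset_card_mono) auto
    then have "d (S - {i, j}) x = x"
      by (rule less.hyps) (use ev less.prems(2,3) in \<open>simp_all only: eq, blast\<close>)
    moreover have "d S (d {i, j} x) = d (S - {i, j}) x"
      using less.prems lt j eq by (simp add: d_d)
    ultimately show ?thesis using less.prems(3) i j by metis
  qed (use less.prems in simp)
qed

text \<open>A nonempty even set of indices has size 4 or 2. \<open>J\<close> records the stabilizer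
  elements of size 4 by the index that they omit, \<open>pair_support\<close> those of size 2 by the
  indices that they involve. Both are index sets to which \<open>class_count\<close>
  applies.\<close>

definition J :: "'x \<Rightarrow> nat set" where
  "J x = {k. k < 5 \<and> d ({..<5} - {k}) x = x}"

definition pair_support :: "'x \<Rightarrow> nat set" where
  "pair_support x = {i. i < 5 \<and> (\<exists>j<5. j \<noteq> i \<and> d {i, j} x = x)}"

lemma d_fix_sw:
  assumes "i < 5" "j < 5" "i \<noteq> j" "x \<in> X" "even_set S"
  shows "d S x = x \<longleftrightarrow> d (transp i j ` S) (sw i j x) = sw i j x"
  using assms sw_d[of i j S x] sw_inj[of i j "d S x" x] by (auto simp: d_closed)

lemma J_sw:
  assumes "i < 5" "j < 5" "i \<noteq> j" "x \<in> X"
  shows "J (sw i j x) = transp i j ` J x"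
  unfolding J_def
proof (rule transpose_Collect[OF assms(1,2)])
  fix k :: nat assume k: "k < 5"
  have "transp i j ` ({..<5} - {k}) = {..<5} - {transp i j k}"
    using assms by (subst image_set_diff) auto
  then show "d ({..<5} - {k}) x = x \<longleftrightarrow>
      d ({..<5} - {transp i j k}) (sw i j x) = sw i j x"
    using d_fix_sw[OF assms, of "{..<5} - {k}"] k by simp
qed

lemma J_d: "x \<in> X \<Longrightarrow> even_set S \<Longrightarrow> J (d S x) = J x"
  by (auto simp: J_def d_commute[of _ S] d_closed d_inj)

lemma J_sub: "J x \<subseteq> {..<5}" by (auto simp: J_def)

lemma pair_support_sw:
  assumes "i < 5" "j < 5" "i \<noteq> j" "x \<in> X"
  shows "pair_support (sw i j x) = transp i j ` pair_support x"
  unfolding pair_support_def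
proof (rule transpose_Collect[OF assms(1,2)])
  fix k :: nat assume k: "k < 5"
  let ?t = "transp i j"
  have lt: "?t k < 5 \<longleftrightarrow> k < 5" for k
    using assms by (auto simp: Transposition.transpose_def)
  have *: "d {k, l} x = x \<longleftrightarrow> d {?t k, ?t l} (sw i j x) = sw i j x" if "l < 5" "l \<noteq> k" for l
    using d_fix_sw[OF assms, of "{k, l}"] k that by auto
  show "(\<exists>l<5. l \<noteq> k \<and> d {k, l} x = x) \<longleftrightarrow> (\<exists>l<5. l \<noteq> ?t k \<and> d {?t k, l} (sw i j x) = sw i j x)"
  proof
    assume "\<exists>l<5. l \<noteq> k \<and> d {k, l} x = x"
    then obtain l where "l < 5" "l \<noteq> k" "d {k, l} x = x" by blast
    moreover from this have "?t l \<noteq> ?t k" by (metis transpose_involutory)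
    ultimately have "?t l < 5" "?t l \<noteq> ?t k" "d {?t k, ?t l} (sw i j x) = sw i j x"
      using *[of l] lt[of l] by simp_all
    then show "\<exists>l<5. l \<noteq> ?t k \<and> d {?t k, l} (sw i j x) = sw i j x" by blast
  next
    assume "\<exists>l<5. l \<noteq> ?t k \<and> d {?t k, l} (sw i j x) = sw i j x"
    then obtain l where l: "l < 5" "l \<noteq> ?t k" "d {?t k, l} (sw i j x) = sw i j x" by blast
    then have "?t l \<noteq> k" by auto
    then have "?t l < 5" "?t l \<noteq> k" "d {k, ?t l} x = x"
      using *[of "?t l"] lt[of l] l by simp_all
    then show "\<exists>l<5. l \<noteq> k \<and> d {k, l} x = x" by blast
  qed
qed

lemma pair_support_d: "x \<in> X \<Longrightarrow> even_set S \<Longrightarrow> pair_support (d S x) = pair_support x"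
proof -
  assume x: "x \<in> X" and S: "even_set S"
  have "d {i, j} (d S x) = d S x \<longleftrightarrow> d {i, j} x = x" if "i < 5" "j < 5" "j \<noteq> i" for i j
    using that x S by (simp add: d_commute[of _ S] d_closed d_inj)
  then show ?thesis unfolding pair_support_def by (intro Collect_cong) auto
qed

text \<open>There are ten index sets of size 2 and ten of size 3; with at least two points for each,
  20 points would be required.\<close>

lemma card_2_3:
  assumes "\<And>x i j. x \<in> X \<Longrightarrow> i < 5 \<Longrightarrow> j < 5 \<Longrightarrow> i \<noteq> j \<Longrightarrow> c (sw i j x) = transp i j ` c x"
    and "\<And>x S. x \<in> X \<Longrightarrow> even_set S \<Longrightarrow> c (d S x) = c x"
    and "\<And>x. x \<in> X \<Longrightarrow> c x \<subseteq> {..<5}"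
    and "x \<in> X - F"
  shows "card (c x) \<noteq> 2" "card (c x) \<noteq> 3"
proof -
  have ten: "(5::nat) choose 2 = 10" "(5::nat) choose 3 = 10" by (simp_all add: numeral_eq_Suc)
  have "card (X - F) \<le> card X" using finite_X by (intro card_mono) auto
  then have "(5 choose card (c x)) * card {y \<in> X - F. c y = c x} < 18"
    using class_count(1)[OF assms(1-4)] card_X by simp
  then show "card (c x) \<noteq> 2" "card (c x) \<noteq> 3"
    using class_count(2)[OF assms(1-4)] by (auto simp: ten)
qed

lemma d_pair_J:
  assumes "x \<in> X" "k \<in> J x" "l \<in> J x" "k \<noteq> l" shows "d {k, l} x = x"
proof -
  have kl: "k < 5" "l < 5" using assms by (auto simp: J_def)
  have "sym_diff ({..<5} - {k}) ({..<5} - {l}) = {k, l}" using kl assms by auto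
  then have "d ({..<5} - {k}) (d ({..<5} - {l}) x) = d {k, l} x"
    using d_d[of "{..<5} - {k}" "{..<5} - {l}" x] kl assms by simp
  then show ?thesis using assms by (simp add: J_def)
qed

text \<open>Stabilizer elements omitting \<open>k\<close> and \<open>l\<close> multiply to the sign
  change at \<open>k\<close> and \<open>l\<close>, so every even subset of \<open>J x\<close> fixes
  \<open>x\<close>. If \<open>J x\<close> has at least four elements, these subsets include the
  complement of an index that is missing, so none is missing and \<open>x\<close> lies in
  \<open>F\<close>.\<close>

lemma card_J: assumes x: "x \<in> X - F" shows "card (J x) \<le> 1"
proof -
  have "card (J x) \<noteq> 2" "card (J x) \<noteq> 3"
    using card_2_3[of J x] J_sw J_d J_sub x by auto
  moreover have "card (J x) < 4"
  proof (rule ccontr)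
    assume "\<not> card (J x) < 4"
    then have that: "card (J x) \<ge> 4" by simp
    have xX: "x \<in> X" using x by simp
    have sub: "d S x = x" if "even_set S" "S \<subseteq> J x" for S
      by (rule d_fixed_even[OF that(1) xX]) (use that(2) d_pair_J[OF xX] in blast)
    have "card ({..<5} - J x) \<le> 1" using that J_sub[of x]
      by (simp add: card_Diff_subset finite_subset)
    have "{..<5} \<subseteq> J x"
    proof (rule ccontr)
      assume "\<not> {..<5} \<subseteq> J x"
      then obtain p where p: "p < 5" "p \<notin> J x" by auto
      have "q = p" if "q < 5" "q \<notin> J x" for q
        using that p \<open>card ({..<5} - J x) \<le> 1\<close> card_le_Suc0_iff_eq[of "{..<5} - J x"] by auto
      then have "{..<5} - {p} \<subseteq> J x" by auto
      then have "d ({..<5} - {p}) x = x" using sub p by simp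
      then show False using p by (simp add: J_def)
    qed
    then have "x \<in> F" using sub xX by (auto simp: F_def even_set_def)
    then show False using x by simp
  qed
  ultimately show ?thesis by linarith
qed

text \<open>Disjoint pairs multiply to a set of size 4, whose omitted index would lie in
  \<open>J x\<close>.\<close>

lemma disjoint_pairs:
  assumes "x \<in> X" "J x = {}" "d {i, j} x = x" "d {k, l} x = x"
    "i < 5" "j < 5" "k < 5" "l < 5" "i \<noteq> j" "k \<noteq> l" "{i, j} \<inter> {k, l} = {}"
  shows False
proof -
  obtain p where p: "p < 5" "p \<notin> {i, j, k, l}" using obtain_index[of "[i, j, k, l]"] by auto
  have "{i, j, k, l} = {..<5} - {p}"
  proof (rule card_subset_eq)
    show "card {i, j, k, l} = card ({..<5} - {p})" using assms p by (auto simp: card_insert_if)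
  qed (use assms p in auto)
  moreover have "sym_diff {i, j} {k, l} = {i, j, k, l}" using assms by auto
  ultimately have "d ({..<5} - {p}) x = x"
    using assms d_d[of "{i, j}" "{k, l}" x] by simp
  then show False using p assms(2) by (auto simp: J_def)
qed

text \<open>The fixing pairs meet each other, and the product of two overlapping ones is again a
  fixing pair. So they form a single edge or a triangle, and the support has size 2 or 3, against
  \<open>card_2_3\<close>.\<close>

lemma pair_support_empty:
  assumes x: "x \<in> X - F" and J: "J x = {}" shows "pair_support x = {}"
proof (rule ccontr)
  assume "pair_support x \<noteq> {}"
  then obtain i j where ij: "i < 5" "j < 5" "j \<noteq> i" "d {i, j} x = x"
    by (auto simp: pair_support_def)
  have xX: "x \<in> X" using x by simp
  note disj = disjoint_pairs[OF xX J]
  have both: "d {i, m} x = x \<and> d {j, m} x = x" if m: "m \<in> pair_support x" "m \<notin> {i, j}" for m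
  proof -
    obtain p where p: "p < 5" "p \<noteq> m" "d {m, p} x = x" "m < 5" using m
      by (auto simp: pair_support_def)
    then have "p \<in> {i, j}" using disj[of i j m p] ij m by auto
    then have "d {i, m} x = x \<or> d {j, m} x = x" using p by (auto simp: insert_commute)
    moreover have "sym_diff {i, j} {i, m} = {j, m}" "sym_diff {i, j} {j, m} = {i, m}"
      using ij m by auto
    then have "d {i, j} (d {i, m} x) = d {j, m} x" "d {i, j} (d {j, m} x) = d {i, m} x"
      using d_d[of "{i, j}" "{i, m}" x] d_d[of "{i, j}" "{j, m}" x] ij m p xX by auto
    ultimately show ?thesis using ij by auto
  qed
  have in_supp: "i \<in> pair_support x" "j \<in> pair_support x"
    using ij by (auto simp: pair_support_def insert_commute)
  have "card (pair_support x) = 2 \<or> card (pair_support x) = 3"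
  proof (cases "pair_support x \<subseteq> {i, j}")
    case True
    then have "pair_support x = {i, j}" using in_supp by auto
    then show ?thesis using ij by simp
  next
    case False
    then obtain m where m: "m \<in> pair_support x" "m \<notin> {i, j}" by blast
    have "pair_support x \<subseteq> {i, j, m}"
    proof
      fix l assume l: "l \<in> pair_support x"
      show "l \<in> {i, j, m}"
      proof (rule ccontr)
        assume "l \<notin> {i, j, m}"
        then show False
          using disj[of i l j m] both[OF m] both[of l] l m ij by (auto simp: pair_support_def)
      qed
    qed
    then have "pair_support x = {i, j, m}" using in_supp m by auto
    then show ?thesis using ij m by auto
  qed
  moreover have "card (pair_support x) \<noteq> 2" "card (pair_support x) \<noteq> 3"
    using card_2_3[of pair_support x] pair_support_sw pair_support_d x
    by (auto simp: pair_support_def)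
  ultimately show False by blast
qed

definition free_point :: "'x \<Rightarrow> bool" where
  "free_point x \<longleftrightarrow> x \<in> X \<and> (\<forall>S. even_set S \<longrightarrow> d S x = x \<longrightarrow> S = {})"

lemma free_pointI:
  assumes x: "x \<in> X - F" and J: "J x = {}" shows "free_point x"
proof -
  have "S = {}" if S: "even_set S" "d S x = x" for S
  proof -
    have sub: "S \<subseteq> {..<5}" "even (card S)" "finite S" using S even_set_finite
      by (auto simp: even_set_def)
    have "card S \<le> 5" using card_mono[OF _ sub(1)] by simp
    with sub(2) have "card S = 0 \<or> card S = 2 \<or> card S = 4" by presburger
    moreover have "card S \<noteq> 2"
    proof
      assume "card S = 2"
      then obtain i j where "S = {i, j}" "i \<noteq> j" by (auto simp: card_2_iff)
      then have "i \<in> pair_support x" using S sub by (auto simp: pair_support_def)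
      then show False using pair_support_empty[OF assms] by simp
    qed
    moreover have "card S \<noteq> 4"
    proof
      assume "card S = 4"
      then have "S \<noteq> {..<5}" by auto
      then obtain p where p: "p < 5" "p \<notin> S" using sub(1) by blast
      have "S = {..<5} - {p}" using sub p \<open>card S = 4\<close> by (intro card_subset_eq) auto
      then have "p \<in> J x" using S p by (simp add: J_def)
      then show False using J by simp
    qed
    ultimately show ?thesis using sub by auto
  qed
  then show ?thesis using x by (auto simp: free_point_def)
qed

lemma free_inj: "free_point x \<Longrightarrow> inj_on (\<lambda>S. d S x) {S. even_set S}"
proof (rule inj_onI)
  fix S T assume x: "free_point x" and S: "S \<in> {S. even_set S}" and T: "T \<in> {S. even_set S}"
    and eq: "d S x = d T x"
  have "d S (d T x) = x" using x S eq by (metis d_invol free_point_def mem_Collect_eq)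
  then have "d (sym_diff S T) x = x" using x S T by (simp add: free_point_def d_d)
  moreover have "even_set (sym_diff S T)" using S T by (simp add: even_set_sym_diff)
  ultimately have "sym_diff S T = {}" using x unfolding free_point_def by blast
  then show "S = T" by auto
qed

definition E :: "nat \<Rightarrow> 'x set" where
  "E i = {x \<in> X - F. J x = {i}}"

lemma trichotomy:
  obtains "X = F" | x where "free_point x" | "\<And>i. i < 5 \<Longrightarrow>
    card (E i) = 2" "X - F = (\<Union>i<5. E i)" "card F \<le> 7"
proof (cases "X = F \<or> (\<exists>x. free_point x)")
  case True then show ?thesis using that by blast
next
  case False
  have J: "\<exists>i<5. x \<in> E i" if x: "x \<in> X - F" for x
  proof -
    have "J x \<noteq> {}" using False free_pointI[OF x] by blast
    moreover have "finite (J x)" using J_sub by (rule finite_subset) simp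
    ultimately have "card (J x) = 1" using card_J[OF x] by (simp add: le_Suc_eq)
    then obtain i where "J x = {i}" by (auto simp: card_1_singleton_iff)
    then show ?thesis using J_sub[of x] x by (auto simp: E_def)
  qed
  obtain x where x: "x \<in> X - F" using False F_X by blast
  obtain i where i: "i < 5" "J x = {i}" using J[OF x] by (auto simp: E_def)
  note count = class_count[of J x, OF J_sw J_d J_sub x]
  \<comment> \<open>As \<open>J x\<close> is a singleton, the binomial coefficient in
    \<open>class_count\<close> is 5.\<close>
  have "5 * card (E i) \<le> card (X - F)" "2 \<le> card (E i)"
    using count(1,2) i by (simp_all add: E_def)
  moreover have "card (X - F) \<le> card X" using finite_X by (intro card_mono) auto
  ultimately have le: "card (E i) \<le> 3" "2 \<le> card (E i)" using card_X by linarith+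
  \<comment> \<open>The sign change omitting some \<open>k \<noteq> i\<close> is an involution of
    \<open>E i\<close> without fixed points, so the number of points is even.\<close>
  have "card (E i) \<noteq> 3"
  proof
    assume "card (E i) = 3"
    then obtain p q s where pqs: "E i = {p, q, s}" "p \<noteq> q" "q \<noteq> s" "p \<noteq> s"
      by (auto simp: card_3_iff)
    obtain k where k: "k < 5" "k \<notin> {i}" using obtain_index[of "[i]"] by auto
    have "d ({..<5} - {k}) y \<noteq> y" "d ({..<5} - {k}) y \<in> E i" if "y \<in> E i" for y
      using that k J_d d_not_F by (auto simp: E_def J_def)
    moreover have "d ({..<5} - {k}) (d ({..<5} - {k}) y) = y" if "y \<in> E i" for y
      using that k by (simp add: E_def)
    ultimately show False using pqs by (metis insertE insertI1 insertI2 singletonD)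
  qed
  then have "card (E i) = 2" using le by simp
  then have card: "card (E k) = 2" if "k < 5" for k
    using count(3)[of "{k}"] i that by (simp add: E_def)
  have un: "X - F = (\<Union>i<5. E i)" using J by (auto simp: E_def)
  have "card (X - F) = (\<Sum>i<5. card (E i))"
    unfolding un by (rule card_UN_disjoint) (auto simp: E_def finite_X)
  also have "\<dots> = 10" using card by simp
  finally have "card F \<le> 7" using card_X finite_X F_X card_mono[OF finite_X F_X]
    by (simp add: card_Diff_subset finite_subset)
  with card un show ?thesis using that by blast
qed

text \<open>A sign change that fixes \<open>y\<close> still conjugates the transvection. To invert
  only one of \<open>a\<close> and \<open>b\<close> by an even set, a third index \<open>k\<close>
  is added.\<close>

lemma t_sign:
  assumes y: "y \<in> F" and ab: "indep 5 a b" and fst: "fst a' = fst a" "fst b' = fst b"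
  obtains S where "even_set S" "t a' b' y = d S (t a b y)"
proof -
  obtain k where k: "k < 5" "k \<notin> {fst a, fst b}"
    using obtain_index[of "[fst a, fst b]"] by auto
  have lt: "fst a < 5" "fst b < 5" "fst a \<noteq> fst b" using ab by (simp_all add: indep_def)
  consider "a' = a" "b' = b" | "a' = inv_letter a" "b' = b" | "a' = a" "b' = inv_letter b"
    | "a' = inv_letter a" "b' = inv_letter b"
    using letter_eq_or_inv fst by metis
  then obtain S where S: "even_set S" "flip_letters S a = a'" "flip_letters S b = b'"
  proof cases
    case 1 then show ?thesis using that[of "{}"] by (simp add: flip_letters_def)
  next
    case 2 then show ?thesis using that[of "{fst a, k}"] lt k by (simp add: flip_letters_def)
  next
    case 3 then show ?thesis using that[of "{fst b, k}"] lt k by (simp add: flip_letters_def)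
  next
    case 4 then show ?thesis using that[of "{fst a, fst b}"] lt by (simp add: flip_letters_def)
  qed
  have "y \<in> X" "d S y = y" using y S(1) by (simp_all add: F_def)
  then have "t a' b' y = d S (t a b y)" using d_t[OF S(1) ab] S by simp
  then show ?thesis using that S(1) by blast
qed

lemma trivial_if_F:
  assumes XF: "X = F" and ab: "indep 5 a b" and x: "x \<in> X"
  shows "t a b x = x"
proof -
  have sign: "t a' b' y = t a b y"
    if "indep 5 a b" "fst a' = fst a" "fst b' = fst b" "y \<in> X" for a b a' b' y
  proof -
    note ab = that(1-3)
    have yF: "y \<in> F" "t a b y \<in> F" using that XF t_closed by auto
    obtain S where S: "even_set S" "t a' b' y = d S (t a b y)" by (rule t_sign[OF yF(1) ab])
    then show ?thesis using yF(2) by (simp add: F_def)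
  qed
  \<comment> \<open>The multiplied generator is the row index; this order of the indices turns
    \<open>t_steinberg\<close> into the Steinberg relation of
    \<open>binary_transvections\<close>.\<close>
  define r where "r i j = t (j, True) (i, True)" for i j
  interpret r: binary_transvections r X
  proof
    show "finite X" "card X < 18" by (rule finite_X, rule card_X)
    fix y and i j :: nat assume ij: "i < 5" "j < 5" "i \<noteq> j" and y: "y \<in> X"
    show "r i j y \<in> X" using ij y by (simp add: r_def t_closed)
    \<comment> \<open>The inverse transvection is obtained by inverting the multiplying letter,
      which \<open>sign\<close> identifies with the transvection itself.\<close>
    show "r i j (r i j y) = y" using ij y t_inv[of "(j, True)" "(i, True)" y]
      by (simp add: r_def sign[of "(j, True)" "(i, True)" "inv_letter (j, True)" "(i, True)"]
        t_closed)
    fix k :: nat assume k: "k < 5"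
    show "r j k (r i j y) = r i j (r i k (r j k y))" if "j \<noteq> k" "i \<noteq> k"
      using t_steinberg[of "(k, True)" "(j, True)" "(i, True)" y] that ij k y by (simp add: r_def)
    fix l :: nat assume l: "l < 5"
    \<comment> \<open>\<open>t_commute\<close> excludes two equal multiplied letters. Inverting one
      of them by \<open>sign\<close> replaces a left multiplication by a right one, and left and
      right multiplications commute.\<close>
    show "r i j (r k l y) = r k l (r i j y)" if "k \<noteq> l" "j \<noteq> k" "l \<noteq> i"
    proof -
      have "t (j, True) (inv_letter (i, True)) (t (l, True) (k, True) y) =
          t (l, True) (k, True) (t (j, True) (inv_letter (i, True)) y)"
        using that ij k l y by (intro t_commute) (auto simp: inv_letter_def)
      then show ?thesis using that ij k l y
        by (simp add: r_def sign[of "(j, True)" "(i, True)" "(j, True)" "inv_letter (i, True)"]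
          t_closed)
    qed
  qed
  have "t a b x = t (fst a, True) (fst b, True) x"
    using ab x by (intro sign) (simp_all add: indep_def)
  then show ?thesis using r.trivial[of "fst b" "fst a" x] ab x by (simp add: r_def indep_def)
qed

end

section \<open>Points with free sign changes\<close>

text \<open>This signed 3-cycle sends \<open>m\<close> to \<open>k\<close>, \<open>k\<close> to the
  inverse of \<open>l\<close>, and that inverse to \<open>m\<close>, so the signs cancel in the
  cube.\<close>

lemma swap_cycle:
  assumes "k < 5" "l < 5" "m < 5" "k \<noteq> l" "l \<noteq> m" "k \<noteq> m"
  defines "s \<equiv> swap_letter (k, True) (l, True) \<circ> swap_letter (l, True) (m, True)"
  shows "s \<circ> (s \<circ> s) = id"
proof (rule ext)
  fix x :: "nat letter"
  obtain i b where x: "x = (i, b)" by (cases x)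
  consider "i = k" | "i = l" | "i = m" | "i \<notin> {k, l, m}" by blast
  then show "(s \<circ> (s \<circ> s)) x = id x"
    using assms(4-6) unfolding s_def x
    by cases (cases b; simp add: swap_letter_def inv_letter_def)+
qed

text \<open>For a 3-element \<open>B\<close>, these are the even sets invariant under the 3-cycle of
  \<open>B\<close>; they form a Klein four-group.\<close>

definition block_sets :: "nat set \<Rightarrow> nat set set" where
  "block_sets B = {R. even_set R \<and> (B \<subseteq> R \<or> B \<inter> R = {})}"

text \<open>\<open>R\<close> agrees with \<open>T\<close> outside \<open>B\<close>. As
  \<open>card B\<close> is odd, including all of \<open>B\<close> repairs the parity if necessary,
  and what remains of \<open>T\<close> lies inside \<open>B\<close>.\<close>

lemma block_decomposition:
  assumes B: "B \<subseteq> {..<5}" "odd (card B)" and T: "even_set T"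
  obtains S R where "even_set S" "S \<subseteq> B" "R \<in> block_sets B" "T = sym_diff S R"
proof -
  define R where "R = (if even (card (T \<inter> B)) then T - B else (T - B) \<union> B)"
  have fin: "finite T" "finite B" using T B even_set_finite finite_subset by auto
  have "card T = card (T - B) + card (T \<inter> B)"
    using fin by (simp add: card_Diff_subset_Int card_mono)
  then have par: "even (card (T - B)) \<longleftrightarrow> even (card (T \<inter> B))"
    using T by (simp add: even_set_def)
  have cU: "card ((T - B) \<union> B) = card (T - B) + card B"
    using fin by (intro card_Un_disjoint) auto
  have R: "even_set R"
  proof (cases "even (card (T \<inter> B))")
    case True
    then show ?thesis using T par by (auto simp: R_def even_set_def)
  next
    case False
    then have "even (card ((T - B) \<union> B))" unfolding cU using par B by simp
    then show ?thesis using False T B unfolding even_set_def R_def by auto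
  qed
  show ?thesis
  proof
    show "even_set (sym_diff T R)" using T R by (rule even_set_sym_diff)
    show "sym_diff T R \<subseteq> B" by (auto simp: R_def)
    show "R \<in> block_sets B" using R by (auto simp: block_sets_def R_def)
    show "T = sym_diff (sym_diff T R) R" by auto
  qed
qed

lemma block_sets_sym_diff: "R \<in> block_sets B \<Longrightarrow> Q \<in> block_sets B \<Longrightarrow> sym_diff R Q \<in> block_sets B"
  by (auto simp: block_sets_def intro: even_set_sym_diff)

lemma card_block_sets:
  assumes "B \<subseteq> {..<5}" "card B = 3" shows "card (block_sets B) = 4" "finite (block_sets B)"
proof -
  have fin: "finite B" using assms by (auto intro: card_ge_0_finite)
  have "card ({..<5} - B) = 2" using assms fin by (simp add: card_Diff_subset)
  then obtain i j where ij: "{..<5} - B = {i, j}" "i \<noteq> j" by (auto simp: card_2_iff)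
  have iB: "i \<notin> B" "j \<notin> B" "i < 5" "j < 5" using ij by auto
  have split: "{..<5} = B \<union> {i, j}" using ij assms by auto
  have "block_sets B = {{}, {i, j}, insert i B, insert j B}"
  proof (intro equalityI subsetI)
    fix R assume R: "R \<in> block_sets B"
    then have Rs: "even_set R" "R \<subseteq> B \<union> {i, j}" unfolding split[symmetric]
      by (auto simp: block_sets_def even_set_def)
    consider "B \<subseteq> R" | "B \<inter> R = {}" using R by (auto simp: block_sets_def)
    then show "R \<in> {{}, {i, j}, insert i B, insert j B}"
    proof cases
      case 1
      then have "R = B \<or> R = insert i B \<or> R = insert j B \<or> R = insert i (insert j B)"
        using Rs(2) by auto
      moreover have "odd (card B)" "odd (card (insert i (insert j B)))"
        using assms iB ij fin by auto
      ultimately show ?thesis using Rs(1) by (auto simp: even_set_def)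
    next
      case 2
      then have "R = {} \<or> R = {i} \<or> R = {j} \<or> R = {i, j}" using Rs(2) by auto
      then show ?thesis using Rs(1) by (auto simp: even_set_def)
    qed
  next
    fix R assume "R \<in> {{}, {i, j}, insert i B, insert j B}"
    then show "R \<in> block_sets B"
      using assms iB ij fin by (auto simp: block_sets_def even_set_def)
  qed
  moreover have "{i, j} \<noteq> insert i B" "{i, j} \<noteq> insert j B" "insert i B \<noteq> insert j B"
    using iB ij(2) by (metis insertE insertI1 insertI2 singletonD)+
  then have "card {{}, {i, j}, insert i B, insert j B} = 4" by (simp add: card_insert_if)
  ultimately show "card (block_sets B) = 4" "finite (block_sets B)" by auto
qed

context transvection_action
begin

text \<open>A free orbit has 16 points, so at most one point is left over; it is then fixed by all
  sign changes and lies in \<open>F\<close>.\<close>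

lemma free_orbit:
  assumes x: "free_point x" and y: "y \<in> X - F"
  obtains S where "even_set S" "y = d S x"
proof -
  define Q0 where "Q0 = (\<lambda>S. d S x) ` {S. even_set S}"
  have xX: "x \<in> X" using x by (simp add: free_point_def)
  have "card Q0 = 16"
    unfolding Q0_def using card_image[OF free_inj[OF x]] card_even_sets by simp
  have OX: "Q0 \<subseteq> X" using xX by (auto simp: Q0_def d_closed)
  then have "card (X - Q0) \<le> 1"
    using \<open>card Q0 = 16\<close> card_X finite_X by (simp add: card_Diff_subset finite_subset)
  have "y \<in> Q0"
  proof (rule ccontr)
    assume yO: "y \<notin> Q0"
    have "d S y = y" if S: "even_set S" for S
    proof -
      have "d S y \<notin> Q0"
      proof
        assume "d S y \<in> Q0"
        then obtain T where T: "even_set T" "d S y = d T x" by (auto simp: Q0_def)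
        then have "y = d (sym_diff S T) x" using S y xX d_d[of S T x] d_invol[of S y] by auto
        then show False using yO S T even_set_sym_diff[of S T] unfolding Q0_def by blast
      qed
      then show ?thesis
        using yO S y \<open>card (X - Q0) \<le> 1\<close> finite_X card_le_Suc0_iff_eq[of "X - Q0"]
          by (auto simp: d_closed)
    qed
    then show False using y by (auto simp: F_def)
  qed
  then show ?thesis using that by (auto simp: Q0_def)
qed

lemma free_point_d: "free_point x \<Longrightarrow> even_set S \<Longrightarrow> free_point (d S x)"
  unfolding free_point_def by (metis d_closed d_commute d_inj)

lemma free_all: "free_point x \<Longrightarrow> y \<in> X - F \<Longrightarrow> free_point y"
  by (metis free_orbit free_point_d)

lemma free_not_F: "free_point x \<Longrightarrow> x \<in> X - F"
proof -
  assume x: "free_point x"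
  have "even_set {0, 1}" by simp
  then have "d {0, 1} x \<noteq> x" using x unfolding free_point_def by (metis insert_not_empty)
  with x \<open>even_set {0, 1}\<close> show ?thesis unfolding free_point_def F_def by blast
qed

lemma free_eq_iff:
  "free_point x \<Longrightarrow> even_set S \<Longrightarrow> even_set T \<Longrightarrow> d S x = d T x \<longleftrightarrow> S = T"
  using free_inj[of x] by (auto dest: inj_onD)

text \<open>A sign change \<open>d {k, l}\<close> at indices off the transvection commutes with it
  and moves \<open>x\<close>, hence also the image; and outside \<open>F\<close> all points are
  free.\<close>

lemma free_t:
  assumes x: "free_point x" and ab: "indep 5 a b" shows "free_point (t a b x)"
proof -
  obtain k where k: "k < 5" "k \<notin> {fst a, fst b}" using obtain_index[of "[fst a, fst b]"] by auto
  obtain l where l: "l < 5" "l \<notin> {fst a, fst b, k}"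
    using obtain_index[of "[fst a, fst b, k]"] by auto
  have ev: "even_set {k, l}" using k l by auto
  have xX: "x \<in> X" using x by (simp add: free_point_def)
  have "d {k, l} x \<noteq> x" using x ev unfolding free_point_def by blast
  then have "d {k, l} (t a b x) \<noteq> t a b x"
    using d_t_commute[OF ev ab xX] k l ab xX ev by (auto simp: t_inj d_closed)
  then have "t a b x \<in> X - F" using ev ab xX by (auto simp: F_def t_closed)
  then show ?thesis using free_all[OF x] by blast
qed

text \<open>The elements \<open>d T\<close> with \<open>T \<subseteq> B\<close> commute with the transvection. The points fixed by the
  3-cycle of \<open>B\<close> form an orbit of the Klein four-group of all \<open>d R\<close> with \<open>R \<in> block_sets B\<close>, and
  a Klein four-group is normal in the symmetric group on its four elements.\<close>

lemma t_normalizes_d: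
  assumes x0: "free_point x0" and ab: "indep 5 a b" and S: "even_set S"
  obtains S' where "even_set S'" "\<And>y. y \<in> X - F \<Longrightarrow> t a b (d S y) = d S' (t a b y)"
proof -
  obtain k where k: "k < 5" "k \<notin> {fst a, fst b}" using obtain_index[of "[fst a, fst b]"] by auto
  obtain l where l: "l < 5" "l \<notin> {fst a, fst b, k}"
    using obtain_index[of "[fst a, fst b, k]"] by auto
  obtain m where m: "m < 5" "m \<notin> {fst a, fst b, k, l}"
    using obtain_index[of "[fst a, fst b, k, l]"] by auto
  define B where "B = {k, l, m}"
  have B: "B \<subseteq> {..<5}" "card B = 3" "fst a \<notin> B" "fst b \<notin> B" using k l m by (auto simp: B_def)
  define s where "s = swap_letter (k, True) (l, True) \<circ> swap_letter (l, True) (m, True)"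
  have mono: "monomial s" unfolding s_def using k l m
    by (intro monomial_comp monomial_single) auto
  have s3: "s \<circ> (s \<circ> s) = id" unfolding s_def using k l m by (intro swap_cycle) auto
  define p where "p = index_map s"
  have p_def': "p = transp k l \<circ> transp l m"
    unfolding p_def s_def using k l m by (simp add: index_map_comp monomial_single index_map_swap)
  have mu_s: "mu s y = sw k l (sw l m y)" if "y \<in> X" for y
    unfolding s_def sw_def using that k l m by (simp add: mu_comp monomial_single)
  have mu_s_F: "mu s y \<in> X - F" if "y \<in> X - F" for y
  proof -
    have "sw k l (sw l m y) \<in> X - F" by (intro sw_not_F) (use that k l m in auto)
    then show ?thesis using that by (simp add: mu_s)
  qed
  have mu_s_d: "mu s (d S y) = d (p ` S) (mu s y)" if "even_set S" "y \<in> X" for S y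
    using that mono by (simp add: mu_d p_def)
  have ev_p: "even_set (p ` S)" if "even_set S" for S
    using that mono by (simp add: p_def even_set_image)
  have mu_s_t: "mu s (t a' b y) = t a' b (mu s y)" if "y \<in> X" "fst a' = fst a" "indep 5 a' b"
    for y a'
  proof -
    have s_fix: "s x = x" if "fst x \<notin> B" for x
      using that by (auto simp: s_def B_def swap_letter_def)
    show ?thesis using that mono B by (simp add: mu_t s_fix)
  qed
  have mu_s3: "mu s (mu s (mu s y)) = y" if "y \<in> X" for y
    using that mono s3 by (metis mu_comp mu_id monomial_comp)
  \<comment> \<open>A cocycle of a group of order 3 with values in a 2-group splits: with symmetric
    difference as addition, the trivial cube of \<open>mu s\<close> gives
    \<open>p p b + p b + b = 0\<close>, so translating \<open>x0\<close> by \<open>p b\<close>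
    yields a fixed point.\<close>
  obtain x1 where x1: "free_point x1" "mu s x1 = x1"
  proof -
    have x0X: "x0 \<in> X" using x0 by (simp add: free_point_def)
    obtain b where b: "even_set b" "mu s x0 = d b x0"
      using free_orbit[OF x0 mu_s_F[OF free_not_F[OF x0]]] by blast
    have "d (p ` p ` b) (d (p ` b) (d b x0)) = x0"
      using mu_s3[OF x0X] b x0X by (simp add: mu_s_d ev_p d_closed)
    then have "d (sym_diff (p ` p ` b) (sym_diff (p ` b) b)) x0 = x0"
      using b x0X by (simp add: d_d ev_p even_set_sym_diff)
    then have "sym_diff (p ` p ` b) (sym_diff (p ` b) b) = {}"
      using x0 b ev_p even_set_sym_diff unfolding free_point_def by meson
    then have "sym_diff (p ` p ` b) b = p ` b" by blast
    then have "mu s (d (p ` b) x0) = d (p ` b) x0"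
      using b x0X by (simp add: mu_s_d ev_p d_d)
    then show ?thesis using that free_point_d[OF x0 ev_p] b by blast
  qed
  have x1X: "x1 \<in> X" using x1 by (simp add: free_point_def)
  have block_even: "even_set R" if "R \<in> block_sets B" for R using that by (simp add: block_sets_def)
  have fixed_iff: "mu s (d R x1) = d R x1 \<longleftrightarrow> R \<in> block_sets B" if R: "even_set R" for R
  proof -
    have "mu s (d R x1) = d R x1 \<longleftrightarrow> p ` R = R"
      using R x1 x1X by (simp add: mu_s_d free_eq_iff ev_p)
    also have "\<dots> \<longleftrightarrow> R \<in> block_sets B"
    proof
      assume eq: "p ` R = R"
      have p: "p k = l" "p l = m" "p m = k" using k l m
        by (auto simp: p_def' Transposition.transpose_def)
      have "k \<in> R \<Longrightarrow> l \<in> R" "l \<in> R \<Longrightarrow> m \<in> R" "m \<in> R \<Longrightarrow> k \<in> R"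
        using p eq by (metis imageI)+
      then show "R \<in> block_sets B" using R by (auto simp: block_sets_def B_def)
    next
      assume "R \<in> block_sets B"
      then have "B \<subseteq> R \<or> B \<inter> R = {}" by (simp add: block_sets_def)
      then have "l \<in> R \<longleftrightarrow> m \<in> R" "k \<in> R \<longleftrightarrow> l \<in> R" by (auto simp: B_def)
      then have "transp l m ` R = R" "transp k l ` R = R"
        by simp_all
      then show "p ` R = R" unfolding p_def' image_comp[symmetric] by simp
    qed
    finally show ?thesis .
  qed
  \<comment> \<open>These are the free points fixed by \<open>mu s\<close>. Transvections at indices
    outside \<open>B\<close> commute with \<open>mu s\<close> and therefore preserve this
    set.\<close>
  define V where "V = (\<lambda>R. d R x1) ` block_sets B"
  have tV: "t a' b y \<in> V" if y: "y \<in> V" and a': "fst a' = fst a" "indep 5 a' b" for a' y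
  proof -
    obtain R where R: "R \<in> block_sets B" "y = d R x1" using y by (auto simp: V_def)
    then have yX: "y \<in> X" and fy: "free_point y" using x1X x1 block_even
      by (auto simp: d_closed free_point_d)
    have "mu s y = y" using R fixed_iff block_even by blast
    then have fixed: "mu s (t a' b y) = t a' b y" using mu_s_t[OF yX a'] by simp
    obtain Q where Q: "even_set Q" "t a' b y = d Q x1"
      using free_orbit[OF x1(1) free_not_F[OF free_t[OF fy a'(2)]]] by blast
    then have "Q \<in> block_sets B" using fixed fixed_iff by simp
    then show ?thesis using Q by (simp add: V_def)
  qed
  have dV: "d R y \<in> V" if "y \<in> V" "R \<in> block_sets B" for y R
    using that x1X block_sets_sym_diff block_even by (auto simp: V_def d_d)
  have ab': "indep 5 (inv_letter a) b" using ab by simp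
  have block: "\<exists>Q\<in>block_sets B. \<forall>y\<in>X - F. t a b (d R y) = d Q (t a b y)" if R: "R \<in> block_sets B"
    for R
  proof (cases "R = {}")
    case True
    have "{} \<in> block_sets B" by (simp add: block_sets_def)
    then show ?thesis using True ab by (auto simp: t_closed intro!: bexI[of _ "{}"])
  next
    case False
    \<comment> \<open>The conjugate of \<open>d R\<close> by the transvection; it will turn out to
      be some \<open>d Q\<close> on \<open>X - F\<close>.\<close>
    define h where "h y = t a b (d R (t (inv_letter a) b y))" for y
    have evR: "even_set R" using R block_even by simp
    have hX: "h y \<in> X" if "y \<in> X" for y using that ab evR by (simp add: h_def t_closed d_closed)
    have hV: "h y \<in> V" if "y \<in> V" for y unfolding h_def using that R ab by (intro tV dV) auto
    have hh: "h (h y) = y" if "y \<in> X" for y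
      using that ab evR by (simp add: h_def t_inv t_inv' t_closed d_closed)
    have h_inj: "h y = h z \<longleftrightarrow> y = z" if "y \<in> X" "z \<in> X" for y z using hh that by metis
    have h_neq: "h y \<noteq> y" if y: "free_point y" for y
    proof
      assume eq: "h y = y"
      have yX: "y \<in> X" using y by (simp add: free_point_def)
      let ?z = "t (inv_letter a) b y"
      have zX: "?z \<in> X" and zf: "free_point ?z" using yX y ab by (simp_all add: t_closed free_t)
      have "d R ?z = ?z" using arg_cong[OF eq, of "t (inv_letter a) b"] zX evR ab
        by (simp add: h_def t_inv d_closed)
      then show False using zf evR False unfolding free_point_def by blast
    qed
    have x1V: "x1 \<in> V" unfolding V_def
      by (rule image_eqI[of _ _ "{}"]) (simp_all add: x1X block_sets_def)
    obtain Q where Q: "Q \<in> block_sets B" "h x1 = d Q x1" using hV[OF x1V] by (auto simp: V_def)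
    have evQ: "even_set Q" using Q block_even by simp
    have "Q \<noteq> {}" using h_neq[OF x1(1)] Q x1X by auto
    \<comment> \<open>\<open>h\<close> is an involution without fixed points on the four points of
      \<open>V\<close>. It exchanges \<open>x1\<close> and \<open>d Q x1\<close>, hence also the
      other two points, exactly as \<open>d Q\<close> does.\<close>
    have h_block: "h (d P x1) = d Q (d P x1)" if P: "P \<in> block_sets B" for P
    proof -
      have evP: "even_set P" using P block_even by simp
      have PX: "d P x1 \<in> X" using evP x1X by (simp add: d_closed)
      consider "P = {}" | "P = Q" | "P \<noteq> {}" "P \<noteq> Q" by blast
      then show ?thesis
      proof cases
        case 1 then show ?thesis using Q x1X by simp
      next
        case 2 then show ?thesis using Q hh[OF x1X] evQ x1X by simp
      next
        case 3
        obtain P' where P': "P' \<in> block_sets B" "h (d P x1) = d P' x1"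
          using hV[of "d P x1"] P by (auto simp: V_def)
        have "P' \<noteq> P" using h_neq[of "d P x1"] free_point_d[OF x1(1) evP] P' by auto
        moreover have "P' \<noteq> {}"
        proof
          assume "P' = {}"
          then have "d P x1 = h x1" using hh[OF PX] P' x1X by simp
          then show False using Q 3 x1(1) evP evQ by (simp add: free_eq_iff)
        qed
        moreover have "P' \<noteq> Q"
        proof
          assume "P' = Q"
          then have "d P x1 = d {} x1" using h_inj[OF PX x1X] P' Q x1X by simp
          then show False using 3 x1(1) evP free_eq_iff[of x1 P "{}"] by simp
        qed
        moreover have "block_sets B = {{}, Q, P, sym_diff Q P}"
        proof (rule card_subset_eq[symmetric])
          have "sym_diff Q P \<noteq> {}" "sym_diff Q P \<noteq> Q" "sym_diff Q P \<noteq> P"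
            using 3 \<open>Q \<noteq> {}\<close> by auto
          then show "card {{}, Q, P, sym_diff Q P} = card (block_sets B)"
            using 3 \<open>Q \<noteq> {}\<close> card_block_sets[OF B(1,2)] by (simp add: card_insert_if)
          show "{{}, Q, P, sym_diff Q P} \<subseteq> block_sets B"
            using Q P block_sets_sym_diff[of Q B P] by (simp add: block_sets_def)
        qed (use card_block_sets[OF B(1,2)] in simp)
        ultimately have "P' = sym_diff Q P" using P' by blast
        then show ?thesis using P' evP evQ x1X by (simp add: d_d)
      qed
    qed
    \<comment> \<open>\<open>h\<close> commutes with the sign changes inside \<open>B\<close>, and
      these carry \<open>V\<close> over the whole free orbit, so the agreement of \<open>h\<close>
      with \<open>d Q\<close> spreads from \<open>V\<close> to \<open>X - F\<close>.\<close>
    have h_all: "h y = d Q y" if y: "y \<in> X - F" for y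
    proof -
      obtain T where T: "even_set T" "y = d T x1" using free_orbit[OF x1(1) y] by blast
      obtain S P where SP: "even_set S" "S \<subseteq> B" "P \<in> block_sets B" "T = sym_diff S P"
        using block_decomposition[OF B(1) _ T(1)] B(2) by (metis odd_numeral)
      have evP: "even_set P" using SP block_even by simp
      have y': "y = d S (d P x1)" using SP evP x1X T by (simp add: d_d)
      have PX: "d P x1 \<in> X" using evP x1X by (simp add: d_closed)
      have aS: "fst a \<notin> S" "fst b \<notin> S" using SP B by auto
      have "h (d S z) = d S (h z)" if "z \<in> X" for z
        using that aS ab SP(1) evR
        by (simp add: h_def d_t_commute[symmetric] t_closed d_closed d_commute[of R S])
      then have "h y = d S (d Q (d P x1))" using y' PX h_block[OF SP(3)] by simp
      then show ?thesis using y' SP(1) evQ PX by (simp add: d_commute[of S Q])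
    qed
    have "t a b (d R y) = d Q (t a b y)" if y: "y \<in> X - F" for y
    proof -
      have "t a b y \<in> X - F" using free_not_F[OF free_t[OF free_all[OF x1(1) y] ab]] .
      then show ?thesis using h_all[of "t a b y"] y ab by (simp add: h_def t_inv)
    qed
    then show ?thesis using Q by blast
  qed
  \<comment> \<open>The factor inside \<open>B\<close> commutes with the transvection, and
    \<open>block\<close> treats the other factor.\<close>
  obtain T R where TR: "even_set T" "T \<subseteq> B" "R \<in> block_sets B" "S = sym_diff T R"
    using block_decomposition[OF B(1) _ S] B(2) by (metis odd_numeral)
  obtain Q where Q: "Q \<in> block_sets B" "\<And>y. y \<in> X - F \<Longrightarrow> t a b (d R y) = d Q (t a b y)"
    using block[OF TR(3)] by blast
  show ?thesis
  proof
    show "even_set (sym_diff T Q)" using TR Q block_even by (simp add: even_set_sym_diff)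
    fix y assume y: "y \<in> X - F"
    have "t a b (d S y) = t a b (d T (d R y))" using TR y block_even by (simp add: d_d)
    also have "\<dots> = d T (t a b (d R y))"
    proof (rule d_t_commute[symmetric])
      show "fst a \<notin> T" "fst b \<notin> T" using TR B by auto
    qed (use TR ab y block_even in \<open>auto simp: d_closed\<close>)
    also have "\<dots> = d (sym_diff T Q) (t a b y)" using Q y TR block_even ab
      by (simp add: d_d t_closed)
    finally show "t a b (d S y) = d (sym_diff T Q) (t a b y)" .
  qed
qed

end

context transvection_action
begin

lemma no_free_point: "\<not> free_point x0"
proof
  assume x0: "free_point x0"
  have x0X: "x0 \<in> X" using x0 by (simp add: free_point_def)
  \<comment> \<open>\<open>d N\<close> is the conjugate of \<open>d S\<close> by the transvection.
    At a free point \<open>d\<close> is injective, so the choice is unique, and the relations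
    between the transvections carry over to \<open>N\<close> by evaluation at such points.\<close>
  define N where "N a b S = (SOME S'. even_set S' \<and> (\<forall>y\<in>X - F. t a b (d S y) = d S' (t a b y)))"
    for a b S
  have N: "even_set (N a b S) \<and> (\<forall>y\<in>X - F. t a b (d S y) = d (N a b S) (t a b y))"
    if "indep 5 a b" "even_set S" for a b S
  proof -
    note abS = that
    obtain S' where "even_set S'" "\<And>y. y \<in> X - F \<Longrightarrow> t a b (d S y) = d S' (t a b y)"
      using t_normalizes_d[OF x0 abS] by blast
    then have "\<exists>S'. even_set S' \<and> (\<forall>y\<in>X - F. t a b (d S y) = d S' (t a b y))" by blast
    then show ?thesis unfolding N_def by (rule someI_ex)
  qed
  have Ne: "even_set (N a b S)" if "indep 5 a b" "even_set S" for a b S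
    using N[OF that] by blast
  have Nt: "t a b (d S y) = d (N a b S) (t a b y)" if "indep 5 a b" "even_set S" "free_point y"
    for a b S y
    using N[OF that(1,2)] free_not_F[OF that(3)] by blast
  have eqI: "S = T" if "even_set S" "even_set T" "d S y = d T y" "free_point y" for S T y
    using that free_eq_iff by blast
  have fX: "y \<in> X" if "free_point y" for y using that by (simp add: free_point_def)
  have f_mu: "free_point (mu m y)" if "monomial m" "free_point y" for m y
    using that
  proof (induction arbitrary: y rule: monomial.induct)
    case (monomial_swap a b m)
    have ba: "indep 5 b a" using monomial_swap.hyps by (auto simp: indep_def)
    have "mu (swap_letter a b \<circ> m) y = mu (swap_letter a b) (mu m y)"
      using monomial_swap by (intro mu_comp) (auto simp: monomial_single fX)
    also have "\<dots> = t a b (t (inv_letter b) a (t (inv_letter a) (inv_letter b) (mu m y)))"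
      using monomial_swap by (intro mu_swap) (auto simp: fX)
    finally have eq: "mu (swap_letter a b \<circ> m) y =
        t a b (t (inv_letter b) a (t (inv_letter a) (inv_letter b) (mu m y)))" .
    show ?case unfolding eq using monomial_swap ba by (simp add: free_t)
  qed (simp add: mu_id fX)
  \<comment> \<open>The conjugation action on the flips is an action of the same kind in which the flips act
    trivially, because they commute.\<close>
  interpret N: transvection_action "{S. even_set S}" N "\<lambda>m S. index_map m ` S"
  proof
    show "finite {S. even_set S}" by (rule finite_subset[of _ "Pow {..<5}"]) (auto simp:
      even_set_def)
    show "card {S. even_set S} < 18" by (simp add: card_even_sets)
    fix a b :: "nat letter" and S assume ab: "indep 5 a b" and S: "S \<in> {S. even_set S}"
    show "N a b S \<in> {S. even_set S}" using Ne ab S by simp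
    have "d (N (inv_letter a) b (N a b S)) x0 = d S x0"
    proof -
      have "t (inv_letter a) b (d (N a b S) (t a b x0)) = d (N (inv_letter a) b (N a b S)) x0"
        using ab S x0 x0X by (subst Nt) (simp_all add: Ne free_t t_inv)
      moreover have "d (N a b S) (t a b x0) = t a b (d S x0)" using ab S x0 by (simp add: Nt)
      ultimately show ?thesis using ab S x0X by (simp add: t_inv d_closed)
    qed
    then show "N (inv_letter a) b (N a b S) = S" using ab S x0 by (intro eqI) (auto simp: Ne)
    have NN: "t a b (t c e (d S x0)) = d (N a b (N c e S)) (t a b (t c e x0))"
      if "indep 5 a b" "indep 5 c e" for a b c e
      using that S x0 by (simp add: Nt Ne free_t)
    fix c e :: "nat letter"
    show "N a b (N c e S) = N c e (N a b S)"
      if "indep 5 c e" "fst a \<noteq> fst e" "fst c \<noteq> fst b" "b \<noteq> e"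
    proof (rule eqI)
      show "d (N a b (N c e S)) (t a b (t c e x0)) = d (N c e (N a b S)) (t a b (t c e x0))"
        using NN[of a b c e] NN[of c e a b] t_commute[of a b c e] that ab S x0X
          by (simp add: d_closed)
    qed (use that ab S x0 in \<open>simp_all add: Ne free_t\<close>)
    show "N a b (N b c S) = N b c (N a c (N a b S))" if "indep 5 b c" "fst a \<noteq> fst c"
    proof (rule eqI)
      have ac: "indep 5 a c" using ab that by (simp add: indep_def)
      have "t b c (t a c (t a b (d S x0))) = d (N b c (N a c (N a b S))) (t b c (t a c (t a b x0)))"
        using that ab ac S x0 by (simp add: Nt Ne free_t)
      then show "d (N a b (N b c S)) (t a b (t b c x0)) =
        d (N b c (N a c (N a b S))) (t a b (t b c x0))"
        using NN[of a b b c] t_steinberg[of a b c] that ab S x0X by (simp add: d_closed)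
      show "even_set (N b c (N a c (N a b S)))" using that ab ac S by (simp add: Ne)
    qed (use that ab S x0 in \<open>simp_all add: Ne free_t\<close>)
    show "index_map (swap_letter a b) ` S =
      N a b (N (inv_letter b) a (N (inv_letter a) (inv_letter b) S))"
    proof (rule eqI)
      have ba: "indep 5 b a" using ab by (auto simp: indep_def)
      have "mu (swap_letter a b) (d S x0) =
          d (N a b (N (inv_letter b) a (N (inv_letter a) (inv_letter b) S))) (mu (swap_letter a
            b) x0)"
        using ab ba S x0 x0X by (simp add: mu_swap d_closed Nt Ne free_t)
      then show "d (index_map (swap_letter a b) ` S) (mu (swap_letter a b) x0) =
          d (N a b (N (inv_letter b) a (N (inv_letter a) (inv_letter b) S))) (mu (swap_letter a
            b) x0)"
        using ab S x0X by (simp add: mu_d monomial_single)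
      show "even_set (N a b (N (inv_letter b) a (N (inv_letter a) (inv_letter b) S)))"
        using ab ba S by (simp add: Ne)
    qed (use ab S x0 in \<open>simp_all add: even_set_image monomial_single f_mu\<close>)
  next
    fix m and S assume m: "monomial m" and S: "S \<in> {S. even_set S}"
    show "index_map m ` S \<in> {S. even_set S}" using m S by (simp add: even_set_image)
    fix k assume k: "monomial k"
    show "index_map (m \<circ> k) ` S = index_map m ` index_map k ` S"
      using m by (simp add: index_map_comp image_comp)
  next
    fix S assume "S \<in> {S. even_set S}"
    show "index_map id ` S = S" by (simp add: index_map_def)
  next
    fix m a b S assume m: "monomial m" and ab: "indep 5 a b" and S: "S \<in> {S. even_set S}"
    show "index_map m ` N a b S = N (m a) (m b) (index_map m ` S)"
    proof (rule eqI)
      have "mu m (t a b (d S x0)) = d (index_map m ` N a b S) (mu m (t a b x0))"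
        using m ab S x0 x0X by (simp add: Nt Ne mu_d t_closed)
      moreover have "mu m (t a b (d S x0)) = t (m a) (m b) (d (index_map m ` S) (mu m x0))"
        using m ab S x0X by (simp add: mu_t d_closed mu_d)
      moreover have "\<dots> = d (N (m a) (m b) (index_map m ` S)) (mu m (t a b x0))"
        using m ab S x0 x0X by (simp add: mu_t Nt indep_monomial even_set_image f_mu)
      ultimately show "d (index_map m ` N a b S) (mu m (t a b x0)) =
          d (N (m a) (m b) (index_map m ` S)) (mu m (t a b x0))" by simp
    qed (use m ab S x0 in \<open>simp_all add: Ne even_set_image indep_monomial f_mu free_t\<close>)
  qed
  have "N.F = {S. even_set S}"
  proof -
    have "index_map (flip_letters T) = id" for T
      by (simp add: fun_eq_iff index_map_def flip_letters_def)
    then show ?thesis by (auto simp: N.F_def N.d_def)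
  qed
  then have triv: "N a b S = S" if "indep 5 a b" "even_set S" for a b S
    using N.trivial_if_F that by simp
  \<comment> \<open>The swap is a product of transvections, so it conjugates trivially as well; but
    its transposition carries {1, 2} to {0, 2}.\<close>
  have "index_map (swap_letter (0, True) (1, True)) ` {1, 2} = {1, 2}"
    by (subst N.mu_swap) (auto simp: triv)
  then have "transp 0 1 ` {1, 2::nat} = {1, 2}"
    by (simp add: index_map_swap)
  then show False by (auto simp: Transposition.transpose_def split: if_splits)
qed

end

section \<open>Paired points\<close>

lemma two_commute:
  assumes "card A = 2" "f ` A \<subseteq> A" "g ` A \<subseteq> A" "inj_on f A" "inj_on g A" "x \<in> A"
  shows "f (g x) = g (f x)"
proof -
  obtain p q where A: "A = {p, q}" "p \<noteq> q" using assms(1) by (auto simp: card_2_iff)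
  have "f p \<in> {p, q}" "f q \<in> {p, q}" "f p \<noteq> f q" "g p \<in> {p, q}" "g q \<in> {p, q}" "g p \<noteq> g q"
    using assms A by (auto simp: inj_on_def)
  then show ?thesis using assms(6) A by auto
qed

text \<open>\<open>P i j y\<close> says that a transvection for the index pair \<open>(i, j)\<close> moves \<open>y\<close>. The roles of the
  multiplying and of the multiplied generator are interchanged between the two applications.\<close>

lemma ten_points:
  fixes z :: "nat \<Rightarrow> nat \<Rightarrow> 'a"
  assumes fin: "finite A"
    and z: "\<And>i j. i < 5 \<Longrightarrow> j < 5 \<Longrightarrow> i \<noteq> j \<Longrightarrow> z i j \<in> A"
    and P1: "\<And>i j. i < 5 \<Longrightarrow> j < 5 \<Longrightarrow> i \<noteq> j \<Longrightarrow> P i j (z i j)"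
    and P2: "\<And>i j k. i < 5 \<Longrightarrow> j < 5 \<Longrightarrow> i \<noteq> j \<Longrightarrow> k < 5 \<Longrightarrow> k \<notin> {i, j} \<Longrightarrow> P j k (z i j)"
    and P3: "\<And>i j k. i < 5 \<Longrightarrow> j < 5 \<Longrightarrow> i \<noteq> j \<Longrightarrow> k < 5 \<Longrightarrow> k \<notin> {i, j} \<Longrightarrow> \<not> P k j (z i j)"
    and P4: "\<And>i j k l. i < 5 \<Longrightarrow> j < 5 \<Longrightarrow> i \<noteq> j \<Longrightarrow> k < 5 \<Longrightarrow> l < 5 \<Longrightarrow> k \<noteq> l \<Longrightarrow>
      k \<notin> {i, j} \<Longrightarrow> l \<notin> {i, j} \<Longrightarrow> \<not> P k l (z i j)"
  shows "10 \<le> card A"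
proof -
  \<comment> \<open>The hypotheses do not separate \<open>z i j\<close> from \<open>z j i\<close>,
    so points are counted by unordered pairs; for different pairs some instance of \<open>P\<close>
    distinguishes the points.\<close>
  have uniq: "{i, j} = {k, l}"
    if ij: "i < 5" "j < 5" "i \<noteq> j" and kl: "k < 5" "l < 5" "k \<noteq> l" and eq: "z i j = z k l"
      for i j k l :: nat
  proof (rule ccontr)
    assume ne: "{i, j} \<noteq> {k, l}"
    obtain m where m: "m < 5" "m \<notin> {i, j, k, l}"
      using obtain_index[of "[i, j, k, l]"] by auto
    consider "k \<notin> {i, j}" "l \<notin> {i, j}" | "k = i" "l \<noteq> j" | "k = j" "l \<noteq> i" | "l = i" "k \<noteq> j" | "l =
      j" "k \<noteq> i"
      using ne by auto
    then show False
    proof cases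
      case 1
      then show False using P1[OF kl] P4[OF ij kl] eq by simp
    next
      case 2
      then show False using P2[OF kl, of j] P3[OF ij, of l] eq ij kl by auto
    next
      case 3
      then show False using P2[OF kl, of m] P4[OF ij, of l m] eq ij kl m by auto
    next
      case 4
      then show False using P2[OF ij, of m] P4[OF kl, of j m] eq ij kl m by auto
    next
      case 5
      then show False using P1[OF kl] P3[OF ij, of k] eq ij kl by auto
    qed
  qed
  define I where "I = ({(0,1), (0,2), (0,3), (0,4), (1,2), (1,3), (1,4), (2,3), (2,4), (3,4)} ::
    (nat \<times> nat) set)"
  have I: "i < 5 \<and> j < 5 \<and> i < j" if "(i, j) \<in> I" for i j :: nat
    using that by (auto simp: I_def)
  have "inj_on (\<lambda>(i, j). z i j) I"
  proof (rule inj_onI, clarify)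
    fix i j k l :: nat assume *: "(i, j) \<in> I" "(k, l) \<in> I" "z i j = z k l"
    then have "{i, j} = {k, l}" using I[OF *(1)] I[OF *(2)] by (intro uniq) auto
    then show "i = k \<and> j = l" using I[OF *(1)] I[OF *(2)] by (auto simp: doubleton_eq_iff)
  qed
  moreover have "(\<lambda>(i, j). z i j) ` I \<subseteq> A"
  proof clarify
    fix i j assume "(i, j) \<in> I"
    then show "z i j \<in> A" using I[of i j] by (intro z) auto
  qed
  ultimately have "card I \<le> card A" using fin by (intro card_inj_on_le)
  then show ?thesis by (simp add: I_def)
qed

lemma obtain_letter:
  assumes "length xs < 5" obtains c :: "nat letter" where "fst c < 5" "fst c \<notin> set xs"
  using obtain_index[OF assms] by (metis fst_conv)

locale paired_action = transvection_action +
  assumes card_E: "i < 5 \<Longrightarrow> card (E i) = 2"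
    and cover: "X - F = (\<Union>i<5. E i)"
    and card_F: "card F \<le> 7"
begin

lemma E_X: "x \<in> E i \<Longrightarrow> x \<in> X" by (simp add: E_def)

lemma E_unique: "x \<in> E i \<Longrightarrow> x \<in> E j \<Longrightarrow> i = j" by (simp add: E_def)

lemma E_F: "x \<in> E i \<Longrightarrow> x \<notin> F" by (simp add: E_def)

lemma E_d: "x \<in> E i \<Longrightarrow> even_set S \<Longrightarrow> d S x \<in> E i"
  using d_not_F[of S x] J_d[of x S] by (simp add: E_def)

lemma E_sw:
  assumes "k < 5" "l < 5" "k \<noteq> l" "x \<in> E i"
  shows "sw k l x \<in> E (transp k l i)"
  using assms sw_not_F[of k l x] J_sw[of k l x] by (simp add: E_def)

lemma E_sw_iff:
  assumes kl: "k < 5" "l < 5" "k \<noteq> l" and x: "x \<in> X"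
  shows "sw k l x \<in> E k \<longleftrightarrow> x \<in> E l"
proof
  assume "sw k l x \<in> E k"
  then have "d {k, l} x \<in> E l" using E_sw[OF kl, of "sw k l x" k] kl x by (simp add: sw_sw)
  then show "x \<in> E l" using E_d[of "d {k, l} x" l "{k, l}"] kl x by simp
qed (use E_sw[OF kl, of x l] in simp)

text \<open>On the two points of \<open>E i\<close>, the sign change omitting \<open>l\<close> is
  trivial for \<open>l = i\<close> and exchanges them otherwise; \<open>d {j, k}\<close> is the
  product of two of these.\<close>

lemma d_pair_E:
  assumes x: "x \<in> E i" and i: "i < 5" and jk: "j < 5" "k < 5" "j \<noteq> k"
  shows "d {j, k} x = x \<longleftrightarrow> i \<noteq> j \<and> i \<noteq> k"
proof -
  have xX: "x \<in> X" using x by (rule E_X)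
  have fixed: "d ({..<5} - {l}) y = y \<longleftrightarrow> l = i" if "y \<in> E i" "l < 5" for l y
    using that by (auto simp: E_def J_def)
  have "sym_diff ({..<5} - {j}) ({..<5} - {k}) = {j, k}" using jk by auto
  then have eq: "d {j, k} x = d ({..<5} - {j}) (d ({..<5} - {k}) x)"
    using d_d[of "{..<5} - {j}" "{..<5} - {k}" x] jk xX by simp
  have kE: "d ({..<5} - {k}) x \<in> E i" and jE: "d ({..<5} - {j}) (d ({..<5} - {k}) x) \<in> E i"
    using x jk by (simp_all add: E_d)
  obtain p q where pq: "E i = {p, q}" "p \<noteq> q" using card_E[OF i] by (auto simp: card_2_iff)
  show ?thesis
    using fixed[OF x jk(2)] fixed[OF kE jk(1)] x kE jE jk(3) unfolding eq pq(1) by auto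
qed

text \<open>For \<open>m\<close> off the transvection, \<open>d {m, p}\<close> commutes with it and
  moves \<open>x\<close>. So the image is moved by both \<open>d {k, p}\<close> and
  \<open>d {l, p}\<close>, and \<open>p\<close> is the only index that these share.\<close>

lemma t_E_closed:
  assumes ab: "indep 5 a b" and p: "p < 5" "p \<notin> {fst a, fst b}" and x: "x \<in> E p"
  shows "t a b x \<in> E p"
proof -
  obtain k where k: "k < 5" "k \<notin> {fst a, fst b, p}"
    using obtain_index[of "[fst a, fst b, p]"] by auto
  obtain l where l: "l < 5" "l \<notin> {fst a, fst b, p, k}"
    using obtain_index[of "[fst a, fst b, p, k]"] by auto
  have xX: "x \<in> X" using x by (rule E_X)
  have moved: "d {m, p} (t a b x) \<noteq> t a b x" if "m < 5" "m \<notin> {fst a, fst b, p}" for m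
  proof -
    have ev: "even_set {m, p}" using that p by simp
    have "d {m, p} (t a b x) = t a b (d {m, p} x)"
      using that p ab xX ev by (intro d_t_commute) auto
    moreover have "d {m, p} x \<noteq> x" using d_pair_E[OF x p(1)] that p by auto
    ultimately show ?thesis using ab xX ev by (simp add: t_inj d_closed)
  qed
  have "even_set {k, p}" using k p by simp
  then have "t a b x \<in> X - F" using moved[OF k] t_closed[OF ab xX] unfolding F_def by blast
  then obtain q where q: "q < 5" "t a b x \<in> E q" using cover by auto
  have "q \<in> {k, p}" "q \<in> {l, p}"
    using d_pair_E[OF q(2,1), of k p] d_pair_E[OF q(2,1), of l p] moved[of k] moved[of l] k l p
      by auto
  then show ?thesis using q l by auto
qed

lemma t_inj_on_E: "indep 5 a b \<Longrightarrow> inj_on (t a b) (E i)"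
  by (auto simp: inj_on_def t_inj E_X)

text \<open>With a further index for \<open>b\<close>, the maps \<open>t a b\<close> and
  \<open>t b c\<close> permute the two points of \<open>E p\<close>. Such permutations commute, so
  the Steinberg relation leaves only \<open>t a c\<close>.\<close>

lemma t_E:
  assumes ac: "indep 5 a c" and p: "p < 5" "p \<notin> {fst a, fst c}" and x: "x \<in> E p"
  shows "t a c x = x"
proof -
  obtain b :: "nat letter" where b: "fst b < 5" "fst b \<notin> {fst a, fst c, p}"
    using obtain_letter[of "[fst a, fst c, p]"] by auto
  have ab: "indep 5 a b" and bc: "indep 5 b c" using ac b by (auto simp: indep_def)
  define y where "y = t (inv_letter a) b x"
  have y: "y \<in> E p" unfolding y_def using ab p b x by (intro t_E_closed) auto
  have x': "t a b y = x" using ab E_X[OF x] by (simp add: y_def t_inv')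
  have "t a b (t b c y) = t b c (t a b y)"
  proof (rule two_commute[OF card_E[OF p(1)]])
    show "t a b ` E p \<subseteq> E p" "t b c ` E p \<subseteq> E p"
      using t_E_closed[OF ab p(1)] t_E_closed[OF bc p(1)] p b by auto
  qed (use ab bc y t_inj_on_E in auto)
  moreover have "t a b (t b c y) = t b c (t a c (t a b y))"
    using ab bc ac E_X[OF y] by (intro t_steinberg) (auto simp: indep_def)
  ultimately show ?thesis using t_inj[OF bc] x' ac E_X[OF x] by (simp add: t_closed)
qed

lemma mu_swap_E:
  assumes ab: "indep 5 a b" and p: "p < 5" "p \<notin> {fst a, fst b}" and x: "x \<in> E p"
  shows "mu (swap_letter a b) x = x"
proof -
  have "indep 5 b a" using ab by (auto simp: indep_def)
  then show ?thesis using mu_swap[OF ab E_X[OF x]] t_E ab p x by simp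
qed

lemma swap_letter_other: "fst x \<notin> {fst a, fst b} \<Longrightarrow> swap_letter a b x = x"
  by (auto simp: swap_letter_def)

text \<open>By \<open>t_sign\<close>, inverting letters composes the value with some
  \<open>d S\<close>, and this \<open>d S\<close> fixes \<open>y\<close>.\<close>

lemma fixed_F:
  assumes y: "y \<in> F" and ab: "indep 5 a b"
  shows "t a b y = y \<longleftrightarrow> t (fst a, True) (fst b, True) y = y"
proof -
  have yX: "y \<in> X" using y F_X by blast
  obtain S where S: "even_set S" "t (fst a, True) (fst b, True) y = d S (t a b y)"
    by (rule t_sign[OF y ab, of "(fst a, True)" "(fst b, True)"]) simp_all
  have "d S y = y" using y S(1) by (simp add: F_def)
  then show ?thesis using S d_inj[OF S(1) t_closed[OF ab yX] yX] by simp
qed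

lemma in_F: "x \<in> X \<Longrightarrow> (\<And>q. q < 5 \<Longrightarrow> x \<notin> E q) \<Longrightarrow> x \<in> F"
  using cover by blast

text \<open>The swap of \<open>b\<close> and \<open>c\<close> fixes \<open>E (fst a)\<close>
  pointwise by \<open>mu_swap_E\<close> and conjugates \<open>t a c\<close> to \<open>t a b\<close>.
  Letters of equal index are compared through a third one.\<close>

lemma column_indep:
  assumes ab: "indep 5 a b" and ac: "indep 5 a c" and e: "e \<in> E (fst a)"
    and c: "t a c e \<in> E (fst a)"
  shows "t a b e \<in> E (fst a)"
proof -
  have step: "t a b e \<in> E (fst a)"
    if ab: "indep 5 a b" and ac: "indep 5 a c" and ne: "fst b \<noteq> fst c"
      and c: "t a c e \<in> E (fst a)" for b c
  proof -
    have bc: "indep 5 b c" using ab ac ne by (simp add: indep_def)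
    have p: "fst a < 5" "fst a \<notin> {fst b, fst c}" using ab ac by (auto simp: indep_def)
    have "mu (swap_letter b c) (t a c e) = t a b (mu (swap_letter b c) e)"
      using mu_t[OF monomial_single[OF bc] ac E_X[OF e]] swap_letter_other[of a b c] p
      by (simp add: swap_letter_def)
    then show ?thesis using mu_swap_E[OF bc p c] mu_swap_E[OF bc p e] c by simp
  qed
  obtain g :: "nat letter" where g: "fst g < 5" "fst g \<notin> {fst a, fst b, fst c}"
    using obtain_letter[of "[fst a, fst b, fst c]"] by auto
  have ag: "indep 5 a g" using g ab by (auto simp: indep_def)
  show ?thesis using step[OF ab ag _ step[OF ag ac _ c]] g by auto
qed

lemma column_closed:
  assumes ab: "indep 5 a b" and e: "e \<in> E (fst a)"
  shows "t a b e \<in> E (fst a)"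
proof (rule ccontr)
  assume bad: "t a b e \<notin> E (fst a)"
  have lt: "fst a < 5" using ab by (simp add: indep_def)
  \<comment> \<open>Conjugating by a swap carries the failure from \<open>fst a\<close> to every
    index \<open>j\<close>, and \<open>column_indep\<close> extends it to all second
    letters.\<close>
  have "\<exists>a' e'. fst a' = j \<and> e' \<in> E j \<and> (\<forall>b'. indep 5 a' b' \<longrightarrow> t a' b' e' \<notin> E j)" if j: "j < 5" for j
  proof (cases "j = fst a")
    case True
    then show ?thesis using column_indep[OF ab _ e] bad e by blast
  next
    case False
    define a' where "a' = (j, snd a)"
    obtain c :: "nat letter" where c: "fst c < 5" "fst c \<notin> {fst a, j}"
      using obtain_letter[of "[fst a, j]"] by auto
    have ac: "indep 5 a c" and ac': "indep 5 a' c" using c j lt by (auto simp: indep_def a'_def)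
    let ?m = "swap_letter (j, True) (fst a, True)"
    have m: "?m a = a'" "?m c = c" "monomial ?m"
      using False c j lt by (cases a; auto simp: a'_def swap_letter_def inv_letter_def
        monomial_single)+
    have e': "sw j (fst a) e \<in> E j" using e False j lt by (simp add: E_sw_iff E_X)
    have "t a c e \<notin> E (fst a)" using column_indep[OF ab ac e] bad by blast
    then have "sw j (fst a) (t a c e) \<notin> E j" using e False j lt ac
      by (simp add: E_sw_iff E_X t_closed)
    then have "t a' c (sw j (fst a) e) \<notin> E (fst a')"
      using mu_t[OF m(3) ac E_X[OF e]] m by (simp add: sw_def a'_def)
    then have "\<forall>b'. indep 5 a' b' \<longrightarrow> t a' b' (sw j (fst a) e) \<notin> E j"
      using column_indep[OF ac'] e' by (metis a'_def fst_conv)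
    then show ?thesis using e' by (intro exI[of _ a']) (auto simp: a'_def)
  qed
  then obtain A Y where AY: "\<And>j. j < 5 \<Longrightarrow>
    fst (A j) = j \<and> Y j \<in> E j \<and> (\<forall>b'. indep 5 (A j) b' \<longrightarrow> t (A j) b' (Y j) \<notin> E j)"
    by metis
  define z where "z j i = t (A j) (i, True) (Y j)" for j i
  have dist: "indep 5 (A j) (i, True)" if "j < 5" "i < 5" "j \<noteq> i" for i j
    using that AY[of j] by (simp add: indep_def)
  have YX: "Y j \<in> X" if "j < 5" for j using AY[OF that] E_X by blast
  have bad_moves: "t (A j) b (Y j) \<noteq> Y j" if "j < 5" "indep 5 (A j) b" for j b
    using AY[OF that(1)] that by metis
  have zX: "z j i \<in> X" if "j < 5" "i < 5" "j \<noteq> i" for i j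
    using that by (simp add: z_def t_closed dist YX)
  \<comment> \<open>\<open>t (A j) c\<close> commutes with the transvection that defines
    \<open>z j i\<close>, and it moves \<open>Y j\<close>.\<close>
  have kj: "t (A j) c (z j i) \<noteq> z j i" if "j < 5" "i < 5" "j \<noteq> i" "fst c < 5" "fst c \<notin> {i, j}"
    for i j c
  proof
    have Ac: "indep 5 (A j) c" using that AY[of j] by (auto simp: indep_def)
    assume eq: "t (A j) c (z j i) = z j i"
    have "t (A j) c (z j i) = t (A j) (i, True) (t (A j) c (Y j))"
      unfolding z_def using that AY[of j] Ac dist YX by (intro t_commute) auto
    then have "t (A j) c (Y j) = Y j"
      using eq t_inj[OF dist, of j i] that YX Ac by (simp add: z_def t_closed)
    then show False using bad_moves that Ac by blast
  qed
  \<comment> \<open>In \<open>E j\<close> the point would contradict the choice of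
    \<open>Y j\<close>. In \<open>E i\<close> it would be fixed by some \<open>t (A j) c\<close>
    according to \<open>t_E\<close>, against \<open>kj\<close>. In any other \<open>E q\<close> the
    inverse transvection would keep it there, although it leads back to \<open>Y j\<close>.\<close>
  have zF: "z j i \<in> F" if ji: "j < 5" "i < 5" "j \<noteq> i" for i j
  proof (rule in_F[OF zX[OF ji]])
    fix q :: nat assume q: "q < 5"
    show "z j i \<notin> E q"
    proof
      assume zq: "z j i \<in> E q"
      have return: "t (inv_letter (A j)) (i, True) (z j i) = Y j"
        using dist[OF ji] YX ji by (simp add: z_def t_inv)
      consider "q = j" | "q = i" | "q \<notin> {i, j}" by blast
      then show False
      proof cases
        case 1 then show False using zq AY[OF ji(1)] dist[OF ji] by (auto simp: z_def)
      next
        case 2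
        obtain c :: "nat letter" where c: "fst c < 5" "fst c \<notin> {i, j}"
          using obtain_letter[of "[i, j]"] by auto
        have "t (A j) c (z j i) = z j i"
          using zq c AY[of j] ji 2 by (intro t_E) (auto simp: indep_def)
        then show False using kj[OF ji c] by blast
      next
        case 3
        then have "Y j \<in> E q" using t_E_closed[OF _ q _ zq, of "inv_letter (A j)" "(i, True)"]
          return dist[OF ji] AY[of j] ji by auto
        then show False using AY[of j] ji E_unique 3 by blast
      qed
    qed
  qed
  have "10 \<le> card F"
  proof (rule ten_points[where z = z and P = "\<lambda>i j y. t (i, True) (j, True) y \<noteq> y"])
    show "finite F" using F_X finite_X by (rule finite_subset)
    fix j i :: nat assume ji: "j < 5" "i < 5" "j \<noteq> i"
    note d = dist[OF ji]
    note A = AY[OF ji(1)]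
    show "z j i \<in> F" using zF[OF ji] .
    have "t (A j) (i, True) (z j i) \<noteq> z j i"
      using t_inj[OF d zX[OF ji] YX[OF ji(1)]] zF[OF ji] E_F[of "Y j" j] A by (metis z_def)
    then show "t (j, True) (i, True) (z j i) \<noteq> z j i" using fixed_F[OF zF[OF ji] d] A by simp
    fix k :: nat assume k: "k < 5" "k \<notin> {j, i}"
    have ik: "indep 5 (i, True) (k, True)" "indep 5 (k, True) (i, False)" "indep 5 (A j) (k, True)"
      using k ji A by (auto simp: indep_def)
    show "t (i, True) (k, True) (z j i) \<noteq> z j i"
    proof
      assume eq: "t (i, True) (k, True) (z j i) = z j i"
      have "t (i, True) (k, True) (Y j) = Y j" by (rule t_E[OF ik(1) ji(1)]) (use k A ji in auto)
      then have "z j i = t (i, True) (k, True) (t (A j) (k, True) (z j i))"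
        using t_steinberg[OF d ik(1) _ YX[OF ji(1)]] k A by (simp add: z_def)
      then have "t (A j) (k, True) (z j i) = z j i"
        using eq t_inj[OF ik(1), of "t (A j) (k, True) (z j i)" "z j i"] zX[OF ji] ik
          by (simp add: t_closed)
      then show False using kj[OF ji, of "(k, True)"] k by auto
    qed
    \<comment> \<open>The inverted letter makes this a multiplication of the generator
      \<open>i\<close> from the other side, which commutes with the one in \<open>z j i\<close>; on
      \<open>F\<close> the sign can be restored by \<open>fixed_F\<close>.\<close>
    have "t (k, True) (i, False) (z j i) = t (A j) (i, True) (t (k, True) (i, False) (Y j))"
      unfolding z_def using ik d k A ji YX[OF ji(1)] by (intro t_commute) auto
    moreover have "t (k, True) (i, False) (Y j) = Y j"
      by (rule t_E[OF ik(2) ji(1)]) (use k A ji in auto)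
    ultimately show "\<not> t (k, True) (i, True) (z j i) \<noteq> z j i"
      using fixed_F[OF zF[OF ji] ik(2)] by (simp add: z_def)
    fix l :: nat assume l: "l < 5" "k \<noteq> l" "l \<notin> {j, i}"
    have kl: "indep 5 (k, True) (l, True)" using k l by simp
    have "t (k, True) (l, True) (z j i) = t (A j) (i, True) (t (k, True) (l, True) (Y j))"
      unfolding z_def using kl d k l A ji YX[OF ji(1)] by (intro t_commute) auto
    moreover have "t (k, True) (l, True) (Y j) = Y j" by (rule t_E[OF kl ji(1)]) (use k l A in auto)
    ultimately show "\<not> t (k, True) (l, True) (z j i) \<noteq> z j i" by (simp add: z_def)
  qed
  then show False using card_F by simp
qed

text \<open>In the Steinberg relation for \<open>a\<close>, \<open>b\<close>, \<open>c\<close> the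
  factor \<open>t b c\<close> is trivial on \<open>E (fst a)\<close> by \<open>t_E\<close>, and
  \<open>column_closed\<close> keeps the intermediate points in this set.\<close>

lemma column_fixed:
  assumes ac: "indep 5 a c" and z: "z \<in> E (fst a)"
  shows "t a c z = z"
proof -
  obtain b :: "nat letter" where b: "fst b < 5" "fst b \<notin> {fst a, fst c}"
    using obtain_letter[of "[fst a, fst c]"] by auto
  have ab: "indep 5 a b" and bc: "indep 5 b c" using ac b by (auto simp: indep_def)
  have p: "fst a < 5" "fst a \<notin> {fst b, fst c}" "fst a \<noteq> fst c" using ac b by (auto simp: indep_def)
  define y where "y = t (inv_letter a) b z"
  have y: "y \<in> E (fst a)" using column_closed[of "inv_letter a" b z] ab z by (simp add: y_def)
  have z': "t a b y = z" using ab E_X[OF z] by (simp add: y_def t_inv')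
  have "z = t b c (t a c z)"
    using t_steinberg[OF ab bc p(3) E_X[OF y]] t_E[OF bc p(1,2) y] z' by simp
  also have "\<dots> = t a c z" by (rule t_E[OF bc p(1,2) column_closed[OF ac z]])
  finally show ?thesis ..
qed

lemma row_indep:
  assumes ab: "indep 5 a b" and cb: "indep 5 c b" and e: "e \<in> E (fst b)"
    and c: "t c b e = e"
  shows "t a b e = e"
proof -
  have step: "t a b e = e"
    if ab: "indep 5 a b" and cb: "indep 5 c b" and ne: "fst a \<noteq> fst c" and c: "t c b e = e" for a c
  proof -
    have ac: "indep 5 a c" using ab cb ne by (simp add: indep_def)
    have p: "fst b < 5" "fst b \<notin> {fst a, fst c}" using ab cb by (auto simp: indep_def)
    have "mu (swap_letter a c) (t c b e) = t a b (mu (swap_letter a c) e)"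
      using mu_t[OF monomial_single[OF ac] cb E_X[OF e]] swap_letter_other[of b a c] p
      by (simp add: swap_letter_def)
    then show ?thesis using mu_swap_E[OF ac p e] c by simp
  qed
  obtain g :: "nat letter" where g: "fst g < 5" "fst g \<notin> {fst a, fst b, fst c}"
    using obtain_letter[of "[fst a, fst b, fst c]"] by auto
  have gb: "indep 5 g b" using g ab by (auto simp: indep_def)
  show ?thesis using step[OF ab gb _ step[OF gb cb _ c]] g by auto
qed

text \<open>The ten points of \<open>column_closed\<close> again, now built from the multiplied
  letter. With \<open>column_fixed\<close> available, it is contradictory already that a point is
  moved, whether or not it leaves \<open>E (fst b)\<close>.\<close>

lemma row_fixed:
  assumes ab: "indep 5 a b" and e: "e \<in> E (fst b)"
  shows "t a b e = e"
proof (rule ccontr)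
  assume bad: "t a b e \<noteq> e"
  have lt: "fst b < 5" using ab by (simp add: indep_def)
  have "\<exists>b' e'. fst b' = i \<and> e' \<in> E i \<and> (\<forall>a'. indep 5 a' b' \<longrightarrow> t a' b' e' \<noteq> e')" if i: "i < 5" for i
  proof (cases "i = fst b")
    case True
    then show ?thesis using row_indep[OF ab _ e] bad e by blast
  next
    case False
    define b' where "b' = (i, snd b)"
    obtain c :: "nat letter" where c: "fst c < 5" "fst c \<notin> {fst b, i}"
      using obtain_letter[of "[fst b, i]"] by auto
    have cb: "indep 5 c b" and cb': "indep 5 c b'" using c i lt by (auto simp: indep_def b'_def)
    let ?m = "swap_letter (i, True) (fst b, True)"
    have m: "?m b = b'" "?m c = c" "monomial ?m"
      using False c i lt by (cases b; auto simp: b'_def swap_letter_def inv_letter_def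
        monomial_single)+
    have e': "sw i (fst b) e \<in> E i" using e False i lt by (simp add: E_sw_iff E_X)
    have "t c b e \<noteq> e" using row_indep[OF ab cb e] bad by blast
    then have "sw i (fst b) (t c b e) \<noteq> sw i (fst b) e" using e False i lt cb
      by (simp add: sw_inj E_X t_closed)
    then have "t c b' (sw i (fst b) e) \<noteq> sw i (fst b) e"
      using mu_t[OF m(3) cb E_X[OF e]] m by (simp add: sw_def)
    then have "\<forall>a'. indep 5 a' b' \<longrightarrow> t a' b' (sw i (fst b) e) \<noteq> sw i (fst b) e"
      using row_indep[OF cb'] e' by (metis b'_def fst_conv)
    then show ?thesis using e' by (intro exI[of _ b']) (auto simp: b'_def)
  qed
  then obtain B Y where BY: "\<And>i. i < 5 \<Longrightarrow>
    fst (B i) = i \<and> Y i \<in> E i \<and> (\<forall>a'. indep 5 a' (B i) \<longrightarrow> t a' (B i) (Y i) \<noteq> Y i)"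
    by metis
  define z where "z i j = t (j, True) (B i) (Y i)" for i j
  have dist: "indep 5 (j, True) (B i)" if "i < 5" "j < 5" "i \<noteq> j" for i j
    using that BY[of i] by (simp add: indep_def)
  have YX: "Y i \<in> X" if "i < 5" for i using BY[OF that] E_X by blast
  have zX: "z i j \<in> X" if "i < 5" "j < 5" "i \<noteq> j" for i j
    using that by (simp add: z_def t_closed dist YX)
  have jk: "t (k, True) (j, True) (z i j) \<noteq> z i j"
    if "i < 5" "j < 5" "i \<noteq> j" "k < 5" "k \<notin> {i, j}" for i j k
  proof
    assume eq: "t (k, True) (j, True) (z i j) = z i j"
    have kj: "indep 5 (k, True) (j, True)" and kB: "indep 5 (k, True) (B i)"
      using that BY[of i] by (auto simp: indep_def)
    have "t (k, True) (j, True) (Y i) = Y i"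
      by (rule t_E[OF kj that(1)]) (use that BY[of i] in auto)
    then have "z i j = t (j, True) (B i) (t (k, True) (B i) (Y i))"
      using t_steinberg[OF kj dist[OF that(1-3)] _ YX[OF that(1)]] eq that BY[of i]
        by (auto simp: z_def)
    then have "t (k, True) (B i) (Y i) = Y i"
      using t_inj[OF dist[OF that(1-3)] YX[OF that(1)] t_closed[OF kB YX[OF that(1)]]]
        by (simp add: z_def)
    then show False using BY[OF that(1)] kB by blast
  qed
  have ne: "z i j \<noteq> Y i" if "i < 5" "j < 5" "i \<noteq> j" for i j
    using BY[OF that(1)] dist[OF that] by (simp add: z_def)
  \<comment> \<open>If the point lay in \<open>E q\<close> with \<open>q \<noteq> i\<close>, the
    inverse transvection would fix it by \<open>column_fixed\<close> or \<open>t_E\<close>, although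
    it leads back to \<open>Y i\<close>. In \<open>E i\<close> the point would contradict
    \<open>jk\<close>.\<close>
  have zF: "z i j \<in> F" if ij: "i < 5" "j < 5" "i \<noteq> j" for i j
  proof (rule in_F[OF zX[OF ij]])
    fix q :: nat assume q: "q < 5"
    show "z i j \<notin> E q"
    proof
      assume zq: "z i j \<in> E q"
      have return: "t (inv_letter (j, True)) (B i) (z i j) = Y i"
        using dist[OF ij] YX ij by (simp add: z_def t_inv)
      consider "q = i" | "q = j" | "q \<notin> {i, j}" by blast
      then show False
      proof cases
        case 1
        obtain k where k: "k < 5" "k \<notin> {i, j}"
          using obtain_index[of "[i, j]"] by auto
        have "t (k, True) (j, True) (z i j) = z i j"
          using zq k ij 1 by (intro t_E) auto
        then show False using jk[OF ij k] by blast
      next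
        case 2
        then have "t (inv_letter (j, True)) (B i) (z i j) = z i j"
          using column_fixed[of "inv_letter (j, True)" "B i" "z i j"] zq dist[OF ij] by simp
        then show False using return ne[OF ij] by simp
      next
        case 3
        then have "t (inv_letter (j, True)) (B i) (z i j) = z i j"
          using t_E[of "inv_letter (j, True)" "B i" q "z i j"] zq dist[OF ij] BY[OF ij(1)] q by auto
        then show False using return ne[OF ij] by simp
      qed
    qed
  qed
  have "10 \<le> card F"
  proof (rule ten_points[where z = z and P = "\<lambda>i j y. t (j, True) (i, True) y \<noteq> y"])
    show "finite F" using F_X finite_X by (rule finite_subset)
    fix i j :: nat assume ij: "i < 5" "j < 5" "i \<noteq> j"
    note d = dist[OF ij]
    note B = BY[OF ij(1)]
    have B_neq: "B i \<noteq> (m, s)" if "m \<noteq> i" for m s using B that by (metis fst_conv)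
    show "z i j \<in> F" using zF[OF ij] .
    have "t (j, True) (B i) (z i j) \<noteq> z i j"
      using t_inj[OF d zX[OF ij] YX[OF ij(1)]] ne[OF ij] by (metis z_def)
    then show "t (j, True) (i, True) (z i j) \<noteq> z i j" using fixed_F[OF zF[OF ij] d] B by simp
    fix k :: nat assume k: "k < 5" "k \<notin> {i, j}"
    show "t (k, True) (j, True) (z i j) \<noteq> z i j" by (rule jk[OF ij k])
    have jk': "indep 5 (j, True) (k, True)" using ij k by simp
    have "t (j, True) (k, True) (z i j) = t (j, True) (B i) (t (j, True) (k, True) (Y i))"
      unfolding z_def using jk' d k B B_neq[of k True] ij YX[OF ij(1)] by (intro t_commute) auto
    moreover have "t (j, True) (k, True) (Y i) = Y i"
      by (rule t_E[OF jk' ij(1)]) (use k B ij in auto)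
    ultimately show "\<not> t (j, True) (k, True) (z i j) \<noteq> z i j" by (simp add: z_def)
    fix l :: nat assume l: "l < 5" "k \<noteq> l" "l \<notin> {i, j}"
    have lk: "indep 5 (l, True) (k, True)" using k l by simp
    have "t (l, True) (k, True) (z i j) = t (j, True) (B i) (t (l, True) (k, True) (Y i))"
      unfolding z_def using lk d k l B B_neq[of k True] ij YX[OF ij(1)] by (intro t_commute) auto
    moreover have "t (l, True) (k, True) (Y i) = Y i" by (rule t_E[OF lk ij(1)]) (use k l B in auto)
    ultimately show "\<not> t (l, True) (k, True) (z i j) \<noteq> z i j" by (simp add: z_def)
  qed
  then show False using card_F by simp
qed

text \<open>The sign change \<open>d {0, 1}\<close> is the square of a swap, which is a product of
  transvections.\<close>

lemma contradiction: False
proof -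
  obtain e where e: "e \<in> E 0" using card_E[of 0]
    by (metis card.empty ex_in_conv zero_less_numeral zero_neq_numeral)
  have all: "t a b e = e" if "indep 5 a b" for a b
  proof -
    consider "fst a = 0" | "fst b = 0" | "0 \<notin> {fst a, fst b}" by auto
    then show ?thesis using that e by cases (simp_all add: column_fixed row_fixed t_E[OF that _ _
      e])
  qed
  have "sw 0 1 e = e" unfolding sw_def using mu_swap[of "(0, True)" "(1, True)" e] E_X[OF e]
    by (simp add: all)
  then have "d {0, 1} e = e" using sw_sw[of 0 1 e] E_X[OF e] by simp
  then show False using d_pair_E[OF e, of 0 1] by simp
qed

end

section \<open>Transvections of a free group\<close>

abbreviation free_nat :: "nat \<Rightarrow> nat letter list monoid" where
  "free_nat n \<equiv> free_group {..<n}"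

abbreviation Aut :: "nat \<Rightarrow> (nat letter list \<Rightarrow> nat letter list) monoid" where
  "Aut n \<equiv> AutoGroup (free_nat n)"

abbreviation fmult :: "'s letter list \<Rightarrow> 's letter list \<Rightarrow> 's letter list" where
  "fmult \<equiv> foldr cons_letter"

section \<open>Words as elements of the free group\<close>

definition finv :: "'s letter list \<Rightarrow> 's letter list" where
  "finv w = map inv_letter (rev w)"

lemma finv_simps [simp]: "finv [] = []" "finv (u @ v) = finv v @ finv u" "finv [a] = [inv_letter a]"
  "finv (finv u) = u" "length (finv u) = length u" "finv u = [] \<longleftrightarrow> u = []"
  by (simp_all add: finv_def rev_map comp_def)

lemma finv_Cons: "finv (a # u) = finv u @ [inv_letter a]"
  by (simp add: finv_def)

lemma reduced_finv [simp]: "reduced (finv u) \<longleftrightarrow> reduced u"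
  using reduced_inverse[of u] reduced_inverse[of "finv u"] by (auto simp: finv_def rev_map comp_def)

lemma set_finv: "fst ` set (finv u) = fst ` set u"
  by (force simp: finv_def)

lemma in_free: "w \<in> carrier (free_nat n) \<longleftrightarrow> reduced w \<and> fst ` set w \<subseteq> {..<n}"
  by (simp add: free_group_def)

lemma mult_free: "u \<otimes>\<^bsub>free_nat n\<^esub> v = fmult u v"
  by (simp add: free_group_def)

lemma fmult_finv: "reduced v \<Longrightarrow> fmult (finv u) (fmult u v) = v"
  unfolding finv_def by (rule foldr_cons_letter_inverse)

lemma fmult_Nil: "reduced u \<Longrightarrow> fmult u [] = u"
  by (rule foldr_cons_letter_Nil)

lemma fmult_assoc: "reduced w \<Longrightarrow> fmult (fmult u v) w = fmult u (fmult v w)"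
  by (rule foldr_cons_letter_assoc)

lemma finv_in_free [simp]: "finv u \<in> carrier (free_nat n) \<longleftrightarrow> u \<in> carrier (free_nat n)"
  by (simp add: in_free set_finv)

lemma inv_free: "u \<in> carrier (free_nat n) \<Longrightarrow> inv\<^bsub>free_nat n\<^esub> u = finv u"
proof (rule group.inv_equality[OF group_free_group])
  assume u: "u \<in> carrier (free_nat n)"
  then show "finv u \<otimes>\<^bsub>free_nat n\<^esub> u = \<one>\<^bsub>free_nat n\<^esub>"
    using fmult_finv[of "[]" u] by (simp add: mult_free one_free_group in_free fmult_Nil)
qed simp_all

lemma single_in_free [simp]: "[a] \<in> carrier (free_nat n) \<longleftrightarrow> fst a < n"
  by (simp add: in_free)

section \<open>Endomorphisms given by substitution of letters\<close>

definition letter_hom :: "nat \<Rightarrow> (nat letter \<Rightarrow> nat letter list) \<Rightarrow> bool" where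
  "letter_hom n s \<longleftrightarrow> (\<forall>a. fst a < n \<longrightarrow> s a \<in> carrier (free_nat n) \<and> s (inv_letter a) = finv (s a))"

lemma letter_homD:
  assumes "letter_hom n s" "fst a < n"
  shows "s a \<in> carrier (free_nat n)" "s (inv_letter a) = finv (s a)" "reduced (s a)"
  using assms unfolding letter_hom_def in_free by blast+

definition subst_word :: "(nat letter \<Rightarrow> nat letter list) \<Rightarrow> nat letter list \<Rightarrow> nat letter list" where
  "subst_word s w = foldr (\<lambda>a v. fmult (s a) v) w []"

text \<open>Restricted to the carrier because the members of \<open>auto\<close> are extensional
  functions.\<close>

definition endo :: "nat \<Rightarrow> (nat letter \<Rightarrow> nat letter list) \<Rightarrow> nat letter list \<Rightarrow> nat letter list" where
  "endo n s = restrict (subst_word s) (carrier (free_nat n))"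

lemma subst_word_simps [simp]:
  "subst_word s [] = []" "subst_word s (a # w) = fmult (s a) (subst_word s w)"
  by (simp_all add: subst_word_def)

lemma fmult_closed: "u \<in> carrier (free_nat n) \<Longrightarrow> v \<in> carrier (free_nat n) \<Longrightarrow>
  fmult u v \<in> carrier (free_nat n)"
  using monoid.m_closed[OF group.is_monoid[OF group_free_group], of u "{..<n}" v]
    by (simp add: mult_free)

lemma subst_word_closed:
  assumes "letter_hom n s" "fst ` set w \<subseteq> {..<n}" shows "subst_word s w \<in> carrier (free_nat n)"
  using assms(2)
proof (induction w)
  case (Cons a w)
  then show ?case using letter_homD(1)[OF assms(1), of a] by (simp add: fmult_closed)
qed (simp add: in_free)

lemma subst_word_cons_letter:
  assumes s: "letter_hom n s" and "fst a < n" "fst ` set w \<subseteq> {..<n}"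
  shows "subst_word s (cons_letter a w) = fmult (s a) (subst_word s w)"
proof (cases w)
  case (Cons b v)
  show ?thesis
  proof (cases "b = inv_letter a")
    case True
    have "reduced (subst_word s v)"
      using subst_word_closed[OF s, of v] assms Cons by (simp add: in_free)
    then have "fmult (finv (finv (s a))) (fmult (finv (s a)) (subst_word s v)) = subst_word s v"
      by (rule fmult_finv)
    then show ?thesis using True Cons letter_homD(2)[OF s assms(2)] by simp
  qed (simp add: Cons)
qed simp

lemma subst_word_fmult:
  assumes s: "letter_hom n s" and "fst ` set u \<subseteq> {..<n}" "fst ` set v \<subseteq> {..<n}"
  shows "subst_word s (fmult u v) = fmult (subst_word s u) (subst_word s v)"
  using assms(2)
proof (induction u)
  case (Cons a u)
  have "fst ` set (fmult u v) \<subseteq> {..<n}" using set_foldr[of u v] Cons.prems assms(3) by fastforce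
  moreover have "reduced (subst_word s v)" using subst_word_closed[OF s assms(3)]
    by (simp add: in_free)
  ultimately show ?case using Cons s by (simp add: subst_word_cons_letter fmult_assoc)
qed simp

lemma endo_hom: "letter_hom n s \<Longrightarrow> endo n s \<in> hom (free_nat n) (free_nat n)"
proof (rule homI)
  assume s: "letter_hom n s"
  fix u v assume u: "u \<in> carrier (free_nat n)" and v: "v \<in> carrier (free_nat n)"
  then have "fst ` set u \<subseteq> {..<n}" "fst ` set v \<subseteq> {..<n}" by (simp_all add: in_free)
  then show "endo n s u \<in> carrier (free_nat n)"
    "endo n s (u \<otimes>\<^bsub>free_nat n\<^esub> v) = endo n s u \<otimes>\<^bsub>free_nat n\<^esub> endo n s v"
    using u v s by (simp_all add: endo_def mult_free fmult_closed subst_word_closed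
      subst_word_fmult)
qed

lemma endo_single: "letter_hom n s \<Longrightarrow> fst a < n \<Longrightarrow> endo n s [a] = s a"
  by (simp add: endo_def fmult_Nil letter_homD(3))

lemma hom_letter_eqI:
  assumes "h \<in> hom (free_nat n) (free_nat n)" "k \<in> hom (free_nat n) (free_nat n)"
    and "\<And>a. fst a < n \<Longrightarrow> h [a] = k [a]" and "w \<in> carrier (free_nat n)"
  shows "h w = k w"
  by (rule hom_free_group_eqI[OF group_free_group assms(1,2) _ assms(4)]) (simp add: assms(3))

lemma endo_cong: "(\<And>a. fst a < n \<Longrightarrow> s a = s' a) \<Longrightarrow> endo n s = endo n s'"
proof -
  assume *: "\<And>a. fst a < n \<Longrightarrow> s a = s' a"
  have "subst_word s w = subst_word s' w" if "fst ` set w \<subseteq> {..<n}" for w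
    using that by (induction w) (auto simp: *)
  then show ?thesis by (auto simp: endo_def in_free intro!: restrict_ext)
qed

lemma letter_hom_comp:
  assumes s: "letter_hom n s" and s': "letter_hom n s'"
  shows "letter_hom n (\<lambda>a. subst_word s (s' a))"
proof -
  have "subst_word s (finv u) = finv (subst_word s u)" if u: "u \<in> carrier (free_nat n)" for u
  proof -
    interpret h: group_hom "free_nat n" "free_nat n" "endo n s"
      using s by (simp add: group_hom_def group_hom_axioms_def group_free_group endo_hom)
    have "subst_word s u \<in> carrier (free_nat n)" using subst_word_closed[OF s, of u] u
      by (simp add: in_free)
    then show ?thesis using h.hom_inv[OF u] u by (simp add: inv_free endo_def)
  qed
  then show ?thesis using letter_homD[OF s'] subst_word_closed[OF s]
    unfolding letter_hom_def by (simp add: in_free)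
qed

lemma endo_comp:
  assumes s: "letter_hom n s" and s': "letter_hom n s'"
  shows "compose (carrier (free_nat n)) (endo n s) (endo n s') = endo n (\<lambda>a. subst_word s (s' a))"
proof
  fix w
  let ?s = "\<lambda>a. subst_word s (s' a)"
  have closed: "endo n s' w \<in> carrier (free_nat n)" if "w \<in> carrier (free_nat n)" for w
    using endo_hom[OF s'] that by (auto simp: hom_def)
  show "compose (carrier (free_nat n)) (endo n s) (endo n s') w = endo n ?s w"
  proof (cases "w \<in> carrier (free_nat n)")
    case True
    have "(endo n s \<circ> endo n s') w = endo n ?s w"
    proof (rule hom_letter_eqI[OF _ _ _ True])
      show "endo n s \<circ> endo n s' \<in> hom (free_nat n) (free_nat n)"
        using hom_compose[OF endo_hom[OF s'] endo_hom[OF s]] .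
      show "endo n ?s \<in> hom (free_nat n) (free_nat n)"
        by (rule endo_hom[OF letter_hom_comp[OF s s']])
      fix a :: "nat letter" assume "fst a < n"
      then show "(endo n s \<circ> endo n s') [a] = endo n ?s [a]"
        using endo_single[OF s'] endo_single[OF letter_hom_comp[OF s s']] letter_homD(1)[OF s']
        by (simp add: endo_def[of n s])
    qed
    then show ?thesis using True by (simp add: compose_def)
  qed (simp add: compose_def endo_def)
qed

lemma endo_id: "endo n (\<lambda>a. [a]) = \<one>\<^bsub>Aut n\<^esub>"
proof -
  have "subst_word (\<lambda>a. [a]) w = w" if "reduced w" for w
    using that
  proof (induction w)
    case (Cons a w)
    then show ?case using reduced_ConsD[OF Cons.prems] by (simp add: cons_letter_reduced)
  qed simp
  then show ?thesis by (auto simp: endo_def one_AutoGroup in_free intro!: restrict_ext)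
qed

lemma endo_auto:
  assumes s: "letter_hom n s" and s': "letter_hom n s'"
    and "\<And>a. fst a < n \<Longrightarrow> subst_word s (s' a) = [a]" "\<And>a. fst a < n \<Longrightarrow> subst_word s' (s a) = [a]"
  shows "endo n s \<in> auto (free_nat n)"
proof -
  have inv: "endo n s (endo n s' w) = w" "endo n s' (endo n s w) = w"
    if "w \<in> carrier (free_nat n)" for w
    using endo_comp[OF s s', THEN fun_cong, of w] endo_comp[OF s' s, THEN fun_cong, of w]
      endo_cong[of n "\<lambda>a. subst_word s (s' a)" "\<lambda>a. [a]"] endo_cong[of n
        "\<lambda>a. subst_word s' (s a)" "\<lambda>a. [a]"]
      assms(3,4) that by (simp_all add: compose_def endo_id one_AutoGroup)
  have closed: "endo n s w \<in> carrier (free_nat n)" "endo n s' w \<in> carrier (free_nat n)"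
    if "w \<in> carrier (free_nat n)" for w
    using endo_hom[OF s'] endo_hom[OF s] that by (auto simp: hom_def)
  have "bij_betw (endo n s) (carrier (free_nat n)) (carrier (free_nat n))"
    by (rule bij_betw_byWitness[where f' = "endo n s'"]) (auto simp: inv closed)
  then show ?thesis using endo_hom[OF s] by (auto simp: auto_def Bij_def endo_def)
qed

section \<open>Transvections and signed permutations as automorphisms\<close>

definition transvection_letter :: "nat letter \<Rightarrow> nat letter \<Rightarrow> nat letter \<Rightarrow> nat letter list" where
  "transvection_letter a b x =
    (if x = b then [a, b] else if x = inv_letter b then [inv_letter b, inv_letter a] else [x])"

definition transvection :: "nat \<Rightarrow> nat letter \<Rightarrow> nat letter \<Rightarrow> nat letter list \<Rightarrow> nat letter list" where
  "transvection n a b = endo n (transvection_letter a b)"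

definition relabel :: "nat \<Rightarrow> (nat letter \<Rightarrow> nat letter) \<Rightarrow> nat letter list \<Rightarrow> nat letter list" where
  "relabel n m = endo n (\<lambda>x. [m x])"

lemma indep_neq:
  assumes "indep n a b"
  shows "a \<noteq> b" "b \<noteq> a" "a \<noteq> inv_letter b" "b \<noteq> inv_letter a" "inv_letter a \<noteq> b" "inv_letter b \<noteq> a"
  using assms by (auto simp: indep_def)

lemma letter_hom_transvection: "indep n a b \<Longrightarrow> letter_hom n (transvection_letter a b)"
  by (auto simp: letter_hom_def transvection_letter_def finv_Cons in_free indep_neq)
    (auto simp: indep_def)

lemma cancel_pair [simp]: "reduced w \<Longrightarrow> cons_letter (inv_letter a) (cons_letter a w) = w"
  using cons_letter_cancel[of w "inv_letter a"] by simp

lemma transvection_inv_letter: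
  "indep n a b \<Longrightarrow> subst_word (transvection_letter (inv_letter a) b) (transvection_letter a b x) =
    [x]"
  using indep_neq[of n a b] by (auto simp: transvection_letter_def)

lemma transvection_auto: "indep n a b \<Longrightarrow> transvection n a b \<in> auto (free_nat n)"
  unfolding transvection_def
  by (rule endo_auto[where s' = "transvection_letter (inv_letter a) b"])
    (use transvection_inv_letter[of n a b] transvection_inv_letter[of n "inv_letter a" b] in
      \<open>auto simp: letter_hom_transvection\<close>)

abbreviation Aut_mult :: "nat \<Rightarrow> _ \<Rightarrow> _ \<Rightarrow> _" where
  "Aut_mult n \<equiv> mult (Aut n)"

lemma endo_mult:
  assumes "letter_hom n s" "letter_hom n s'" "endo n s \<in> auto (free_nat n)"
    "endo n s' \<in> auto (free_nat n)"
  shows "Aut_mult n (endo n s) (endo n s') = endo n (\<lambda>a. subst_word s (s' a))"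
  using assms by (simp add: mult_AutoGroup endo_comp)

lemma transvection_mult:
  assumes "indep n a b" "indep n c e"
  shows "Aut_mult n (transvection n a b) (transvection n c e) =
    endo n (\<lambda>x. subst_word (transvection_letter a b) (transvection_letter c e x))"
  using assms transvection_auto unfolding transvection_def
    by (intro endo_mult letter_hom_transvection) auto

lemma transvection_inv:
  assumes "indep n a b"
  shows "Aut_mult n (transvection n (inv_letter a) b) (transvection n a b) = \<one>\<^bsub>Aut n\<^esub>"
  using assms by (subst transvection_mult) (auto simp: transvection_inv_letter endo_id)

text \<open>The condition \<open>b \<noteq> e\<close> admits the inverse of \<open>b\<close> for
  \<open>e\<close>: multiplications of one generator from the left and from the right
  commute.\<close>

lemma transvection_commute:
  assumes "indep n a b" "indep n c e" "fst a \<noteq> fst e" "fst c \<noteq> fst b" "b \<noteq> e"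
  shows "Aut_mult n (transvection n a b) (transvection n c e) =
    Aut_mult n (transvection n c e) (transvection n a b)"
proof -
  have "subst_word (transvection_letter a b) (transvection_letter c e x) =
      subst_word (transvection_letter c e) (transvection_letter a b x)" for x
  proof -
    have neq: "a \<noteq> e" "a \<noteq> inv_letter e" "e \<noteq> a" "inv_letter e \<noteq> a" "e \<noteq> inv_letter a"
      "inv_letter a \<noteq> e"
      "c \<noteq> b" "c \<noteq> inv_letter b" "b \<noteq> c" "inv_letter b \<noteq> c" "b \<noteq> inv_letter c" "inv_letter c \<noteq> b"
      using assms by auto
    show ?thesis
      using indep_neq[OF assms(1)] indep_neq[OF assms(2)] neq assms(5)
      by (auto simp: transvection_letter_def)
  qed
  then show ?thesis using assms by (simp add: transvection_mult)
qed

lemma letter_hom_relabel: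
  "(\<And>x. fst x < n \<Longrightarrow> fst (m x) < n) \<Longrightarrow> (\<And>x. m (inv_letter x) = inv_letter (m x)) \<Longrightarrow>
    letter_hom n (\<lambda>x. [m x])"
  by (simp add: letter_hom_def)

lemma transvection_steinberg:
  assumes "indep n a b" "indep n b c" "fst a \<noteq> fst c"
  shows "Aut_mult n (transvection n a b) (transvection n b c) =
    Aut_mult n (transvection n b c) (Aut_mult n (transvection n a c) (transvection n a b))"
proof -
  have ac: "indep n a c" using assms by (simp add: indep_def)
  have neq: "a \<noteq> c" "a \<noteq> inv_letter c" "c \<noteq> a" "inv_letter c \<noteq> a" "c \<noteq> inv_letter a"
    "inv_letter a \<noteq> c"
    using assms by auto
  interpret A: group "Aut n" by (intro group.AutoGroup group_free_group)
  have "Aut_mult n (transvection n a c) (transvection n a b) =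
      endo n (\<lambda>x. subst_word (transvection_letter a c) (transvection_letter a b x))"
    using assms ac by (simp add: transvection_mult)
  moreover have "\<dots> \<in> auto (free_nat n)"
    using A.m_closed[of "transvection n a c" "transvection n a b"] assms ac
    by (simp add: transvection_mult carrier_AutoGroup transvection_auto)
  ultimately have "Aut_mult n (transvection n b c) (Aut_mult n (transvection n a c) (transvection
    n a b)) =
      endo n (\<lambda>x. subst_word (transvection_letter b c)
        (subst_word (transvection_letter a c) (transvection_letter a b x)))"
    using assms ac transvection_auto[OF assms(2)] unfolding transvection_def
    by (simp add: endo_mult letter_hom_transvection letter_hom_comp)
  moreover have "subst_word (transvection_letter a b) (transvection_letter b c x) =
      subst_word (transvection_letter b c) (subst_word (transvection_letter a c)
        (transvection_letter a b x))" for x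
    using indep_neq[OF assms(1)] indep_neq[OF assms(2)] indep_neq[OF ac] neq
    by (auto simp: transvection_letter_def)
  ultimately show ?thesis using assms by (simp add: transvection_mult)
qed

text \<open>The determinant takes values in an abelian group, and the Steinberg relation makes the
  transvection a commutator; it takes a third index, hence \<open>n \<ge> 3\<close>.\<close>

lemma transvection_SAut:
  assumes "indep n a c" "n \<ge> 3" shows "transvection n a c \<in> carrier (SAut n)"
proof -
  have "card {fst a, fst c} < card {..<n}" using assms by (auto simp: card_insert_if)
  then have "\<not> {..<n} \<subseteq> {fst a, fst c}" using card_mono[of "{fst a, fst c}" "{..<n}"] by auto
  then obtain i where i: "i < n" "i \<notin> {fst a, fst c}" by auto
  define b where "b = (i, True)"
  have ab: "indep n a b" and bc: "indep n b c" using assms i by (auto simp: indep_def b_def)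
  define D where "D g = det (abel_mat n g)" for g
  interpret D: group_hom "Aut n" sign_img "det \<circ> abel_mat n"
    unfolding group_hom_def group_hom_axioms_def
    by (intro conjI group.AutoGroup group_free_group sign_img_is_group hom_compose[OF
      abel_mat_hom det_hom])
  have T: "transvection n a b \<in> carrier (Aut n)" "transvection n b c \<in> carrier (Aut n)"
    "transvection n a c \<in> carrier (Aut n)"
    using assms ab bc by (simp_all add: carrier_AutoGroup transvection_auto)
  have mult: "D (Aut_mult n g h) = D g * D h" if "g \<in> carrier (Aut n)" "h \<in> carrier (Aut n)" for g h
    using D.hom_mult[OF that] by (simp add: D_def sign_img_def)
  have nz: "D g \<noteq> 0" if "g \<in> carrier (Aut n)" for g
    using D.hom_closed[OF that] by (auto simp: D_def sign_img_def)
  have "fst a \<noteq> fst c" using assms(1) by (simp add: indep_def)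
  then have "D (Aut_mult n (transvection n a b) (transvection n b c)) =
      D (Aut_mult n (transvection n b c) (Aut_mult n (transvection n a c) (transvection n a b)))"
    by (rule arg_cong[OF transvection_steinberg[OF ab bc], of D])
  then have "D (transvection n a b) * D (transvection n b c) =
      D (transvection n b c) * (D (transvection n a c) * D (transvection n a b))"
    using T by (simp add: mult)
  then have "D (transvection n a c) = 1" using nz[OF T(1)] nz[OF T(2)] by simp
  then show ?thesis using T by (simp add: SAut_def kernel_def D_def sign_img_def)
qed

lemma swap_good:
  assumes "indep n a b"
  shows "fst x < n \<Longrightarrow> fst (swap_letter a b x) < n" "swap_letter a b (inv_letter x) =
    inv_letter (swap_letter a b x)"
  using assms by (auto simp: swap_letter_def indep_def)

text \<open>The free group version of writing a Weyl element of SL_2 as a product of three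
  elementary matrices.\<close>

lemma relabel_swap:
  assumes ab: "indep n a b"
  shows "relabel n (swap_letter a b) = Aut_mult n (transvection n a b)
    (Aut_mult n (transvection n (inv_letter b) a) (transvection n (inv_letter a) (inv_letter b)))"
proof -
  have ba: "indep n (inv_letter b) a" "indep n (inv_letter a) (inv_letter b)"
    using ab by (auto simp: indep_def)
  interpret A: group "Aut n" by (intro group.AutoGroup group_free_group)
  have "Aut_mult n (transvection n (inv_letter b) a) (transvection n (inv_letter a) (inv_letter
    b)) =
      endo n (\<lambda>x. subst_word (transvection_letter (inv_letter b) a) (transvection_letter
        (inv_letter a) (inv_letter b) x))"
    using ba by (simp add: transvection_mult del: indep_inv)
  moreover have "\<dots> \<in> auto (free_nat n)"
    using A.m_closed[of "transvection n (inv_letter b) a"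
      "transvection n (inv_letter a) (inv_letter b)"] ba
    by (simp add: transvection_mult carrier_AutoGroup transvection_auto del: indep_inv)
  ultimately have "Aut_mult n (transvection n a b)
      (Aut_mult n (transvection n (inv_letter b) a) (transvection n (inv_letter a) (inv_letter
        b))) =
      endo n (\<lambda>x. subst_word (transvection_letter a b) (subst_word (transvection_letter
        (inv_letter b) a)
        (transvection_letter (inv_letter a) (inv_letter b) x)))"
    using ab ba transvection_auto[OF ab] unfolding transvection_def
    by (simp add: endo_mult letter_hom_transvection letter_hom_comp del: indep_inv)
  moreover have "subst_word (transvection_letter a b) (subst_word (transvection_letter
    (inv_letter b) a)
        (transvection_letter (inv_letter a) (inv_letter b) x)) = [swap_letter a b x]" for x
    using indep_neq[OF ab] by (auto simp: transvection_letter_def swap_letter_def)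
  ultimately show ?thesis by (simp add: relabel_def)
qed

section \<open>Nielsen reduction\<close>

lemma reduced_Cons: "reduced (a # w) \<longleftrightarrow> reduced w \<and> (w \<noteq> [] \<longrightarrow> hd w \<noteq> inv_letter a)"
  by (cases w) auto

lemma reduced_append:
  "reduced (u @ v) \<longleftrightarrow> reduced u \<and> reduced v \<and> (u \<noteq> [] \<longrightarrow> v \<noteq> [] \<longrightarrow> hd v \<noteq> inv_letter (last u))"
  unfolding reduced_def successively_append_iff by auto

lemma reduced_glue: "reduced (p @ m) \<Longrightarrow> reduced (m @ q) \<Longrightarrow> m \<noteq> [] \<Longrightarrow> reduced (p @ m @ q)"
  by (auto simp: reduced_append)

lemma fmult_reduced: "reduced (u @ v) \<Longrightarrow> fmult u v = u @ v"
proof (induction u)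
  case (Cons a u)
  then have "reduced (a # (u @ v))" by simp
  then show ?case using Cons.IH cons_letter_reduced reduced_ConsD by fastforce
qed simp

lemma fmult_cancel: "reduced (finv r @ q) \<Longrightarrow> reduced (p @ q) \<Longrightarrow> fmult (p @ r) (finv r @ q) = p @ q"
  using fmult_finv[of q "finv r"] fmult_reduced[of "finv r" q] fmult_reduced[of p q]
  by (simp add: reduced_append)

lemma cancellation:
  assumes "reduced u" "reduced v"
  obtains p r q where "u = p @ r" "v = finv r @ q" "reduced (p @ q)" "fmult u v = p @ q"
  using assms
proof (induction u arbitrary: v thesis rule: rev_induct)
  case Nil
  then show ?case using Nil(1)[of "[]" "[]" v] by simp
next
  case (snoc a u)
  have u: "reduced u" using snoc.prems by (simp add: reduced_append)
  show ?case
  proof (cases "reduced ((u @ [a]) @ v)")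
    case True
    then show ?thesis using snoc.prems(1)[of "u @ [a]" "[]" v] fmult_reduced[OF True] by simp
  next
    case False
    then have v: "v \<noteq> []" "hd v = inv_letter a"
      using False snoc.prems(2,3) unfolding reduced_append[of "u @ [a]" v] by auto
    then obtain w where w: "v = inv_letter a # w" by (cases v) auto
    then have "reduced w" using snoc.prems by (simp add: reduced_Cons)
    then obtain p r q where *: "u = p @ r" "w = finv r @ q" "reduced (p @ q)" "fmult u w = p @ q"
      using snoc.IH[OF _ u] by blast
    show ?thesis
    proof (rule snoc.prems(1))
      show "u @ [a] = p @ (r @ [a])" "v = finv (r @ [a]) @ q" using * w by simp_all
      have "fmult (u @ [a]) v = fmult u w" using w \<open>reduced w\<close> by simp
      then show "fmult (u @ [a]) v = p @ q" using * by simp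
    qed (rule *)
  qed
qed

text \<open>The number of letter pairs that cancel, that is, the length of \<open>r\<close> in
  \<open>cancellation\<close>.\<close>

definition cancel :: "'s letter list \<Rightarrow> 's letter list \<Rightarrow> nat" where
  "cancel u v = (length u + length v - length (fmult u v)) div 2"

lemma cancelE:
  assumes "reduced u" "reduced v"
  obtains p r q where "u = p @ r" "v = finv r @ q" "reduced (p @ q)" "fmult u v =
    p @ q" "length r = cancel u v"
proof -
  obtain p r q where *: "u = p @ r" "v = finv r @ q" "reduced (p @ q)" "fmult u v = p @ q"
    using cancellation[OF assms] .
  then have "length r = cancel u v" by (simp add: cancel_def)
  then show ?thesis using that * by blast
qed

lemma length_fmult:
  assumes "reduced u" "reduced v"
  shows "length (fmult u v) + 2 * cancel u v = length u + length v"
proof -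
  obtain p r q where "u = p @ r" "v = finv r @ q" "fmult u v = p @ q" "length r = cancel u v"
    using cancelE[OF assms] by metis
  then show ?thesis by simp
qed

text \<open>Otherwise each letter of \<open>u\<close> would be inverse to the one in the mirrored
  position: a middle letter would be its own inverse, or the two middle letters would
  cancel.\<close>

lemma cancel_self:
  assumes u: "reduced u" "u \<noteq> []" shows "2 * cancel u u < length u"
proof (rule ccontr)
  assume not: "\<not> 2 * cancel u u < length u"
  obtain p r q where *: "u = p @ r" "u = finv r @ q" "length r = cancel u u"
    using cancelE[OF u(1) u(1)] by metis
  define L where "L = length u"
  have nth: "u ! i = inv_letter (u ! (L - 1 - i))" if i: "i < length r" for i
  proof -
    have "u ! i = finv r ! i" using *(2) i by (metis finv_simps(5) nth_append)
    also have "\<dots> = inv_letter (r ! (length r - Suc i))" using i by (simp add: finv_def rev_nth)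
    also have "r ! (length r - Suc i) = u ! (length p + (length r - Suc i))" using *(1)
      by (metis nth_append_length_plus)
    also have "length p + (length r - Suc i) = L - 1 - i" using *(1) i by (simp add: L_def)
    finally show ?thesis .
  qed
  have L: "L > 0" "2 * length r \<ge> L" using u not *(3) by (auto simp: L_def)
  show False
  proof (cases "odd L")
    case True
    then obtain k where k: "L = 2 * k + 1" by (metis oddE)
    then show False using nth[of k] L by simp
  next
    case False
    then obtain k where k: "L = 2 * k" by (metis evenE)
    then have "k > 0" using L by simp
    then obtain j where j: "k = Suc j" by (cases k) auto
    have "u ! j = inv_letter (u ! Suc j)" using nth[of j] L k j by simp
    then have "u ! Suc j = inv_letter (u ! j)" by simp
    moreover have "u ! Suc j \<noteq> inv_letter (u ! j)"
      using u(1) j k unfolding reduced_def successively_conv_nth L_def[symmetric] by simp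
    ultimately show False by simp
  qed
qed

text \<open>The letters are read as digits in base \<open>2 * n\<close>, which orders the words of
  equal length lexicographically.\<close>

definition word_code :: "nat \<Rightarrow> nat letter list \<Rightarrow> nat" where
  "word_code n w = foldl (\<lambda>c a. c * (2 * n) + (2 * fst a + (if snd a then 1 else 0))) 0 w"

lemma word_code_snoc: "word_code n (w @ [a]) =
  word_code n w * (2 * n) + (2 * fst a + (if snd a then 1 else 0))"
  by (simp add: word_code_def)

lemma word_code_append: "word_code n (u @ v) = word_code n u * (2 * n) ^ length v + word_code n v"
proof (induction v rule: rev_induct)
  case (snoc a v)
  then show ?case by (simp add: append_assoc[symmetric] word_code_snoc algebra_simps del:
    append_assoc)
qed (simp add: word_code_def)

lemma word_code_inj:
  "length u = length v \<Longrightarrow> fst ` set u \<subseteq> {..<n} \<Longrightarrow> fst ` set v \<subseteq> {..<n} \<Longrightarrow>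
    word_code n u = word_code n v \<Longrightarrow> u = v"
proof (induction u arbitrary: v rule: rev_induct)
  case (snoc a u)
  then obtain b w where v: "v = w @ [b]" by (metis length_append_singleton length_Suc_conv_rev)
  define f where "f x = 2 * fst x + (if snd x then 1 else 0)" for x :: "nat letter"
  have "f a < 2 * n" "f b < 2 * n" using snoc.prems v by (auto simp: f_def)
  moreover have eq: "word_code n u * (2 * n) + f a = word_code n w * (2 * n) + f b"
    using snoc.prems v by (simp add: word_code_snoc f_def)
  moreover define B where "B = 2 * n"
  ultimately have lt: "f a < B" "f b < B"
    and eq': "word_code n u * B + f a = word_code n w * B + f b"
    by simp_all
  have *: "(k * B + c) mod B = c" "(k * B + c) div B = k" if "c < B" for k c
    using that by auto
  have "f a = f b" "word_code n u = word_code n w"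
    using *[OF lt(1), of "word_code n u"] *[OF lt(2), of "word_code n w"] eq' by simp_all
  moreover have "a = b" using \<open>f a = f b\<close>
    by (cases a; cases b) (simp add: f_def split: if_splits; presburger)
  ultimately show ?case using snoc v by simp
qed simp

text \<open>With halves, a change near the beginning of a word leaves the code taken from its
  inverse untouched, as \<open>no_smaller_half\<close> requires.\<close>

definition half :: "'a list \<Rightarrow> 'a list" where
  "half w = take ((length w + 1) div 2) w"

lemma half_append_short:
  assumes "length u \<le> length v" shows "half (u @ v) =
    u @ take ((length u + length v + 1) div 2 - length u) v"
  using assms by (simp add: half_def)

lemma half_append_long:
  assumes "length v \<le> length u" shows "half (u @ v) = take ((length u + length v + 1) div 2) u"
  using assms by (simp add: half_def)

text \<open>The images of the letters under an automorphism that no transvection improves, neither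
  in total length nor, at equal length, in total code. A transvection changes only one image up to
  inversion, so single words are compared.\<close>

locale nielsen_minimal =
  fixes n :: nat and u :: "nat letter \<Rightarrow> nat letter list"
  assumes u_free: "fst a < n \<Longrightarrow> u a \<in> carrier (free_nat n)"
    and u_ne: "fst a < n \<Longrightarrow> u a \<noteq> []"
    and u_inv: "fst a < n \<Longrightarrow> u (inv_letter a) = finv (u a)"
    and length_min: "indep n a b \<Longrightarrow> length (u b) \<le> length (fmult (u a) (u b))"
    and code_min: "indep n a b \<Longrightarrow> length (fmult (u a) (u b)) = length (u b) \<Longrightarrow>
      word_code n (half (u b)) + word_code n (half (finv (u b))) \<le>
      word_code n (half (fmult (u a) (u b))) + word_code n (half (finv (fmult (u a) (u b))))"
begin

lemma u_reduced: "fst a < n \<Longrightarrow> reduced (u a)"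
  using u_free by (simp add: in_free)

lemma fmult_inverse: "reduced v \<Longrightarrow> reduced w \<Longrightarrow> finv (fmult v w) = fmult (finv w) (finv v)"
proof -
  assume "reduced v" "reduced w"
  then obtain p r q where *: "v = p @ r" "w = finv r @ q" "reduced (p @ q)" "fmult v w = p @ q"
    using cancellation by metis
  have "reduced (finv (p @ q))" using * by (simp only: reduced_finv)
  moreover have "reduced (finv v)" using \<open>reduced v\<close> by simp
  ultimately have "fmult (finv q @ r) (finv r @ finv p) = finv q @ finv p"
    using *(1) by (intro fmult_cancel) auto
  then show ?thesis using * by simp
qed

text \<open>If more than half of \<open>u a\<close> cancelled, the product would be shorter than
  \<open>u b\<close>. The bound by \<open>u b\<close> is the same statement for the inverse
  product.\<close>

lemma cancel_half:
  assumes "indep n a b"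
  shows "2 * cancel (u a) (u b) \<le> length (u a)" "2 * cancel (u a) (u b) \<le> length (u b)"
proof -
  have lt: "fst a < n" "fst b < n" using assms by (simp_all add: indep_def)
  note len = length_fmult[OF u_reduced[OF lt(1)] u_reduced[OF lt(2)]]
  show "2 * cancel (u a) (u b) \<le> length (u a)" using len length_min[OF assms] by linarith
  have "indep n (inv_letter b) (inv_letter a)" using assms by (auto simp: indep_def)
  from length_min[OF this] have "length (u a) \<le> length (fmult (u a) (u b))"
    using lt fmult_inverse[OF u_reduced[OF lt(1)] u_reduced[OF lt(2)]]
      by (metis u_inv finv_simps(5))
  then show "2 * cancel (u a) (u b) \<le> length (u b)" using len by linarith
qed

lemma cancel_le:
  assumes "fst a < n" "fst b < n" "b \<noteq> inv_letter a"
  shows "2 * cancel (u a) (u b) \<le> length (u a)" "2 * cancel (u a) (u b) \<le> length (u b)"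
    "fst a = fst b \<Longrightarrow> 2 * cancel (u a) (u b) < length (u a)"
    "fst a = fst b \<Longrightarrow> 2 * cancel (u a) (u b) < length (u b)"
proof -
  have "b = a" if "fst a = fst b" using letter_eq_or_inv[of b a] that assms by auto
  then have same: "2 * cancel (u a) (u b) < length (u a) \<and> 2 * cancel (u a) (u b) < length (u b)"
    if "fst a = fst b"
    using that cancel_self[OF u_reduced u_ne] assms by simp
  then show "fst a = fst b \<Longrightarrow> 2 * cancel (u a) (u b) < length (u a)"
    "fst a = fst b \<Longrightarrow> 2 * cancel (u a) (u b) < length (u b)" by simp_all
  show "2 * cancel (u a) (u b) \<le> length (u a)" "2 * cancel (u a) (u b) \<le> length (u b)"
    using same cancel_half[of a b] assms by (cases "fst a = fst b"; force simp: indep_def)+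
qed

text \<open>Nielsen's tie-breaking: if both halves of \<open>u b = P Q\<^sup>-\<^sup>1\<close> cancel against its neighbours, then
  exchanging \<open>P\<close> and \<open>Q\<close> in one neighbour keeps all lengths and lowers the code.\<close>

lemma no_smaller_half:
  assumes bc: "indep n b c" and ub: "u b = P @ finv Q" and uc: "u c = Q @ q"
    and len: "length P = length Q" "length Q \<le> length q"
    and prod: "fmult (u b) (u c) = P @ q"
  shows "word_code n Q \<le> word_code n P"
proof (rule ccontr)
  assume not: "\<not> word_code n Q \<le> word_code n P"
  have lt: "fst b < n" "fst c < n" using bc by (simp_all add: indep_def)
  define k where "k = (length Q + length q + 1) div 2 - length Q"
  have h1: "half (u c) = Q @ take k q" "half (P @ q) = P @ take k q"
    using len uc by (simp_all add: half_append_short k_def)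
  \<comment> \<open>The inverse of \<open>u c\<close> starts with the inverse of \<open>q\<close>,
    which already covers its half.\<close>
  have h2: "half (finv (u c)) = half (finv (P @ q))"
    using len uc by (simp add: half_append_long)
  have "n > 0" using lt by simp
  have "word_code n (half (u c)) \<le> word_code n (half (P @ q))"
    using code_min[OF bc] prod uc len h2 by simp
  then have "word_code n Q * (2 * n) ^ length (take k q) \<le> word_code n P * (2 * n) ^ length (take
    k q)"
    by (simp add: h1 word_code_append)
  then show False using not \<open>n > 0\<close> by simp
qed

text \<open>If nothing of \<open>u b\<close> survived, each neighbour would cancel exactly half of
  it. Then \<open>no_smaller_half\<close>, applied to \<open>b\<close>, \<open>c\<close> and to the
  inverses of \<open>b\<close>, \<open>a\<close>, gives the first half and the inverse of the second
  half the same code, so they agree and \<open>u b\<close> is not reduced.\<close>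

lemma cancel_sum_less:
  assumes lt: "fst a < n" "fst b < n" "fst c < n" and ab: "b \<noteq> inv_letter a"
    and bc: "c \<noteq> inv_letter b"
  shows "cancel (u a) (u b) + cancel (u b) (u c) < length (u b)"
proof (rule ccontr)
  assume not: "\<not> cancel (u a) (u b) + cancel (u b) (u c) < length (u b)"
  note le = cancel_le[OF lt(1,2) ab] cancel_le[OF lt(2,3) bc]
  have eq: "2 * cancel (u a) (u b) = length (u b)" "2 * cancel (u b) (u c) = length (u b)"
    using not le by linarith+
  have ne: "fst a \<noteq> fst b" "fst b \<noteq> fst c" using le(4,7) eq by auto
  obtain p1 r1 q1 where 1: "u a = p1 @ r1" "u b = finv r1 @ q1" "reduced (p1 @ q1)"
    "fmult (u a) (u b) = p1 @ q1" "length r1 = cancel (u a) (u b)"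
    using cancelE[OF u_reduced[OF lt(1)] u_reduced[OF lt(2)]] .
  obtain p2 r2 q2 where 2: "u b = p2 @ r2" "u c = finv r2 @ q2" "reduced (p2 @ q2)"
    "fmult (u b) (u c) = p2 @ q2" "length r2 = cancel (u b) (u c)"
    using cancelE[OF u_reduced[OF lt(2)] u_reduced[OF lt(3)]] .
  have "length (finv r1) = length p2"
    using arg_cong[OF 2(1), of length] 1(5) 2(5) eq by simp
  then have p2: "p2 = finv r1" "q1 = r2" using 1(2) 2(1) by simp_all
  have bc': "indep n b c" "indep n (inv_letter b) (inv_letter a)" using lt ne
    by (auto simp: indep_def)
  have "word_code n (finv r2) \<le> word_code n p2"
  proof (rule no_smaller_half[OF bc'(1), where q = q2])
    show "u b = p2 @ finv (finv r2)" using 2 by simp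
    show "length p2 = length (finv r2)" using arg_cong[OF 2(1), of length] 2(5) eq by simp
    show "length (finv r2) \<le> length q2" using arg_cong[OF 2(2), of length] 2(5) le by simp
  qed (use 2 in simp_all)
  moreover have "word_code n p2 \<le> word_code n (finv r2)"
  proof (rule no_smaller_half[OF bc'(2), where q = "finv p1"])
    show "u (inv_letter b) = finv r2 @ finv p2" using 2 lt by (simp add: u_inv)
    show "u (inv_letter a) = p2 @ finv p1" using 1 p2 lt by (simp add: u_inv)
    show "length (finv r2) = length p2" using arg_cong[OF 2(1), of length] 2(5) eq by simp
    have "length r1 \<le> length p1" using arg_cong[OF 1(1), of length] 1(5) le by simp
    then show "length p2 \<le> length (finv p1)" using p2 by simp
    show "fmult (u (inv_letter b)) (u (inv_letter a)) = finv r2 @ finv p1"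
      using fmult_inverse[OF u_reduced[OF lt(1)] u_reduced[OF lt(2)]] 1 p2 lt by (simp add: u_inv)
  qed
  moreover have "fst ` set (u b) \<subseteq> {..<n}" using u_free[OF lt(2)] by (simp add: in_free)
  then have "fst ` set p2 \<subseteq> {..<n}" "fst ` set (finv r2) \<subseteq> {..<n}" unfolding 2(1) set_finv by auto
  ultimately have "p2 = finv r2"
    using arg_cong[OF 2(1), of length] 2(5) eq by (intro word_code_inj[of _ _ n]) auto
  then have "u b = finv r2 @ r2" "r2 \<noteq> []" using 2(1) u_ne[OF lt(2)] by auto
  then show False using u_reduced[OF lt(2)]
    by (cases r2) (auto simp: finv_Cons reduced_append)
qed

lemma length_subst_word:
  assumes "reduced z" "fst ` set z \<subseteq> {..<n}"
  shows "length z \<le> length (subst_word u z)"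
proof -
  have lh: "letter_hom n u" using u_free u_inv by (simp add: letter_hom_def)
  \<comment> \<open>The surviving prefix of the first factor is longer than any cancellation with a
    preceding factor, so part of it is left when the next factor is put in front. Thus every factor
    contributes at least one letter.\<close>
  have "\<exists>k R. subst_word u (a # z) = take k (u a) @ R \<and> k \<le> length (u a) \<and> length z \<le> length R \<and>
      (\<forall>x. fst x < n \<longrightarrow> a \<noteq> inv_letter x \<longrightarrow> cancel (u x) (u a) < k)"
    if "reduced (a # z)" "fst ` set (a # z) \<subseteq> {..<n}" for a z
    using that
  proof (induction z arbitrary: a)
    case Nil
    then have a: "fst a < n" by simp
    have "cancel (u x) (u a) < length (u a)" if "fst x < n" "a \<noteq> inv_letter x" for x
    proof -
      have "0 < length (u a)" using u_ne[OF a] by simp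
      then show ?thesis using cancel_le(2)[OF that(1) a that(2)] by linarith
    qed
    then show ?case using u_reduced[OF a]
      by (intro exI[of _ "length (u a)"] exI[of _ "[]"]) (simp add: fmult_Nil)
  next
    case (Cons b z)
    have ab: "fst a < n" "fst b < n" "b \<noteq> inv_letter a" "reduced (b # z)"
      "fst ` set (b # z) \<subseteq> {..<n}"
      using Cons.prems by auto
    obtain k R where kR: "subst_word u (b # z) =
      take k (u b) @ R" "k \<le> length (u b)" "length z \<le> length R"
      "\<forall>x. fst x < n \<longrightarrow> b \<noteq> inv_letter x \<longrightarrow> cancel (u x) (u b) < k"
      using Cons.IH[OF ab(4,5)] by blast
    obtain p r q where pq: "u a = p @ r" "u b = finv r @ q" "reduced (p @ q)" "length r =
      cancel (u a) (u b)"
      using cancelE[OF u_reduced[OF ab(1)] u_reduced[OF ab(2)]] by metis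
    have k: "length r < k" using kR(4) ab(1,3) pq(4) by metis
    define m where "m = take (k - length r) q"
    have tk: "take k (u b) = finv r @ m" using pq(2) k by (simp add: m_def)
    have "0 < length m" using k kR(2) arg_cong[OF pq(2), of length]
      by (simp add: m_def del: length_greater_0_conv)
    then have "m \<noteq> []" by simp
    have "q = m @ drop (k - length r) q" by (simp add: m_def)
    then have "reduced (p @ m)" using pq(3) by (metis append_assoc reduced_append)
    have red: "reduced (finv r @ m @ R)"
      using subst_word_closed[OF lh ab(5)] kR(1) tk by (simp add: in_free)
    then have "reduced (m @ R)" by (simp add: reduced_append)
    have "fmult (p @ r) (finv r @ (m @ R)) = p @ (m @ R)"
      by (rule fmult_cancel[OF red reduced_glue[OF \<open>reduced (p @ m)\<close> \<open>reduced (m @ R)\<close> \<open>m \<noteq> []\<close>]])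
    then have "subst_word u (a # b # z) = p @ m @ R"
      using kR(1) tk pq(1) by (simp del: foldr_append)
    moreover have "p = take (length p) (u a)" using pq(1) by simp
    moreover have "length p \<le> length (u a)" using pq(1) by simp
    moreover have "length (b # z) \<le> length (m @ R)" using kR(3) \<open>m \<noteq> []\<close> by (cases m) auto
    moreover have "cancel (u x) (u a) < length p" if "fst x < n" "a \<noteq> inv_letter x" for x
      using cancel_sum_less[OF that(1) ab(1,2) that(2) ab(3)] arg_cong[OF pq(1), of length] pq(4)
        by simp
    ultimately show ?case by metis
  qed
  note main = this
  show ?thesis
  proof (cases z)
    case (Cons a w)
    have a: "fst a < n" using assms Cons by simp
    obtain k R where kR: "subst_word u (a # w) =
      take k (u a) @ R" "k \<le> length (u a)" "length w \<le> length R"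
      "\<forall>x. fst x < n \<longrightarrow> a \<noteq> inv_letter x \<longrightarrow> cancel (u x) (u a) < k"
      using main[of a w] assms Cons by blast
    have "0 < k" using kR(4) a by (metis inv_letter_neq(2) gr_zeroI not_less0)
    then show ?thesis using kR(1-3) Cons by simp
  qed simp
qed

end

section \<open>Reduction of automorphisms by transvections\<close>

definition transvections :: "nat \<Rightarrow> (nat letter list \<Rightarrow> nat letter list) set" where
  "transvections n = {transvection n a b | a b. indep n a b}"

lemma transvectionsI: "indep n a b \<Longrightarrow> transvection n a b \<in> transvections n"
  by (auto simp: transvections_def simp del: split_paired_Ex)

lemma group_AutF: "group (Aut n)"
  by (intro group.AutoGroup group_free_group)

lemma auto_hom: "h \<in> auto (free_nat n) \<Longrightarrow> h \<in> hom (free_nat n) (free_nat n)"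
  by (simp add: auto_def)

lemma auto_inj: "h \<in> auto (free_nat n) \<Longrightarrow> inj_on h (carrier (free_nat n))"
  by (simp add: auto_def Bij_def bij_betw_def)

lemma auto_surj: "h \<in> auto (free_nat n) \<Longrightarrow> h ` carrier (free_nat n) = carrier (free_nat n)"
  by (simp add: auto_def Bij_def bij_betw_def)

lemma auto_group_hom: "h \<in> auto (free_nat n) \<Longrightarrow> group_hom (free_nat n) (free_nat n) h"
  by (simp add: group_hom_def group_hom_axioms_def group_free_group auto_hom)

lemma auto_Nil: "h \<in> auto (free_nat n) \<Longrightarrow> h [] = []"
  using group_hom.hom_one[OF auto_group_hom] by (simp add: one_free_group)

lemma Nil_in_free [simp]: "[] \<in> carrier (free_nat n)"
  by (simp add: in_free)

lemma auto_letter: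
  assumes h: "h \<in> auto (free_nat n)" and a: "fst a < n"
  shows "h [a] \<in> carrier (free_nat n)" "h [a] \<noteq> []" "h [inv_letter a] = finv (h [a])"
proof -
  interpret h: group_hom "free_nat n" "free_nat n" h using h by (rule auto_group_hom)
  show c: "h [a] \<in> carrier (free_nat n)" using a by simp
  show "h [a] \<noteq> []" using inj_onD[OF auto_inj[OF h], of "[a]" "[]"] a auto_Nil[OF h] by auto
  show "h [inv_letter a] = finv (h [a])" using h.hom_inv[of "[a]"] a c by (simp add: inv_free)
qed

lemma letter_hom_auto: "h \<in> auto (free_nat n) \<Longrightarrow> letter_hom n (\<lambda>a. h [a])"
  unfolding letter_hom_def using auto_letter[of h n] by blast

lemma auto_subst_word:
  assumes h: "h \<in> auto (free_nat n)" and w: "w \<in> carrier (free_nat n)"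
  shows "h w = subst_word (\<lambda>a. h [a]) w"
proof -
  have "h w = endo n (\<lambda>a. h [a]) w"
    by (rule hom_letter_eqI[OF auto_hom[OF h] endo_hom[OF letter_hom_auto[OF h]] _ w])
      (simp add: endo_single[OF letter_hom_auto[OF h]])
  then show ?thesis using w by (simp add: endo_def)
qed

lemma auto_eqI:
  assumes h: "h \<in> auto (free_nat n)" and k: "k \<in> auto (free_nat n)" and "\<And>i. i < n \<Longrightarrow>
    h [(i, True)] = k [(i, True)]"
  shows "h = k"
proof
  fix w
  show "h w = k w"
  proof (cases "w \<in> carrier (free_nat n)")
    case True
    show ?thesis
      by (rule hom_free_group_eqI[OF group_free_group auto_hom[OF h] auto_hom[OF k] _ True])
        (simp add: assms(3))
  next
    case False
    then show ?thesis using h k by (auto simp: auto_def Bij_def extensional_def)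
  qed
qed

lemma Aut_mult_single:
  assumes "h \<in> auto (free_nat n)" "k \<in> auto (free_nat n)" "fst a < n"
  shows "Aut_mult n h k [a] = h (k [a])"
  using assms by (simp add: mult_AutoGroup compose_def)

lemma mult_transvection_letter:
  assumes h: "h \<in> auto (free_nat n)" and ab: "indep n a b" and x: "fst x < n"
  shows "Aut_mult n h (transvection n a b) [x] = (if x = b then fmult (h [a]) (h [b])
    else if x = inv_letter b then finv (fmult (h [a]) (h [b])) else h [x])"
proof -
  have lt: "fst a < n" "fst b < n" using ab by (simp_all add: indep_def)
  interpret h: group_hom "free_nat n" "free_nat n" h using h by (rule auto_group_hom)
  have hab: "h [a, b] = fmult (h [a]) (h [b])"
    using h.hom_mult[of "[a]" "[b]"] lt indep_neq[OF ab] by (simp add: mult_free)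
  have "[a, b] \<in> carrier (free_nat n)" using lt indep_neq[OF ab] by (simp add: in_free)
  then have "h (finv [a, b]) = finv (h [a, b])" using h.hom_inv[of "[a, b]"] by (simp add: inv_free)
  then have "h [inv_letter b, inv_letter a] = finv (h [a, b])" by (simp add: finv_Cons)
  moreover have "transvection n a b [x] = transvection_letter a b x"
    unfolding transvection_def by (rule endo_single[OF letter_hom_transvection[OF ab] x])
  ultimately show ?thesis using hab
    by (simp add: Aut_mult_single[OF h transvection_auto[OF ab] x] transvection_letter_def)
qed

text \<open>Multiplication by a transvection on the right is an elementary Nielsen move: only the
  image of the generator of \<open>b\<close> changes. Invariance of \<open>W\<close> under inversion
  covers the case that \<open>b\<close> is a negative letter.\<close>

lemma sum_mult_transvection:
  fixes W :: "nat letter list \<Rightarrow> nat"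
  assumes h: "h \<in> auto (free_nat n)" and ab: "indep n a b" and W: "\<And>v. W (finv v) = W v"
  shows "(\<Sum>i<n. W (Aut_mult n h (transvection n a b) [(i, True)])) + W (h [b]) =
    (\<Sum>i<n. W (h [(i, True)])) + W (fmult (h [a]) (h [b]))"
proof -
  let ?h = "Aut_mult n h (transvection n a b)"
  have lt: "fst b < n" using ab by (simp add: indep_def)
  have other: "?h [(i, True)] = h [(i, True)]" if "i < n" "i \<noteq> fst b" for i
  proof -
    have "(i, True) \<noteq> b" "(i, True) \<noteq> inv_letter b" using that by (metis fst_conv fst_inv_letter)+
    then show ?thesis using that mult_transvection_letter[OF h ab, of "(i, True)"] by simp
  qed
  have "(fst b, True) = b \<or> (fst b, True) = inv_letter b" by (rule letter_eq_or_inv) simp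
  then have W_b: "W (?h [(fst b, True)]) = W (fmult (h [a]) (h [b]))" "W (h [(fst b, True)]) =
    W (h [b])"
    using mult_transvection_letter[OF h ab, of "(fst b, True)"] lt auto_letter(3)[OF h lt]
    by (auto simp: W)
  have "(\<Sum>i<n. W (?h [(i, True)])) = W (?h [(fst b, True)]) + (\<Sum>i\<in>{..<n} - {fst b}. W (?h [(i,
    True)]))"
    using lt by (intro sum.remove) auto
  also have "(\<Sum>i\<in>{..<n} - {fst b}. W (?h [(i, True)])) = (\<Sum>i\<in>{..<n} - {fst b}. W (h [(i, True)]))"
    by (rule sum.cong) (use other in auto)
  moreover have "(\<Sum>i<n. W (h [(i, True)])) =
    W (h [(fst b, True)]) + (\<Sum>i\<in>{..<n} - {fst b}. W (h [(i, True)]))"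
    using lt by (intro sum.remove) auto
  ultimately show ?thesis using W_b by simp
qed

text \<open>For a minimal member of \<open>Q\<close>, \<open>length_subst_word\<close> says that
  images are at least as long as their arguments. So the preimage of a letter, which exists by
  surjectivity, is itself a letter.\<close>

lemma minimal_auto_length_1:
  assumes Q: "Q \<subseteq> auto (free_nat n)" "Q \<noteq> {}"
    and closed: "\<And>h a b. h \<in> Q \<Longrightarrow> indep n a b \<Longrightarrow> Aut_mult n h (transvection n a b) \<in> Q"
  obtains h where "h \<in> Q" "\<And>y. fst y < n \<Longrightarrow> \<exists>x. fst x < n \<and> h [x] = [y]"
proof -
  define K where "K v = word_code n (half v) + word_code n (half (finv v))"
    for v :: "nat letter list"
  define L where "L h = (\<Sum>i<n. length (h [(i, True)]))" for h :: "nat letter list \<Rightarrow> nat letter list"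
  define C where "C h = (\<Sum>i<n. K (h [(i, True)]))" for h :: "nat letter list \<Rightarrow> nat letter list"
  obtain h1 where h1: "h1 \<in> Q" "\<And>h. h \<in> Q \<Longrightarrow> L h1 \<le> L h"
    using Q(2) ex_has_least_nat[of "\<lambda>h. h \<in> Q" _ L] by blast
  obtain h where h: "h \<in> Q" "L h = L h1" "\<And>h'. h' \<in> Q \<Longrightarrow> L h' = L h1 \<Longrightarrow> C h \<le> C h'"
    using h1 ex_has_least_nat[of "\<lambda>h. h \<in> Q \<and> L h = L h1" h1 C] by blast
  have ha: "h \<in> auto (free_nat n)" using h Q by blast
  interpret nielsen_minimal n "\<lambda>a. h [a]"
  proof
    fix a :: "nat letter" assume "fst a < n"
    then show "h [a] \<in> carrier (free_nat n)" "h [a] \<noteq> []" "h [inv_letter a] = finv (h [a])"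
      by (rule auto_letter[OF ha])+
  next
    fix a b assume ab: "indep n a b"
    let ?h = "Aut_mult n h (transvection n a b)"
    have hQ: "?h \<in> Q" using closed h ab by blast
    have eqL: "L ?h + length (h [b]) = L h + length (fmult (h [a]) (h [b]))"
      unfolding L_def by (rule sum_mult_transvection[OF ha ab]) simp
    then show "length (h [b]) \<le> length (fmult (h [a]) (h [b]))" using h1(2)[OF hQ] h(2) by simp
    assume "length (fmult (h [a]) (h [b])) = length (h [b])"
    then have "C h \<le> C ?h" using h(2) eqL by (intro h(3) hQ) simp
    moreover have "C ?h + K (h [b]) = C h + K (fmult (h [a]) (h [b]))"
      unfolding C_def by (rule sum_mult_transvection[OF ha ab]) (simp add: K_def)
    ultimately show "word_code n (half (h [b])) + word_code n (half (finv (h [b]))) \<le>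
      word_code n (half (fmult (h [a]) (h [b]))) + word_code n (half (finv (fmult (h [a]) (h
        [b]))))"
      unfolding K_def by linarith
  qed
  have "\<exists>x. fst x < n \<and> h [x] = [y]" if y: "fst y < n" for y
  proof -
    have "[y] \<in> h ` carrier (free_nat n)" using y auto_surj[OF ha] by simp
    then obtain w where w: "w \<in> carrier (free_nat n)" "h w = [y]" by auto
    then have "length w \<le> 1" using length_subst_word[of w] auto_subst_word[OF ha w(1)]
      by (simp add: in_free)
    moreover have "w \<noteq> []" using w auto_Nil[OF ha] by auto
    ultimately obtain x where "w = [x]" by (cases w) auto
    then show ?thesis using w by (intro exI[of _ x]) simp
  qed
  then show ?thesis using that h(1) by blast
qed

lemma relabel_single:
  assumes "indep n a b" "fst x < n"
  shows "relabel n (swap_letter a b) [x] = [swap_letter a b x]"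
  unfolding relabel_def using assms swap_good[OF assms(1)]
  by (intro endo_single letter_hom_relabel) auto

lemma relabel_swap_generate:
  assumes ab: "indep n a b"
  shows "relabel n (swap_letter a b) \<in> generate (Aut n) (transvections n)"
proof -
  have "indep n (inv_letter b) a" using ab by (auto simp: indep_def)
  then show ?thesis using ab unfolding relabel_swap[OF ab]
    by (intro generate.eng generate.incl transvectionsI) simp_all
qed

lemma transvections_auto: "transvections n \<subseteq> carrier (Aut n)"
  by (auto simp: transvections_def carrier_AutoGroup transvection_auto)

lemma det_flip:
  assumes h: "h \<in> auto (free_nat n)" and i: "i < n" "h [(i, True)] = [(i, False)]"
    and other: "\<And>k. k < n \<Longrightarrow> k \<noteq> i \<Longrightarrow> h [(k, True)] = [(k, True)]"
  shows "det (abel_mat n h) = - 1"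
proof -
  have entry: "abel_mat n h $$ (r, c) = (if r = c then if r = i then - 1 else 1 else 0)"
    if "r < n" "c < n" for r c
    using that i(2) other[of c] by (auto simp: abel_mat_def abel_vec_def exp_sum_Cons)
  have "upper_triangular (abel_mat n h)"
    using entry by (auto simp: upper_triangular_def abel_mat_def)
  then have "det (abel_mat n h) = (\<Prod>r = 0..<n. abel_mat n h $$ (r, r))"
    by (subst det_upper_triangular[of _ n]) (auto simp: prod_list_diag_prod abel_mat_def)
  also have "\<dots> = (\<Prod>r = 0..<n. if r = i then - 1 else 1)"
    by (rule prod.cong) (auto simp: entry)
  also have "\<dots> = - 1" using i(1) by (simp add: prod.delta)
  finally show ?thesis .
qed

text \<open>Nielsen reduction within the coset of \<open>g\<close> leaves a signed permutation of
  the letters. Swaps put the generators in place, squares of swaps remove the sign changes in pairs,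
  and the determinant excludes a single remaining one.\<close>

theorem SAut_generated:
  assumes n: "n \<ge> 3"
  shows "carrier (SAut n) \<subseteq> generate (Aut n) (transvections n)"
proof
  fix g assume g: "g \<in> carrier (SAut n)"
  let ?A = "Aut n"
  define N where "N = generate ?A (transvections n)"
  interpret A: group ?A by (rule group_AutF)
  interpret D: group_hom ?A sign_img "det \<circ> abel_mat n"
    unfolding group_hom_def group_hom_axioms_def
    by (intro conjI group_AutF sign_img_is_group hom_compose[OF abel_mat_hom det_hom])
  interpret N: subgroup N ?A unfolding N_def by (rule A.generate_is_subgroup[OF transvections_auto])
  have NS: "N \<subseteq> carrier (SAut n)"
    unfolding N_def SAut_def using transvection_SAut n
    by (simp, intro A.generate_subgroup_incl D.subgroup_kernel) (auto simp: transvections_def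
      SAut_def)
  have gA: "g \<in> carrier ?A" using g by (simp add: SAut_def kernel_def)
  \<comment> \<open>The coset of \<open>g\<close> modulo \<open>N\<close>; once it contains the
    identity, \<open>g\<close> lies in \<open>N\<close>.\<close>
  define Q where "Q = {h \<in> carrier ?A. inv\<^bsub>?A\<^esub> g \<otimes>\<^bsub>?A\<^esub> h \<in> N}"
  have Q_mult: "h \<otimes>\<^bsub>?A\<^esub> k \<in> Q" if "h \<in> Q" "k \<in> N" for h k
    using that gA N.subset by (auto simp: Q_def A.m_assoc[symmetric] subsetD)
  have gQ: "g \<in> Q" using gA by (simp add: Q_def)
  obtain h0 where h0: "h0 \<in> Q" "\<And>y. fst y < n \<Longrightarrow> \<exists>x. fst x < n \<and> h0 [x] = [y]"
  proof (rule minimal_auto_length_1[of Q n])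
    show "Q \<subseteq> auto (free_nat n)" by (auto simp: Q_def carrier_AutoGroup)
    show "Q \<noteq> {}" using gQ by blast
    show "h \<otimes>\<^bsub>?A\<^esub> transvection n a b \<in> Q" if "h \<in> Q" "indep n a b" for h a b
      using that by (intro Q_mult) (simp_all add: N_def generate.incl transvectionsI)
  qed (rule that)
  define M where "M = {h \<in> Q. \<forall>y. fst y < n \<longrightarrow> (\<exists>x. fst x < n \<and> h [x] = [y])}"
  define fixed where "fixed h = {i. i < n \<and> h [(i, True)] = [(i, True)]}"
    for h :: "nat letter list \<Rightarrow> nat letter list"
  have fin: "finite (fixed h)" "card (fixed h) \<le> n" for h
    using card_mono[of "{..<n}" "fixed h"] by (auto simp: fixed_def)
  have "h0 \<in> M" using h0 by (simp add: M_def)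
  \<comment> \<open>Maximality of the number of fixed generators replaces an explicit sorting
    procedure.\<close>
  then obtain h where h: "h \<in> M" "\<And>h'. h' \<in> M \<Longrightarrow> card (fixed h') \<le> card (fixed h)"
    using ex_has_greatest_nat[of "\<lambda>h. h \<in> M" h0 "\<lambda>h. card (fixed h)" "Suc n"] fin(2)
      by (auto simp: less_Suc_eq_le)
  have hQ: "h \<in> Q" and ha: "h \<in> auto (free_nat n)" using h
    by (simp_all add: M_def Q_def carrier_AutoGroup)
  have preimage: "\<exists>x. fst x < n \<and> h [x] = [y]" if "fst y < n" for y
    using h(1) that unfolding M_def by blast
  have swap: "h' \<otimes>\<^bsub>?A\<^esub> relabel n (swap_letter a b) \<in> M \<and>
      (\<forall>x. fst x < n \<longrightarrow> (h' \<otimes>\<^bsub>?A\<^esub> relabel n (swap_letter a b)) [x] = h' [swap_letter a b x])"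
    if h': "h' \<in> M" and ab: "indep n a b" for h' a b
  proof -
    have rN: "relabel n (swap_letter a b) \<in> N" unfolding N_def
      by (rule relabel_swap_generate[OF ab])
    have r: "relabel n (swap_letter a b) \<in> auto (free_nat n)" using rN N.subset
      by (auto simp: carrier_AutoGroup)
    have h'a: "h' \<in> auto (free_nat n)" using h' by (simp add: M_def Q_def carrier_AutoGroup)
    have val: "(h' \<otimes>\<^bsub>?A\<^esub> relabel n (swap_letter a b)) [x] = h' [swap_letter a b x]"
      if "fst x < n" for x
      using that by (simp add: Aut_mult_single[OF h'a r] relabel_single[OF ab])
    have "\<exists>x. fst x < n \<and> (h' \<otimes>\<^bsub>?A\<^esub> relabel n (swap_letter a b)) [x] = [y]" if y: "fst y < n" for y
    proof -
      obtain x where x: "fst x < n" "h' [x] = [y]" using h' y unfolding M_def by blast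
      have "indep n (inv_letter a) b" using ab by simp
      \<comment> \<open>\<open>swap_letter (inv_letter a) b\<close> is the inverse of
        \<open>swap_letter a b\<close>.\<close>
      define x' where "x' = swap_letter (inv_letter a) b x"
      have "swap_letter a b x' = x"
        using indep_neq[OF ab] by (auto simp: x'_def swap_letter_def)
      moreover have "fst x' < n" using swap_good(1)[OF \<open>indep n (inv_letter a) b\<close> x(1)]
        by (simp add: x'_def)
      ultimately show ?thesis using val x by metis
    qed
    then show ?thesis using val Q_mult[OF _ rN] h' by (simp add: M_def)
  qed
  have flipped: "h [(i, True)] = [(i, False)]" if i: "i < n" "i \<notin> fixed h" for i
  proof -
    obtain y where y: "fst y < n" "h [y] = [(i, True)]" using preimage[of "(i, True)"] i by auto
    have "fst y = i"
    proof (rule ccontr)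
      assume ne: "fst y \<noteq> i"
      have yi: "indep n y (i, True)" using y i ne by (simp add: indep_def)
      define h' where "h' = h \<otimes>\<^bsub>?A\<^esub> relabel n (swap_letter y (i, True))"
      have h': "h' \<in> M" "\<And>x. fst x < n \<Longrightarrow> h' [x] = h [swap_letter y (i, True) x]"
        using swap[OF h(1) yi] unfolding h'_def by blast+
      have "h [(fst y, True)] \<noteq> [(fst y, True)]"
      proof -
        have "(fst y, True) = y \<or> (fst y, True) = inv_letter y" by (rule letter_eq_or_inv) simp
        then have "h [(fst y, True)] = [(i, True)] \<or> h [(fst y, True)] = [inv_letter (i, True)]"
          using y auto_letter(3)[OF ha y(1)] by auto
        then show ?thesis using ne by (auto simp: inv_letter_def)
      qed
      then have "fst y \<notin> fixed h" by (simp add: fixed_def)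
      \<comment> \<open>The swap touches only \<open>i\<close> and the index of \<open>y\<close>,
        and the latter was not fixed before.\<close>
      have "insert i (fixed h) \<subseteq> fixed h'"
      proof
        fix k assume k: "k \<in> insert i (fixed h)"
        show "k \<in> fixed h'"
        proof (cases "k = i")
          case True
          then show ?thesis using h'(2)[of "(i, True)"] y i by (simp add: fixed_def swap_letter_def)
        next
          case False
          then have kf: "k \<in> fixed h" using k by simp
          then have "k \<noteq> fst y" using \<open>fst y \<notin> fixed h\<close> by auto
          then have "swap_letter y (i, True) (k, True) = (k, True)"
            using False by (auto simp: swap_letter_def inv_letter_def)
          then show ?thesis using kf h'(2)[of "(k, True)"] by (simp add: fixed_def)
        qed
      qed
      then have "card (insert i (fixed h)) \<le> card (fixed h')" using fin by (intro card_mono)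
      then show False using h(2)[OF h'(1)] i(2) fin(1)[of h] by simp
    qed
    then have "y = (i, True) \<or> y = (i, False)" by (cases y) auto
    then have "h [(i, False)] = [(i, True)]" using y i by (auto simp: fixed_def)
    then show ?thesis using auto_letter(3)[OF ha, of "(i, False)"] i by (simp add: inv_letter_def)
  qed
  have unique: "i = j" if ij: "i < n" "j < n" "i \<notin> fixed h" "j \<notin> fixed h" for i j
  proof (rule ccontr)
    assume ne: "i \<noteq> j"
    let ?s = "swap_letter (i, True) (j, True)"
    have pair: "indep n (i, True) (j, True)" using ij ne by (simp add: indep_def)
    define h' where "h' = h \<otimes>\<^bsub>?A\<^esub> relabel n ?s"
    have h': "h' \<in> M" "\<And>x. fst x < n \<Longrightarrow> h' [x] = h [?s x]"
      using swap[OF h(1) pair] unfolding h'_def by blast+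
    define h'' where "h'' = h' \<otimes>\<^bsub>?A\<^esub> relabel n ?s"
    have h'': "h'' \<in> M" "\<And>x. fst x < n \<Longrightarrow> h'' [x] = h' [?s x]"
      using swap[OF h'(1) pair] unfolding h''_def by blast+
    have val: "h'' [x] = h [?s (?s x)]" if "fst x < n" for x
      using h''(2)[OF that] h'(2)[OF swap_good(1)[OF pair that]] by simp
    have flip: "h [(k, False)] = [(k, True)]" if "k < n" "k \<notin> fixed h" for k
      using auto_letter(3)[OF ha, of "(k, True)"] flipped[OF that] that
        by (simp add: inv_letter_def)
    have "insert i (fixed h) \<subseteq> fixed h''"
    proof
      fix k assume k: "k \<in> insert i (fixed h)"
      show "k \<in> fixed h''"
      proof (cases "k = i")
        case True
        have "?s (?s (i, True)) = (i, False)" using ne by (simp add: swap_letter_def inv_letter_def)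
        then show ?thesis using True val[of "(i, True)"] flip ij by (simp add: fixed_def)
      next
        case False
        then have kf: "k \<in> fixed h" "k \<noteq> j" using k ij by auto
        then have "?s (?s (k, True)) = (k, True)"
          using False by (simp add: swap_letter_def inv_letter_def)
        then show ?thesis using kf val[of "(k, True)"] by (simp add: fixed_def)
      qed
    qed
    then have "card (insert i (fixed h)) \<le> card (fixed h'')" using fin by (intro card_mono)
    then show False using h(2)[OF h''(1)] ij fin(1)[of h] by simp
  qed
  have gh: "inv\<^bsub>?A\<^esub> g \<otimes>\<^bsub>?A\<^esub> h \<in> N" "h \<in> carrier ?A" using hQ by (simp_all add: Q_def)
  have "(det \<circ> abel_mat n) g = 1" "(det \<circ> abel_mat n) (inv\<^bsub>?A\<^esub> g \<otimes>\<^bsub>?A\<^esub> h) = 1"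
    using g gh NS by (auto simp: SAut_def kernel_def sign_img_def)
  moreover have "h = g \<otimes>\<^bsub>?A\<^esub> (inv\<^bsub>?A\<^esub> g \<otimes>\<^bsub>?A\<^esub> h)" using gA gh by (simp add: A.m_assoc[symmetric])
  ultimately have det1: "det (abel_mat n h) = 1"
    using D.hom_mult[OF gA, of "inv\<^bsub>?A\<^esub> g \<otimes>\<^bsub>?A\<^esub> h"] gA gh by (simp add: sign_img_def)
  have "i \<in> fixed h" if i: "i < n" for i
  proof (rule ccontr)
    assume nf: "i \<notin> fixed h"
    have "h [(k, True)] = [(k, True)]" if "k < n" "k \<noteq> i" for k
      using unique[OF i that(1) nf] that by (auto simp: fixed_def)
    then have "det (abel_mat n h) = - 1" using flipped[OF i nf] by (intro det_flip[OF ha i])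
    then show False using det1 by simp
  qed
  then have "h = \<one>\<^bsub>?A\<^esub>"
    using A.one_closed by (intro auto_eqI[OF ha]) (auto simp: fixed_def carrier_AutoGroup
      one_AutoGroup)
  then have "inv\<^bsub>?A\<^esub> g \<in> N" using gh gA by simp
  then have "inv\<^bsub>?A\<^esub> (inv\<^bsub>?A\<^esub> g) \<in> N" by (rule N.m_inv_closed)
  then show "g \<in> generate ?A (transvections n)" using gA by (simp add: N_def)
qed

section \<open>Actions of the special automorphism group\<close>

context transvection_action
begin

lemma transvections_trivial:
  assumes "indep 5 a b" "x \<in> X" shows "t a b x = x"
proof (cases rule: trichotomy)
  case 1
  then show ?thesis using trivial_if_F assms by blast
next
  case (2 y)
  then show ?thesis using no_free_point by blast
next
  case 3
  then interpret paired_action X t mu by unfold_locales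
  show ?thesis using contradiction ..
qed

end

section \<open>Signed permutations of the first five generators inside the special automorphism
  group\<close>

lemma indep_mono: "n \<ge> 5 \<Longrightarrow> indep 5 a b \<Longrightarrow> indep n a b"
  by (simp add: indep_def indep_def)

lemma monomial_fst_less: "monomial m \<Longrightarrow> n \<ge> 5 \<Longrightarrow> fst x < n \<Longrightarrow> fst (m x) < n"
proof (induction arbitrary: x rule: monomial.induct)
  case (monomial_swap a b m)
  then show ?case
    using swap_good(1)[OF indep_mono[OF monomial_swap.prems(1) monomial_swap.hyps(1)]] by simp
qed simp

lemma letter_hom_monomial: "monomial m \<Longrightarrow> n \<ge> 5 \<Longrightarrow> letter_hom n (\<lambda>x. [m x])"
  by (rule letter_hom_relabel) (simp_all add: monomial_fst_less monomial_inv)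

lemma monomial_eq_iff:
  assumes m: "monomial m" shows "m x = m y \<longleftrightarrow> x = y"
proof
  assume eq: "m x = m y"
  then have "fst x = fst y" using monomial_index_map(1)[OF m] by (metis fst_monomial[OF m] injD)
  then have "x = y \<or> x = inv_letter y" by (rule letter_eq_or_inv)
  then show "x = y" using eq monomial_inv[OF m, of y] by auto
qed simp

lemma relabel_mult:
  assumes "monomial m" "monomial k" "n \<ge> 5" "relabel n m \<in> auto (free_nat n)"
    "relabel n k \<in> auto (free_nat n)"
  shows "relabel n (m \<circ> k) = Aut_mult n (relabel n m) (relabel n k)"
  using assms unfolding relabel_def by (simp add: endo_mult letter_hom_monomial)

lemma SAut_simps:
  "mult (SAut n) = Aut_mult n" "\<one>\<^bsub>SAut n\<^esub> = \<one>\<^bsub>Aut n\<^esub>"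
  by (simp_all add: SAut_def)

lemma SAut_auto: "g \<in> carrier (SAut n) \<Longrightarrow> g \<in> auto (free_nat n)"
  by (simp add: SAut_def kernel_def carrier_AutoGroup)

lemma SAut_mult_closed: "g \<in> carrier (SAut n) \<Longrightarrow> h \<in> carrier (SAut n) \<Longrightarrow>
  Aut_mult n g h \<in> carrier (SAut n)"
  using monoid.m_closed[OF group.is_monoid[OF group_SAut[of n]]] by (simp add: SAut_simps)

lemma relabel_SAut:
  assumes "monomial m" "n \<ge> 5" shows "relabel n m \<in> carrier (SAut n)"
  using assms
proof (induction rule: monomial.induct)
  case monomial_id
  have "relabel n id = \<one>\<^bsub>SAut n\<^esub>" by (simp add: relabel_def endo_id SAut_simps)
  then show ?case using monoid.one_closed[OF group.is_monoid[OF group_SAut]] by (simp only:)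
next
  case (monomial_swap a b m)
  have ab: "indep n a b" using monomial_swap by (simp add: indep_mono)
  then have "indep n b a" by (auto simp: indep_def)
  then have swap: "relabel n (swap_letter a b) \<in> carrier (SAut n)"
    using ab monomial_swap unfolding relabel_swap[OF ab]
      by (intro SAut_mult_closed transvection_SAut) auto
  have eq: "relabel n (swap_letter a b \<circ> m) =
    Aut_mult n (relabel n (swap_letter a b)) (relabel n m)"
    using monomial_swap swap by (intro relabel_mult monomial_single SAut_auto) auto
  show ?case unfolding eq using swap monomial_swap by (simp add: SAut_mult_closed)
qed

lemma relabel_transvection:
  assumes m: "monomial m" and n: "n \<ge> 5" and ab: "indep 5 a b"
  shows "Aut_mult n (relabel n m) (transvection n a b) =
    Aut_mult n (transvection n (m a) (m b)) (relabel n m)"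
proof -
  have g: "indep n a b" "indep n (m a) (m b)"
    using indep_mono[OF n] ab indep_monomial[OF m ab] by blast+
  note lh = letter_hom_monomial[OF m n] letter_hom_transvection
  have auto: "endo n (\<lambda>x. [m x]) \<in> auto (free_nat n)"
    using SAut_auto[OF relabel_SAut[OF m n]] by (simp add: relabel_def)
  have "subst_word (\<lambda>x. [m x]) (transvection_letter a b x) =
      subst_word (transvection_letter (m a) (m b)) [m x]" for x
    using indep_neq[OF g(1)] indep_neq[OF g(2)] monomial_eq_iff[OF m, of x "inv_letter b"]
    by (auto simp: transvection_letter_def monomial_eq_iff[OF m] monomial_inv[OF m] simp del:
      inv_letter_eq_iff)
  then show ?thesis
    using endo_mult[OF lh(1) lh(2)[OF g(1)] auto transvection_auto[OF g(1), unfolded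
      transvection_def]]
      endo_mult[OF lh(2)[OF g(2)] lh(1) transvection_auto[OF g(2), unfolded transvection_def] auto]
    by (simp add: relabel_def transvection_def)
qed

text \<open>Finiteness is stated besides the bound because \<open>card\<close> of an infinite set is
  0. What remains here is to pass from the first five generators to all, and from transvections to
  the whole group.\<close>

theorem corollary3p12:
  fixes n :: nat and X :: "'x set"
    and \<phi> :: "(nat letter list \<Rightarrow> nat letter list) \<Rightarrow> 'x \<Rightarrow> 'x"
  assumes "n \<ge> 5"
    and "finite X" and "card X < 18"
    and "group_action (SAut n) X \<phi>"
  shows "\<forall>g\<in>carrier (SAut n). \<phi> g = \<one>\<^bsub>BijGroup X\<^esub>"
proof -
  interpret act: group_action "SAut n" X \<phi> by (rule assms(4))
  note n = assms(1)
  have comp: "\<phi> (Aut_mult n g h) x = \<phi> g (\<phi> h x)"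
    if "x \<in> X" "g \<in> carrier (SAut n)" "h \<in> carrier (SAut n)" for g h x
    using act.composition_rule[OF that] by (simp add: SAut_simps)
  have closed: "\<phi> g x \<in> X" if "x \<in> X" "g \<in> carrier (SAut n)" for g x
    using act.element_image[OF that(2,1)] by simp
  have act_one: "\<phi> \<one>\<^bsub>Aut n\<^esub> x = x" if "x \<in> X" for x
    using act.id_eq_one that by (metis SAut_simps(2) restrict_apply')
  define t where "t a b = \<phi> (transvection n a b)" for a b
  define mu where "mu m = \<phi> (relabel n m)" for m
  have T: "transvection n a b \<in> carrier (SAut n)" if "indep n a b" for a b
    using that n by (simp add: transvection_SAut)
  have gp: "indep n a b" if "indep 5 a b" for a b
    using indep_mono[OF n that] .
  have steinberg: "t a b (t b c x) = t b c (t a c (t a b x))"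
    if "indep n a b" "indep n b c" "fst a \<noteq> fst c" "x \<in> X" for a b c x
  proof -
    have "indep n a c" using that by (simp add: indep_def)
    then show ?thesis using arg_cong[OF transvection_steinberg[OF that(1-3)], of "\<lambda>g. \<phi> g x"] that
      by (simp add: t_def comp T SAut_mult_closed closed)
  qed
  interpret A: transvection_action X t mu
  proof
    show "finite X" "card X < 18" by fact+
  next
    fix x assume "x \<in> X"
    then show "mu id x = x" by (simp add: mu_def relabel_def endo_id act_one)
  next
    fix a b x assume ab: "indep 5 a b" and x: "x \<in> X"
    note g = gp[OF ab]
    show "t a b x \<in> X" using g x by (simp add: t_def closed T)
    show "t (inv_letter a) b (t a b x) = x"
      using arg_cong[OF transvection_inv[OF g], of "\<lambda>g. \<phi> g x"] g x
        by (simp add: t_def comp T act_one)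
    have ba: "indep n (inv_letter b) a" and ab': "indep n (inv_letter a) (inv_letter b)"
      using g by (auto simp: indep_def)
    show "mu (swap_letter a b) x = t a b (t (inv_letter b) a (t (inv_letter a) (inv_letter b) x))"
      unfolding mu_def relabel_swap[OF g] t_def
      using T[OF g] T[OF ba] T[OF ab'] x by (simp add: comp SAut_mult_closed closed)
    show "t a b (t b c x) = t b c (t a c (t a b x))" if "indep 5 b c" "fst a \<noteq> fst c" for c
      using steinberg[OF g gp[OF that(1)] that(2) x] .
    show "t a b (t c e x) = t c e (t a b x)"
      if "indep 5 c e" "fst a \<noteq> fst e" "fst c \<noteq> fst b" "b \<noteq> e" for c e
      using arg_cong[OF transvection_commute[OF g gp[OF that(1)] that(2-4)], of "\<lambda>g. \<phi> g x"]
        g gp[OF that(1)] x by (simp add: t_def comp T)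
  next
    fix m x assume m: "monomial m" and x: "x \<in> X"
    note r = relabel_SAut[OF _ n]
    show "mu m x \<in> X" using r[OF m] x by (simp add: mu_def closed)
    show "mu (m \<circ> k) x = mu m (mu k x)" if "monomial k" for k
      using that m x n r by (simp add: mu_def relabel_mult SAut_auto comp del: comp_apply)
    show "mu m (t a b x) = t (m a) (m b) (mu m x)" if ab: "indep 5 a b" for a b
      using arg_cong[OF relabel_transvection[OF m n ab], of "\<lambda>g. \<phi> g x"] x r[OF m] gp[OF ab]
        gp[OF indep_monomial[OF m ab]] by (simp add: mu_def t_def comp T)
  qed
  have small: "t a b x = x" if "fst a < 5" "fst b < 5" "fst a \<noteq> fst b" "x \<in> X" for a b x
    using A.transvections_trivial that by (simp add: indep_def)
  have t_inj: "x = y" if "t a b x = t a b y" "indep n a b" "x \<in> X" "y \<in> X" for a b x y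
    using act.inj_prop[OF T[OF that(2)]] that by (auto simp: t_def inj_on_def)
  have t_closed: "t a b x \<in> X" if "indep n a b" "x \<in> X" for a b x
    using that by (simp add: t_def closed T)
  \<comment> \<open>A trivial outer factor in the Steinberg relation makes \<open>t a c\<close>
    trivial; \<open>right\<close> does the same from the other side.\<close>
  have left: "t a c x = x"
    if "indep n a b" "indep n b c" "fst a \<noteq> fst c" "\<And>x. x \<in> X \<Longrightarrow> t a b x = x" "x \<in> X" for a b c x
  proof -
    have ac: "indep n a c" using that by (simp add: indep_def)
    have "t b c x = t b c (t a c x)" using steinberg[OF that(1-3,5)] that t_closed by simp
    then show ?thesis using t_inj that ac t_closed by metis
  qed
  have right: "t a c x = x"
    if "indep n a b" "indep n b c" "fst a \<noteq> fst c" "\<And>x. x \<in> X \<Longrightarrow> t b c x = x" "x \<in> X" for a b c x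
  proof -
    have ac: "indep n a c" using that by (simp add: indep_def)
    have "x \<in> t a b ` X" using act.surj_prop[OF T[OF that(1)]] that(5) by (simp add: t_def)
    then obtain y where y: "y \<in> X" "t a b y = x" by blast
    show ?thesis using steinberg[OF that(1-3) y(1)] y that t_closed ac by simp
  qed
  \<comment> \<open>A middle letter \<open>b\<close> among the first five generators links
    \<open>t a c\<close> to \<open>t b c\<close>, whose multiplying letter is small;
    \<open>low\<close> treats that one through a second small letter.\<close>
  have all: "t a c x = x" if ac: "indep n a c" and x: "x \<in> X" for a c x
  proof -
    obtain b :: "nat letter" where b: "fst b < 5" "fst b \<notin> {fst a, fst c}"
      using obtain_letter[of "[fst a, fst c]"] by auto
    have ab: "indep n a b" and bc: "indep n b c" and ne: "fst a \<noteq> fst c"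
      using ac b n by (auto simp: indep_def)
    have low: "t a c x = x" if "fst a < 5" "indep n a c" "x \<in> X" for a c x
    proof (cases "fst c < 5")
      case True
      then show ?thesis using small that by (simp add: indep_def)
    next
      case False
      obtain b :: "nat letter" where b: "fst b < 5" "fst b \<notin> {fst a}"
        using obtain_letter[of "[fst a]"] by auto
      then have ab: "indep n a b" and bc: "indep n b c" and ne: "fst a \<noteq> fst c"
        using that False n by (auto simp: indep_def)
      show ?thesis using left[OF ab bc ne _ that(3)] small that(1) b by auto
    qed
    show ?thesis using right[OF ab bc ne _ x] low[OF b(1) bc] by blast
  qed
  define K where "K = {g \<in> carrier (SAut n). \<forall>x\<in>X. \<phi> g x = x}"
  interpret S: group "SAut n" by (rule group_SAut)
  interpret Aut: group "Aut n" by (rule group_AutF)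
  have "generate (Aut n) (transvections n) \<subseteq> K"
  proof
    fix g assume "g \<in> generate (Aut n) (transvections n)"
    then show "g \<in> K"
    proof (induction rule: generate.induct)
      case one
      then show ?case using act_one S.one_closed by (simp add: K_def SAut_simps)
    next
      case (incl h)
      then show ?case using all T by (auto simp: transvections_def K_def t_def simp del:
        split_paired_All)
    next
      case (inv h)
      then obtain a b where ab: "h = transvection n a b" "indep n a b"
        by (auto simp: transvections_def)
      have "inv\<^bsub>Aut n\<^esub> h = transvection n (inv_letter a) b"
        using transvection_inv[OF ab(2)] ab
          by (intro Aut.inv_equality) (auto simp: carrier_AutoGroup transvection_auto)
      then show ?case using ab all[of "inv_letter a" b] T[of "inv_letter a" b]
        by (simp add: K_def t_def)
    next
      case (eng g h)
      then show ?case by (simp add: K_def comp SAut_mult_closed)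
    qed
  qed
  then have K: "g \<in> K" if "g \<in> carrier (SAut n)" for g
    using SAut_generated[of n] n that by auto
  show ?thesis
  proof
    fix g assume g: "g \<in> carrier (SAut n)"
    \<comment> \<open>Equality with the identity of \<open>BijGroup X\<close> also concerns
      arguments outside \<open>X\<close>, where extensionality fixes the value.\<close>
    have "\<phi> g \<in> extensional X" using act.bij_prop0[OF g] by (simp add: Bij_def)
    then show "\<phi> g = \<one>\<^bsub>BijGroup X\<^esub>"
      using K[OF g] by (auto simp: K_def BijGroup_def extensional_def fun_eq_iff)
  qed
qed

end
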